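(* For all $\lambda|\mu,\ \xi|\eta\in\Lambda(m|n,r)$ the map $$\partial^{+,-}_{\lambda|\mu,\xi|\eta}:\ \mathfrak D^{+,-}_{\lambda|\mu,\xi|\eta}\longrightarrow\bigcup_{\nu\in\Lambda^+(r)_{m|n}}\mathbf T^{sss}(\nu,\lambda|\mu)\times\mathbf T^{sss}(\nu,\xi|\eta),\qquad w\longmapsto(\mathsf S_w,\mathsf T_w),$$ is a bijection. These maps induce a bijection $$M(m|n,r)\longrightarrow\bigcup_{\lambda|\mu,\ \xi|\eta\in\Lambda(m|n,r),\ \nu\in\Lambda^+(r)_{m|n}}\mathbf T^{sss}(\nu,\lambda|\mu)\times\mathbf T^{sss}(\nu,\xi|\eta),\qquad A\longmapsto(\mathsf S(A),\mathsf T(A)).$$ Moreover, if $A\mapsto(\mathsf S,\mathsf T)$ under this bijection, then $A^t\mapsto(\mathsf T,\mathsf S)$, where $A^t$ is the transpose of $A$.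
   Context: Let $m,n\ge 0$ be integers, not both zero, and $r\ge1$. $\mathfrak S_r$ is the symmetric group (permutations composed as functions) with simple reflections $S=\{(k,k+1)\}$ and length $l$; for $s\in S$, $sx<x$ means $l(sx)<l(x)$. $\hat i=0$ for $1\le i\le m$, $\hat i=1$ for $m<i\le m+n$. $\Lambda(N,r)$ is the set of sequences of $N$ non-negative integers with sum $r$. $\Lambda(m|n,r)$ is the set of pairs $\lambda|\mu$, $\lambda\in\mathbb N^m$, $\mu\in\mathbb N^n$, $|\lambda|+|\mu|=r$, identified with the concatenation $\lambda\vee\mu\in\Lambda(m+n,r)$. $\Lambda^+(r)$ is the set of partitions of $r$ and $\Lambda^+(r)_{m|n}=\{\nu\in\Lambda^+(r):\nu_{m+1}\le n\}$. For a composition $\nu$ of $r$, $R^\nu_k=\{\nu_1+\dots+\nu_{k-1}+1,\dots,\nu_1+\dots+\nu_k\}$, $\mathsf t^\nu$ is the tableau whose $k$-th row is $R^\nu_k$ in increasing order, and $\mathfrak S_\nu$ is its row stabilizer. Put $\lambda^*=\lambda\vee(1^{r-|\lambda|})$ and ${}^*\mu=(1^{r-|\mu|})\vee\mu$. $w_{0,\lambda}$ denotes the longest element of $\mathfrak S_{\lambda^*}$. For $\lambda|\mu\in\Lambda(m|n,r)$, $\xi|\eta\in\Lambda(m'|n',r)$, $\mathfrak D^{+,-}_{\lambda|\mu,\xi|\eta}$ is the set of $x\in\mathfrak S_r$ with $sx<x$ for $s\in S\cap\mathfrak S_{\lambda^*}$, $tx>x$ for $t\in S\cap\mathfrak S_{{}^*\mu}$,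 $xs<x$ for $s\in S\cap\mathfrak S_{\xi^*}$, $xt>x$ for $t\in S\cap\mathfrak S_{{}^*\eta}$. $M(m|n,r)$ is the set of $(m+n)\times(m+n)$ matrices $A=(a_{ij})$ over $\mathbb N$ with entry sum $r$ and $a_{ij}\in\{0,1\}$ whenever $\hat i+\hat j=1$. $\mathrm{ro}(A)$, $\mathrm{co}(A)\in\Lambda(m|n,r)$ are the sequences of row sums and of column sums. For $A\in M(m|n,r)$ with $\mathrm{ro}(A)=\lambda|\mu$, $\mathrm{co}(A)=\xi|\eta$, there is a unique $w_A^{+,-}\in\mathfrak D^{+,-}_{\lambda|\mu,\xi|\eta}$ with $a_{ij}=|R_i^{\lambda\vee\mu}\cap w_A^{+,-}R_j^{\xi\vee\eta}|$ for all $i,j$, and $(\mathrm{ro}(A),w_A^{+,-},\mathrm{co}(A))$ determines $A$. $\mathbf T^{sss}(\nu,\lambda|\mu)$ is the set of semistandard $\nu$-supertableaux of content $\lambda|\mu$: fillings of the Young diagram of $\nu$ with $\lambda_i$ entries $i$ ($1\le i\le m$) and $\mu_j$ entries $m+j$ ($1\le j\le n$), weakly increasing along rows and down columns, such that the numbers in $\{1,\dots,m\}$ strictly increase in columns and the numbers in $\{m+1,\dots,m+n\}$ strictly increase in rows. For $w\in\mathfrak S_r$, a partition $\nu$ of $r$, and a filling $T$ of the diagram of $\nu$ of content $\rho$ (a composition of $r$; $\rho_i$ entries $i$), $w_T\in\mathfrak S_r$ is the element such that $w_T(\mathsf t^\rho)$ has increasing rows and its $i$-th row consists of the entries of $w(\mathsf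 t^\nu)$ in the positions where $T$ has entry $i$ (permutations act on tableaux by acting on entries). $w\mapsto(P(w),Q(w))$ is the Robinson–Schensted correspondence (row insertion of $w(1),\dots,w(r)$; $P$ insertion, $Q$ recording tableau). $\mathsf t_{\kappa}$ is the $\kappa$-tableau filled with $1,\dots,r$ down successive columns. $\nu^t$ is the partition dual to $\nu$. $\varpi_\nu=\{x\in\mathfrak S_r: P(x)=\mathsf t_{\nu^t}\}$ is the right Kazhdan–Lusztig cell containing $w_{0,\nu}$. It is known that $\mathfrak D^{+,-}_{\nu|0,\lambda|\mu}\cap\varpi_\nu=\{(w_{0,\nu})_{\mathsf T}w_{0,\lambda}:\mathsf T\in\mathbf T^{sss}(\nu,\lambda|\mu)\}$, with distinct $\mathsf T$ giving distinct elements. Definition of $\partial^{+,-}_{\lambda|\mu,\xi|\eta}$: for $w\in\mathfrak D^{+,-}_{\lambda|\mu,\xi|\eta}$ let $\nu^t$ be the shape of $P(w)$, and let $x,y\in\mathfrak S_r$ satisfy $P(x^{-1})=P(w)$, $Q(x^{-1})=\mathsf t_{\nu^t}$, $P(y)=\mathsf t_{\nu^t}$, $Q(y)=Q(w)$. Then $x\in\mathfrak D^{+,-}_{\nu|0,\lambda|\mu}\cap\varpi_\nu$ and $y\in\mathfrak D^{+,-}_{\nu|0,\xi|\eta}\cap\varpi_\nu$, and $\mathsf S_w\in\mathbf T^{sss}(\nu,\lambda|\mu)$, $\mathsf T_w\in\mathbf T^{sss}(\nu,\xi|\eta)$ are the unique supertableaux with $x=(w_{0,\nu})_{\mathsf S_w}w_{0,\lambda}$,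 $y=(w_{0,\nu})_{\mathsf T_w}w_{0,\xi}$. The induced map on $M(m|n,r)$ is $(\mathsf S(A),\mathsf T(A))=(\mathsf S_w,\mathsf T_w)$ with $w=w_A^{+,-}$. *)

theory Defs
  imports "HOL-Combinatorics.Permutations" "Jordan_Normal_Form.Matrix"
begin

section \<open>Compositions, partitions and tableaux\<close>

text \<open>Sequences are lists, so that \<open>\<nu>\<^sub>k\<close> is \<open>\<nu> ! (k - 1)\<close>. A tableau or filling is the list of its
  rows; rows and columns (also those of matrices) are indexed from 0, whereas the entries of
  tableaux and the points permuted by the symmetric group are numbered from 1.\<close>

definition compositions :: "nat \<Rightarrow> nat \<Rightarrow> nat list set" where
  "compositions N r = {\<nu>. length \<nu> = N \<and> sum_list \<nu> = r}"

definition bicompositions :: "nat \<Rightarrow> nat \<Rightarrow> nat \<Rightarrow> (nat list \<times> nat list) set" where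
  "bicompositions m n r =
     {(lam, \<mu>). length lam = m \<and> length \<mu> = n \<and> lam @ \<mu> \<in> compositions (m + n) r}"

definition partitions :: "nat \<Rightarrow> nat list set" where
  "partitions r = {\<nu>. sorted_wrt (\<ge>) \<nu> \<and> 0 \<notin> set \<nu> \<and> sum_list \<nu> = r}"

text \<open>A partition is padded by zeros: \<open>\<nu>\<^sub>m\<^sub>+\<^sub>1 = 0\<close> if it has at most \<open>m\<close> parts.\<close>

definition hook_partitions :: "nat \<Rightarrow> nat \<Rightarrow> nat \<Rightarrow> nat list set" where
  "hook_partitions m n r = {\<nu> \<in> partitions r. (if m < length \<nu> then \<nu> ! m else 0) \<le> n}"

definition dual_partition :: "nat list \<Rightarrow> nat list" where
  "dual_partition \<nu> = map (\<lambda>j. length (filter (\<lambda>p. j < p) \<nu>)) [0..<foldr max \<nu> 0]"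

definition shape :: "nat list list \<Rightarrow> nat list" where
  "shape T = map length T"

text \<open>The tableau \<open>t\<^sup>\<nu>\<close>; the set of entries of its \<open>k\<close>-th row is \<open>R\<^sup>\<nu>\<^sub>k\<close>. Rows may be empty.\<close>

definition row_tableau :: "nat list \<Rightarrow> nat list list" where
  "row_tableau \<nu> =
     map (\<lambda>k. [sum_list (take k \<nu>) + 1..<sum_list (take (Suc k) \<nu>) + 1]) [0..<length \<nu>]"

definition row_block :: "nat list \<Rightarrow> nat \<Rightarrow> nat set" where
  "row_block \<nu> k = set (row_tableau \<nu> ! k)"

text \<open>The tableau \<open>t\<^sub>\<kappa>\<close>, numbered down successive columns, is the reflection of the row tableau of
  the dual partition in the main diagonal.\<close>

definition column_tableau :: "nat list \<Rightarrow> nat list list" where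
  "column_tableau \<kappa> =
     map (\<lambda>i. map (\<lambda>j. row_tableau (dual_partition \<kappa>) ! j ! i) [0..<\<kappa> ! i]) [0..<length \<kappa>]"

text \<open>Semistandard supertableaux of content \<open>\<lambda>|\<mu>\<close>. The number \<open>m\<close> separating the two kinds of
  entries is the length of the first sequence of the pair, which may contain zeros.\<close>

definition supertableaux :: "nat list \<Rightarrow> nat list \<times> nat list \<Rightarrow> nat list list set" where
  "supertableaux \<nu> = (\<lambda>(lam, \<mu>). {T. shape T = \<nu> \<and>
     set (concat T) \<subseteq> {1..length (lam @ \<mu>)} \<and>
     (\<forall>k < length (lam @ \<mu>). count_list (concat T) (Suc k) = (lam @ \<mu>) ! k) \<and>
     (\<forall>i < length T. \<forall>j < length (T ! i). \<forall>j' < j.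
        T ! i ! j' \<le> T ! i ! j \<and> (length lam < T ! i ! j' \<longrightarrow> T ! i ! j' < T ! i ! j)) \<and>
     (\<forall>i < length T. \<forall>j < length (T ! i). \<forall>i' < i.
        T ! i' ! j \<le> T ! i ! j \<and> (T ! i ! j \<le> length lam \<longrightarrow> T ! i' ! j < T ! i ! j))})"

section \<open>The symmetric group\<close>

definition simple_reflections :: "nat \<Rightarrow> (nat \<Rightarrow> nat) set" where
  "simple_reflections r = {Transposition.transpose k (Suc k) | k. 1 \<le> k \<and> k < r}"

definition perm_length :: "nat \<Rightarrow> (nat \<Rightarrow> nat) \<Rightarrow> nat" where
  "perm_length r w = (LEAST k. \<exists>ss. length ss = k \<and> set ss \<subseteq> simple_reflections r \<and>
     w = foldr (\<circ>) ss id)"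

definition row_stabilizer :: "nat \<Rightarrow> nat list \<Rightarrow> (nat \<Rightarrow> nat) set" where
  "row_stabilizer r \<nu> =
     {w. w permutes {1..r} \<and> (\<forall>k < length \<nu>. w ` row_block \<nu> k = row_block \<nu> k)}"

definition pad_right :: "nat \<Rightarrow> nat list \<Rightarrow> nat list" where
  "pad_right r lam = lam @ replicate (r - sum_list lam) 1"

definition pad_left :: "nat \<Rightarrow> nat list \<Rightarrow> nat list" where
  "pad_left r \<mu> = replicate (r - sum_list \<mu>) 1 @ \<mu>"

text \<open>\<open>w\<^sub>0\<^sub>,\<^sub>\<lambda>\<close>. For a partition \<open>\<nu>\<close> of \<open>r\<close> the padding is empty, so this is also \<open>w\<^sub>0\<^sub>,\<^sub>\<nu>\<close>.\<close>

definition longest_elt :: "nat \<Rightarrow> nat list \<Rightarrow> nat \<Rightarrow> nat" where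
  "longest_elt r lam =
     (THE w. is_arg_max (perm_length r) (\<lambda>v. v \<in> row_stabilizer r (pad_right r lam)) w)"

definition double_coset_reps ::
    "nat \<Rightarrow> nat list \<times> nat list \<Rightarrow> nat list \<times> nat list \<Rightarrow> (nat \<Rightarrow> nat) set" where
  "double_coset_reps r = (\<lambda>(lam, \<mu>) (\<xi>, \<eta>). {x. x permutes {1..r} \<and>
     (\<forall>s \<in> simple_reflections r \<inter> row_stabilizer r (pad_right r lam).
        perm_length r (s \<circ> x) < perm_length r x) \<and>
     (\<forall>t \<in> simple_reflections r \<inter> row_stabilizer r (pad_left r \<mu>).
        perm_length r (t \<circ> x) > perm_length r x) \<and>
     (\<forall>s \<in> simple_reflections r \<inter> row_stabilizer r (pad_right r \<xi>).
        perm_length r (x \<circ> s) < perm_length r x) \<and>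
     (\<forall>t \<in> simple_reflections r \<inter> row_stabilizer r (pad_left r \<eta>).
        perm_length r (x \<circ> t) > perm_length r x)})"

text \<open>The element \<open>w\<^sub>T\<close> for a filling \<open>T\<close> of content \<open>\<rho>\<close>. The entry of \<open>w(t\<^sup>\<nu>)\<close> in a cell is \<open>w\<close>
  applied to the entry of \<open>t\<^sup>\<nu>\<close>, where \<open>\<nu>\<close> is the shape of \<open>T\<close>.\<close>

definition tableau_perm ::
    "nat \<Rightarrow> (nat \<Rightarrow> nat) \<Rightarrow> nat list \<Rightarrow> nat list list \<Rightarrow> nat \<Rightarrow> nat" where
  "tableau_perm r w \<rho> T = (THE u. u permutes {1..r} \<and>
     (\<forall>k < length \<rho>.
        sorted_wrt (<) (map u (row_tableau \<rho> ! k)) \<and>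
        set (map u (row_tableau \<rho> ! k)) =
          {w (row_tableau (shape T) ! i ! j) | i j.
             i < length T \<and> j < length (T ! i) \<and> T ! i ! j = Suc k}))"

section \<open>The Robinson--Schensted correspondence\<close>

text \<open>Row insertion of \<open>x\<close>: the least entry exceeding \<open>x\<close> is replaced by \<open>x\<close> and inserted into the
  next row. The second component of the result is the index of the row receiving the new cell.\<close>

fun row_insert :: "nat \<Rightarrow> nat list list \<Rightarrow> nat list list \<times> nat" where
  "row_insert x [] = ([[x]], 0)"
| "row_insert x (R # Rs) =
     (case dropWhile (\<lambda>y. y < x) R of
        [] \<Rightarrow> ((R @ [x]) # Rs, 0)
      | y # ys \<Rightarrow> (let (Rs', k) = row_insert y Rs
                  in ((takeWhile (\<lambda>y. y < x) R @ x # ys) # Rs', Suc k)))"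

definition add_cell :: "nat \<Rightarrow> nat \<Rightarrow> nat list list \<Rightarrow> nat list list" where
  "add_cell k i Q = (if k < length Q then Q[k := Q ! k @ [i]] else Q @ [[i]])"

text \<open>The pair of tableaux after the insertion of \<open>w(1), \<dots>, w(r)\<close>.\<close>

fun RS :: "nat \<Rightarrow> (nat \<Rightarrow> nat) \<Rightarrow> nat list list \<times> nat list list" where
  "RS 0 w = ([], [])"
| "RS (Suc r) w =
     (let (P, Q) = RS r w; (P', k) = row_insert (w (Suc r)) P in (P', add_cell k (Suc r) Q))"

definition P_tableau :: "nat \<Rightarrow> (nat \<Rightarrow> nat) \<Rightarrow> nat list list" where
  "P_tableau r w = fst (RS r w)"

definition Q_tableau :: "nat \<Rightarrow> (nat \<Rightarrow> nat) \<Rightarrow> nat list list" where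
  "Q_tableau r w = snd (RS r w)"

section \<open>The correspondence between double cosets and pairs of supertableaux\<close>

text \<open>The partition \<open>\<nu>\<close> attached to \<open>w\<close> is the dual of the shape of \<open>P(w)\<close>. Below,
  \<open>Hilbert_Choice.inv\<close> is the inverse of a function, as \<open>inv\<close> alone is the inverse in a group.\<close>

definition cell_partition :: "nat \<Rightarrow> (nat \<Rightarrow> nat) \<Rightarrow> nat list" where
  "cell_partition r w = dual_partition (shape (P_tableau r w))"

definition left_part :: "nat \<Rightarrow> (nat \<Rightarrow> nat) \<Rightarrow> nat \<Rightarrow> nat" where
  "left_part r w = (THE x. x permutes {1..r} \<and>
     P_tableau r (Hilbert_Choice.inv x) = P_tableau r w \<and>
     Q_tableau r (Hilbert_Choice.inv x) = column_tableau (shape (P_tableau r w)))"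

definition right_part :: "nat \<Rightarrow> (nat \<Rightarrow> nat) \<Rightarrow> nat \<Rightarrow> nat" where
  "right_part r w = (THE y. y permutes {1..r} \<and>
     P_tableau r y = column_tableau (shape (P_tableau r w)) \<and>
     Q_tableau r y = Q_tableau r w)"

text \<open>The unique supertableau \<open>T\<close> of shape \<open>\<nu>\<close> and content \<open>\<lambda>|\<mu>\<close> with
  \<open>x = (w\<^sub>0\<^sub>,\<^sub>\<nu>)\<^sub>T w\<^sub>0\<^sub>,\<^sub>\<lambda>\<close>.\<close>

definition tableau_of ::
    "nat \<Rightarrow> nat list \<Rightarrow> nat list \<times> nat list \<Rightarrow> (nat \<Rightarrow> nat) \<Rightarrow> nat list list" where
  "tableau_of r \<nu> = (\<lambda>(lam, \<mu>) x. THE T. T \<in> supertableaux \<nu> (lam, \<mu>) \<and>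
     x = tableau_perm r (longest_elt r \<nu>) (lam @ \<mu>) T \<circ> longest_elt r lam)"

definition super_RS ::
    "nat \<Rightarrow> nat list \<times> nat list \<Rightarrow> nat list \<times> nat list \<Rightarrow> (nat \<Rightarrow> nat)
      \<Rightarrow> nat list list \<times> nat list list" where
  "super_RS r lm xe w =
     (tableau_of r (cell_partition r w) lm (left_part r w),
      tableau_of r (cell_partition r w) xe (right_part r w))"

section \<open>Matrices\<close>

text \<open>With indices starting at 0, index \<open>i\<close> is even if \<open>i < m\<close> and odd otherwise.\<close>

definition super_matrices :: "nat \<Rightarrow> nat \<Rightarrow> nat \<Rightarrow> nat mat set" where
  "super_matrices m n r = {A \<in> carrier_mat (m + n) (m + n).
     (\<Sum>i<m + n. \<Sum>j<m + n. A $$ (i, j)) = r \<and>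
     (\<forall>i < m + n. \<forall>j < m + n. (i < m) \<noteq> (j < m) \<longrightarrow> A $$ (i, j) \<in> {0, 1})}"

definition row_sums :: "nat \<Rightarrow> nat mat \<Rightarrow> nat list \<times> nat list" where
  "row_sums m A = (let \<rho> = map (\<lambda>i. \<Sum>j<dim_col A. A $$ (i, j)) [0..<dim_row A]
     in (take m \<rho>, drop m \<rho>))"

definition col_sums :: "nat \<Rightarrow> nat mat \<Rightarrow> nat list \<times> nat list" where
  "col_sums m A = (let \<rho> = map (\<lambda>j. \<Sum>i<dim_row A. A $$ (i, j)) [0..<dim_col A]
     in (take m \<rho>, drop m \<rho>))"

definition matrix_perm :: "nat \<Rightarrow> nat \<Rightarrow> nat mat \<Rightarrow> nat \<Rightarrow> nat" where
  "matrix_perm m r A = (let (lam, \<mu>) = row_sums m A; (\<xi>, \<eta>) = col_sums m A in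
     THE w. w \<in> double_coset_reps r (lam, \<mu>) (\<xi>, \<eta>) \<and>
       (\<forall>i < dim_row A. \<forall>j < dim_col A.
          A $$ (i, j) = card (row_block (lam @ \<mu>) i \<inter> w ` row_block (\<xi> @ \<eta>) j)))"

definition super_RSK :: "nat \<Rightarrow> nat \<Rightarrow> nat mat \<Rightarrow> nat list list \<times> nat list list" where
  "super_RSK m r A = super_RS r (row_sums m A) (col_sums m A) (matrix_perm m r A)"

end

theory Submission
  imports Defs
begin

text \<open>For \<open>w\<close> in \<open>double_coset_reps r (\<lambda>, \<mu>) (\<xi>, \<eta>)\<close>, the conditions on the right concern the descents of
  \<open>w\<close>, which depend only on \<open>Q(w)\<close>. Hence the element \<open>y\<close> with \<open>P(y) = t\<^sub>\<kappa>\<close> and \<open>Q(y) = Q(w)\<close> satisfies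
  them too. It is explicit: \<open>y(i)\<close> is the entry of \<open>w\<^sub>0\<^sub>,\<^sub>\<nu>(t\<^sup>\<nu>)\<close> in the cell where the transpose of
  \<open>Q(w)\<close> contains \<open>i\<close>. Replacing each entry of that transpose by the index of its block in \<open>\<xi> @ \<eta>\<close> gives
  \<open>T\<^sub>w\<close>: the descent conditions turn into semistandardness, and \<open>Q(w)\<close> is recovered as the standardization
  of \<open>T\<^sub>w\<close>. By the symmetry \<open>Q(w) = P(w\<^sup>-\<^sup>1)\<close>, which is read off from growth diagrams, the same applies to
  the conditions on the left, \<open>P(w)\<close> and \<open>S\<^sub>w\<close>, and inverting \<open>w\<close> exchanges \<open>S\<^sub>w\<close> and \<open>T\<^sub>w\<close>. A matrix
  determines its permutation because, as a value runs through a block, the block of its position changes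
  monotonically.\<close>

section \<open>Permutations and blocks\<close>

text \<open>Most objects of the statement are definite descriptions, so each must be shown to exist
  and to be unique before it can be used. The part of a cell that occurs is described by
  inequalities between positions (\<open>cell_elements\<close>), and its parametrization by
  supertableaux is derived from that description in \<open>bij_tableau_of\<close>.

  One sorting principle, \<open>sorting_permutation\<close>, serves twice. Colour the values 1..r by
  block indices, each colour with the right multiplicity; exactly one permutation lists the values
  block by block with a prescribed direction inside each block. Coloured by the entries of a
  supertableau this gives the standardization, coloured by \<open>column_of\<close> it gives the
  permutation of a matrix.

  The transpose of Q(w) is forced: on an even block w decreases, so successive new cells lie in
  strictly lower rows of Q(w), whereas equal even entries of a supertableau may share a row but no
  column. The hook condition enters by counting: a shape outside the hook admits no
  supertableau.\<close>

abbreviation pinv :: "(nat \<Rightarrow> nat) \<Rightarrow> nat \<Rightarrow> nat" where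
  "pinv \<equiv> Hilbert_Choice.inv"

lemma permutes_mem: "w permutes S \<Longrightarrow> p \<in> S \<Longrightarrow> w p \<in> S"
  by (rule iffD2[OF permutes_in_image])

lemma permutes_rank:
  fixes w :: "nat \<Rightarrow> nat"
  assumes w: "w permutes {1..r}" and p: "p \<in> {1..r}"
  shows "card {q \<in> {1..r}. w q \<le> w p} = w p"
proof -
  have im: "w ` {q \<in> {1..r}. w q \<le> w p} = {1..w p}"
  proof (intro equalityI subsetI)
    fix v assume "v \<in> w ` {q \<in> {1..r}. w q \<le> w p}"
    then obtain q where q: "q \<in> {1..r}" "w q \<le> w p" "v = w q" by blast
    then show "v \<in> {1..w p}"
      using permutes_mem[OF w q(1)] unfolding q(3) atLeastAtMost_iff by blast
  next
    fix v assume v: "v \<in> {1..w p}"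
    then have "v \<in> {1..r}"
      using permutes_mem[OF w p] unfolding atLeastAtMost_iff by linarith
    then obtain q where "q \<in> {1..r}" "v = w q"
      using permutes_image[OF w] by blast
    then show "v \<in> w ` {q \<in> {1..r}. w q \<le> w p}"
      using v unfolding atLeastAtMost_iff by blast
  qed
  have "card (w ` {q \<in> {1..r}. w q \<le> w p}) = card {q \<in> {1..r}. w q \<le> w p}"
    by (rule card_image) (rule permutes_inj_on[OF w])
  then show ?thesis
    unfolding im by (simp only: card_atLeastAtMost diff_Suc_1)
qed

text \<open>Each value \<open>w p\<close> is its own rank among the values
  (\<open>permutes_rank\<close>), so comparisons alone determine a permutation. The uniqueness of
  sorted permutations and of the longest element rests on this.\<close>

lemma permutes_eqI_order:
  fixes w w' :: "nat \<Rightarrow> nat"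
  assumes w: "w permutes {1..r}" and w': "w' permutes {1..r}"
    and less: "\<And>p q. p \<in> {1..r} \<Longrightarrow> q \<in> {1..r} \<Longrightarrow> w p < w q \<longleftrightarrow> w' p < w' q"
  shows "w = w'"
proof
  fix p
  show "w p = w' p"
  proof (cases "p \<in> {1..r}")
    case True
    then have "{q \<in> {1..r}. w q \<le> w p} = {q \<in> {1..r}. w' q \<le> w' p}"
      using less[of p] unfolding not_less[symmetric] by blast
    then show ?thesis
      using permutes_rank[OF w True] permutes_rank[OF w' True] by metis
  next
    case False
    then show ?thesis
      using w w' by (simp add: permutes_not_in)
  qed
qed

text \<open>The value at \<open>p\<close> counts the predecessors of \<open>p\<close>, plus one
  because the values start at 1.\<close>

lemma permutation_of_order:
  fixes lt :: "nat \<Rightarrow> nat \<Rightarrow> bool"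
  assumes irrefl: "\<And>p. \<not> lt p p" and trans: "\<And>p q s. lt p q \<Longrightarrow> lt q s \<Longrightarrow> lt p s"
    and total: "\<And>p q. p \<noteq> q \<Longrightarrow> lt p q \<or> lt q p"
  obtains w where "w permutes {1..r}"
    "\<And>p q. p \<in> {1..r} \<Longrightarrow> q \<in> {1..r} \<Longrightarrow> w p < w q \<longleftrightarrow> lt p q"
proof
  define w where "w p = (if p \<in> {1..r} then Suc (card {q \<in> {1..r}. lt q p}) else p)" for p
  have mono: "w p < w q" if "p \<in> {1..r}" "q \<in> {1..r}" "lt p q" for p q
  proof -
    have "{s \<in> {1..r}. lt s p} \<subset> {s \<in> {1..r}. lt s q}"
      using that trans irrefl by blast
    then have "card {s \<in> {1..r}. lt s p} < card {s \<in> {1..r}. lt s q}"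
      by (intro psubset_card_mono) auto
    then show ?thesis using that by (simp add: w_def)
  qed
  then show iff: "w p < w q \<longleftrightarrow> lt p q" if "p \<in> {1..r}" "q \<in> {1..r}" for p q
    using that total by (metis less_asym' nat_neq_iff)
  have "inj_on w {1..r}"
    using mono total by (metis inj_onI less_irrefl)
  moreover have "w ` {1..r} \<subseteq> {1..r}"
  proof
    fix v assume "v \<in> w ` {1..r}"
    then obtain p where p: "p \<in> {1..r}" "v = w p" by blast
    have "{q \<in> {1..r}. lt q p} \<subset> {1..r}"
      using p irrefl by blast
    then have "card {q \<in> {1..r}. lt q p} < card {1..r}"
      by (intro psubset_card_mono) auto
    then show "v \<in> {1..r}" using p by (simp add: w_def)
  qed
  ultimately have "bij_betw w {1..r} {1..r}"
    by (simp add: bij_betw_def endo_inj_surj)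
  then show "w permutes {1..r}"
    by (rule bij_imp_permutes) (simp only: w_def if_not_P if_False)
qed

section \<open>Blocks of a composition\<close>

abbreviation psum :: "nat list \<Rightarrow> nat \<Rightarrow> nat" where
  "psum \<rho> k \<equiv> sum_list (take k \<rho>)"

lemma psum_Suc: "k < length \<rho> \<Longrightarrow> psum \<rho> (Suc k) = psum \<rho> k + \<rho> ! k"
  by (simp add: take_Suc_conv_app_nth)

lemma psum_mono: "j \<le> k \<Longrightarrow> psum \<rho> j \<le> psum \<rho> k"
proof (induction rule: dec_induct)
  case (step k)
  have "psum \<rho> k \<le> psum \<rho> (Suc k)"
    by (cases "k < length \<rho>") (simp_all add: psum_Suc)
  with step show ?case by linarith
qed simp

lemma psum_le: "psum \<rho> k \<le> sum_list \<rho>"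
  using psum_mono[of k "max k (length \<rho>)" \<rho>] by simp

text \<open>The index of the block \<open>R\<^sup>\<rho>\<^sub>k\<close> containing \<open>p\<close>, starting from 0; meaningful for
  \<open>1 \<le> p \<le> sum_list \<rho>\<close> only.\<close>

definition blk :: "nat list \<Rightarrow> nat \<Rightarrow> nat" where
  "blk \<rho> p = (LEAST j. p \<le> psum \<rho> (Suc j))"

text \<open>Monotonicity of the partial sums turns the least index into a threshold; the bound on
  \<open>p\<close> ensures that some index qualifies. Empty blocks are skipped, since the partial
  sum does not grow across them.\<close>

lemma blk_le_iff:
  assumes "p \<le> sum_list \<rho>"
  shows "blk \<rho> p \<le> j \<longleftrightarrow> p \<le> psum \<rho> (Suc j)"
proof
  have "p \<le> psum \<rho> (Suc (length \<rho>))" using assms by simp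
  then have "p \<le> psum \<rho> (Suc (blk \<rho> p))"
    unfolding blk_def by (rule LeastI)
  then show "p \<le> psum \<rho> (Suc j)" if "blk \<rho> p \<le> j"
    using psum_mono[of "Suc (blk \<rho> p)" "Suc j" \<rho>] that by linarith
qed (simp add: blk_def Least_le)

lemma blk_mono: "p \<le> q \<Longrightarrow> q \<le> sum_list \<rho> \<Longrightarrow> blk \<rho> p \<le> blk \<rho> q"
  by (meson blk_le_iff order_refl order_trans)

lemma blk_less_length: "1 \<le> p \<Longrightarrow> p \<le> sum_list \<rho> \<Longrightarrow> blk \<rho> p < length \<rho>"
  using blk_le_iff[of p \<rho> "length \<rho> - 1"] by (cases \<rho>) auto

lemma row_block_eq: "k < length \<rho> \<Longrightarrow> row_block \<rho> k = {psum \<rho> k + 1..psum \<rho> (Suc k)}"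
  by (auto simp: row_block_def row_tableau_def)

lemma blk_eq_iff:
  assumes "1 \<le> p" "p \<le> sum_list \<rho>"
  shows "blk \<rho> p = k \<longleftrightarrow> psum \<rho> k < p \<and> p \<le> psum \<rho> (Suc k)"
proof (cases k)
  case 0
  then show ?thesis
    using blk_le_iff[OF assms(2), of 0] assms by simp
next
  case (Suc j)
  then show ?thesis
    using blk_le_iff[OF assms(2), of j] blk_le_iff[OF assms(2), of k] by auto
qed

lemma row_block_blk:
  assumes "k < length \<rho>"
  shows "row_block \<rho> k = {p \<in> {1..sum_list \<rho>}. blk \<rho> p = k}"
proof -
  have "p \<in> row_block \<rho> k \<longleftrightarrow> p \<in> {p \<in> {1..sum_list \<rho>}. blk \<rho> p = k}" for p
    using psum_le[of "Suc k" \<rho>] blk_eq_iff[of p \<rho> k] by (auto simp: row_block_eq[OF assms])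
  then show ?thesis by blast
qed

lemma card_blk: "k < length \<rho> \<Longrightarrow> card {p \<in> {1..sum_list \<rho>}. blk \<rho> p = k} = \<rho> ! k"
  by (subst row_block_blk[symmetric]) (simp_all add: row_block_eq psum_Suc)

lemma down_closed_eq:
  fixes D :: "nat set"
  assumes "D \<subseteq> {1..r}" and "\<And>p q. q \<in> D \<Longrightarrow> 1 \<le> p \<Longrightarrow> p \<le> q \<Longrightarrow> p \<in> D"
  shows "D = {1..card D}"
proof (rule card_subset_eq)
  have fin: "finite D" using assms(1) finite_subset by blast
  show "D \<subseteq> {1..card D}"
  proof
    fix p assume p: "p \<in> D"
    then have "{1..p} \<subseteq> D" using assms(2) by auto
    then have "p \<le> card D" using card_mono[OF fin, of "{1..p}"] by simp
    then show "p \<in> {1..card D}" using p assms(1) by auto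
  qed
qed auto

text \<open>A weakly increasing function is constant on consecutive intervals, and the fibre sizes
  fix their end points: the points with value below \<open>k\<close> form an initial segment of size
  \<open>psum \<rho> k\<close>. Block structures are recognized by this lemma later on.\<close>

lemma blk_unique:
  assumes sum: "sum_list \<rho> = r"
    and mono: "\<And>p q. 1 \<le> p \<Longrightarrow> p \<le> q \<Longrightarrow> q \<le> r \<Longrightarrow> f p \<le> f q"
    and card: "\<And>k. k < length \<rho> \<Longrightarrow> card {p \<in> {1..r}. f p = k} = \<rho> ! k"
    and less: "\<And>p. 1 \<le> p \<Longrightarrow> p \<le> r \<Longrightarrow> f p < length \<rho>"
    and p: "1 \<le> p" "p \<le> r"
  shows "f p = blk \<rho> p"
proof -
  have cardle: "card {p \<in> {1..r}. f p < k} = psum \<rho> k" if "k \<le> length \<rho>" for k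
    using that
  proof (induction k)
    case (Suc k)
    have "{p \<in> {1..r}. f p < Suc k} = {p \<in> {1..r}. f p < k} \<union> {p \<in> {1..r}. f p = k}"
      by auto
    moreover have "card \<dots> = card {p \<in> {1..r}. f p < k} + card {p \<in> {1..r}. f p = k}"
      by (intro card_Un_disjoint) auto
    ultimately show ?case using Suc card[of k] by (simp add: psum_Suc)
  qed simp
  have iff: "f p < k \<longleftrightarrow> p \<le> psum \<rho> k" if "k \<le> length \<rho>" for k
  proof -
    have "{p \<in> {1..r}. f p < k} = {1..card {p \<in> {1..r}. f p < k}}"
      by (rule down_closed_eq[of _ r]) (use mono in \<open>auto intro: le_less_trans\<close>)
    then have "{p \<in> {1..r}. f p < k} = {1..psum \<rho> k}"
      using cardle[OF that] by simp
    then have "p \<in> {p \<in> {1..r}. f p < k} \<longleftrightarrow> p \<in> {1..psum \<rho> k}" by simp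
    then show ?thesis using p by simp
  qed
  have "psum \<rho> (f p) < p \<and> p \<le> psum \<rho> (Suc (f p))"
    using iff[of "f p"] iff[of "Suc (f p)"] less[OF p] by auto
  then show ?thesis
    using blk_eq_iff[of p \<rho>] p sum by metis
qed

text \<open>One side of the double coset conditions, for all pairs inside a block and not only for
  neighbours. For \<open>m = 0\<close> every block is odd, hence increasing.\<close>

definition super_mono :: "nat \<Rightarrow> nat list \<Rightarrow> (nat \<Rightarrow> nat) \<Rightarrow> bool" where
  "super_mono m \<rho> w \<longleftrightarrow> (\<forall>p q. 1 \<le> p \<and> p < q \<and> q \<le> sum_list \<rho> \<and> blk \<rho> p = blk \<rho> q \<longrightarrow>
     (if blk \<rho> p < m then w q < w p else w p < w q))"

lemma super_monoD:
  assumes "super_mono m \<rho> w" "1 \<le> p" "p < q" "q \<le> sum_list \<rho>" "blk \<rho> p = blk \<rho> q"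
  shows "if blk \<rho> p < m then w q < w p else w p < w q"
  using assms unfolding super_mono_def by blast

text \<open>The order in which a \<open>super_mono\<close> permutation lists values of colours
  \<open>c\<close>: ties are broken downwards for even colours and upwards for odd ones.\<close>

definition sort_order :: "nat \<Rightarrow> (nat \<Rightarrow> nat) \<Rightarrow> nat \<Rightarrow> nat \<Rightarrow> bool" where
  "sort_order m c v v' \<longleftrightarrow>
     c v < c v' \<or> c v = c v' \<and> (c v < m \<and> v' < v \<or> \<not> c v < m \<and> v < v')"

lemma sort_order_asym: "sort_order m c v v' \<Longrightarrow> \<not> sort_order m c v' v"
  unfolding sort_order_def by linarith

lemma sort_order_trans: "sort_order m c v v' \<Longrightarrow> sort_order m c v' v'' \<Longrightarrow> sort_order m c v v''"
  unfolding sort_order_def by linarith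

lemma sort_order_total: "v \<noteq> v' \<Longrightarrow> sort_order m c v v' \<or> sort_order m c v' v"
  unfolding sort_order_def by linarith

lemma super_mono_sort_order:
  assumes sum: "sum_list \<rho> = r" and w: "super_mono m \<rho> w"
    and c: "\<forall>p\<in>{1..r}. c (w p) = blk \<rho> p"
    and pq: "p \<in> {1..r}" "q \<in> {1..r}"
  shows "p < q \<longleftrightarrow> sort_order m c (w p) (w q)"
proof -
  have *: "sort_order m c (w p) (w q)" if pq: "p < q" "p \<in> {1..r}" "q \<in> {1..r}" for p q
  proof -
    have "blk \<rho> p \<le> blk \<rho> q" using blk_mono[of p q \<rho>] pq sum by simp
    moreover have cc: "c (w p) = blk \<rho> p" "c (w q) = blk \<rho> q" using c pq by blast+
    moreover have "if blk \<rho> p < m then w q < w p else w p < w q" if "blk \<rho> p = blk \<rho> q"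
      using super_monoD[OF w, of p q] pq sum that by auto
    ultimately show ?thesis
      unfolding sort_order_def by (metis le_neq_implies_less)
  qed
  show ?thesis
  proof (cases p q rule: linorder_cases)
    case less
    then show ?thesis using *[OF less pq] by blast
  next
    case equal
    then show ?thesis by (simp add: sort_order_def)
  next
    case greater
    then show ?thesis using sort_order_asym[OF *[OF greater pq(2,1)]] by simp
  qed
qed

text \<open>The listing enumerates the values in the strict total order \<open>sort_order\<close>,
  so it exists and is unique. That the colour classes become the blocks of \<open>\<rho>\<close> is
  \<open>blk_unique\<close>, as the colours increase weakly along the list and occur with the right
  multiplicities.\<close>

lemma sorting_permutation:
  assumes sum: "sum_list \<rho> = r"
    and card: "\<And>k. k < length \<rho> \<Longrightarrow> card {v \<in> {1..r}. c v = k} = \<rho> ! k"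
    and less: "\<And>v. v \<in> {1..r} \<Longrightarrow> c v < length \<rho>"
  shows "\<exists>!w. w permutes {1..r} \<and> super_mono m \<rho> w \<and> (\<forall>p\<in>{1..r}. c (w p) = blk \<rho> p)"
proof (rule ex_ex1I)
  obtain z where z: "z permutes {1..r}"
    and z_less: "\<And>p q. p \<in> {1..r} \<Longrightarrow> q \<in> {1..r} \<Longrightarrow> z p < z q \<longleftrightarrow> sort_order m c p q"
    by (rule permutation_of_order[of "sort_order m c" r])
      (use sort_order_asym sort_order_trans sort_order_total in blast)+
  \<comment> \<open>\<open>z\<close> assigns to each value its rank; the list of the values in this
    order is the inverse.\<close>
  define w where "w = pinv z"
  have w: "w permutes {1..r}"
    unfolding w_def using z by (rule permutes_inv)
  have wr: "w p \<in> {1..r}" if "p \<in> {1..r}" for p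
    using permutes_mem[OF w that] .
  have w_less: "p < q \<longleftrightarrow> sort_order m c (w p) (w q)" if "p \<in> {1..r}" "q \<in> {1..r}" for p q
    using z_less[OF wr[OF that(1)] wr[OF that(2)]] permutes_inverses(1)[OF z]
    by (simp add: w_def)
  have "c (w p) = blk \<rho> p" if "1 \<le> p" "p \<le> r" for p
  proof (rule blk_unique[OF sum _ _ _ that, where f = "\<lambda>p. c (w p)"])
    fix p q assume "1 \<le> p" "p \<le> q" "q \<le> r"
    then show "c (w p) \<le> c (w q)"
      using w_less[of p q] unfolding sort_order_def by (cases "p = q") auto
  next
    fix k assume k: "k < length \<rho>"
    have "w ` {p \<in> {1..r}. c (w p) = k} = {v \<in> {1..r}. c v = k}"
    proof (intro equalityI subsetI)
      fix v assume v: "v \<in> {v \<in> {1..r}. c v = k}"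
      then obtain p where "p \<in> {1..r}" "v = w p"
        using permutes_image[OF w] by blast
      with v show "v \<in> w ` {p \<in> {1..r}. c (w p) = k}" by blast
    qed (use wr in blast)
    then show "card {p \<in> {1..r}. c (w p) = k} = \<rho> ! k"
      using card[OF k] card_image[OF permutes_inj_on[OF w], of "{p \<in> {1..r}. c (w p) = k}"] by simp
  next
    fix p assume "1 \<le> p" "p \<le> r"
    then show "c (w p) < length \<rho>" using less[OF wr[of p]] by simp
  qed
  then have c: "\<forall>p\<in>{1..r}. c (w p) = blk \<rho> p" by simp
  moreover have "super_mono m \<rho> w"
    unfolding super_mono_def
  proof (intro allI impI)
    fix p q assume pq: "1 \<le> p \<and> p < q \<and> q \<le> sum_list \<rho> \<and> blk \<rho> p = blk \<rho> q"
    then have "sort_order m c (w p) (w q)" using w_less[of p q] sum by auto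
    then show "if blk \<rho> p < m then w q < w p else w p < w q"
      using c pq sum unfolding sort_order_def by auto
  qed
  ultimately show "\<exists>w. w permutes {1..r} \<and> super_mono m \<rho> w \<and> (\<forall>p\<in>{1..r}. c (w p) = blk \<rho> p)"
    using w by blast
next
  fix w w'
  assume w: "w permutes {1..r} \<and> super_mono m \<rho> w \<and> (\<forall>p\<in>{1..r}. c (w p) = blk \<rho> p)"
    and w': "w' permutes {1..r} \<and> super_mono m \<rho> w' \<and> (\<forall>p\<in>{1..r}. c (w' p) = blk \<rho> p)"
  have order: "pinv u v < pinv u v' \<longleftrightarrow> sort_order m c v v'"
    if u: "u permutes {1..r} \<and> super_mono m \<rho> u \<and> (\<forall>p\<in>{1..r}. c (u p) = blk \<rho> p)"
      and v: "v \<in> {1..r}" "v' \<in> {1..r}" for u v v'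
  proof -
    have u': "u permutes {1..r}" using u by blast
    have "pinv u v \<in> {1..r}" "pinv u v' \<in> {1..r}"
      using v permutes_mem[OF permutes_inv[OF u']] by blast+
    then show ?thesis
      using super_mono_sort_order[OF sum, of m u c "pinv u v" "pinv u v'"] u
      by (simp add: permutes_inverses(1)[OF u'])
  qed
  have "pinv w = pinv w'"
    by (rule permutes_eqI_order[of _ r]) (use w w' order in \<open>auto intro: permutes_inv\<close>)
  then show "w = w'"
    using w w' by (metis permutes_inv_inv)
qed

section \<open>Length and inversions\<close>

definition inversions :: "nat \<Rightarrow> (nat \<Rightarrow> nat) \<Rightarrow> (nat \<times> nat) set" where
  "inversions r w = {(p, q). 1 \<le> p \<and> p < q \<and> q \<le> r \<and> w q < w p}"

lemma inversions_id: "inversions r id = {}"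
  by (auto simp: inversions_def)

lemma finite_inversions: "finite (inversions r w)"
  by (rule finite_subset[of _ "{1..r} \<times> {1..r}"]) (auto simp: inversions_def)

lemma transpose_less:
  "p < q \<Longrightarrow> (p, q) \<noteq> (k, Suc k) \<Longrightarrow>
     Transposition.transpose k (Suc k) p < Transposition.transpose k (Suc k) q"
  by (auto simp: Transposition.transpose_def)

lemma transpose_bounds:
  "1 \<le> k \<Longrightarrow> k < r \<Longrightarrow> 1 \<le> p \<Longrightarrow> p \<le> r \<Longrightarrow>
     1 \<le> Transposition.transpose k (Suc k) p \<and> Transposition.transpose k (Suc k) p \<le> r"
  by (auto simp: Transposition.transpose_def)

text \<open>An adjacent transposition respects the order of all pairs but \<open>(k, Suc k)\<close>.
  Hence it carries the old inversions bijectively onto the new ones other than that pair, which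
  becomes an inversion itself.\<close>

lemma card_inversions_ascent:
  assumes k: "1 \<le> k" "k < r" and asc: "w k < w (Suc k)"
  shows "card (inversions r (w \<circ> Transposition.transpose k (Suc k))) = Suc (card (inversions r w))"
proof -
  let ?s = "Transposition.transpose k (Suc k)"
  have "inversions r (w \<circ> ?s) = insert (k, Suc k) (map_prod ?s ?s ` inversions r w)"
  proof (intro equalityI subsetI)
    fix z assume z: "z \<in> inversions r (w \<circ> ?s)"
    obtain p q where pq: "z = (p, q)" by (cases z)
    show "z \<in> insert (k, Suc k) (map_prod ?s ?s ` inversions r w)"
    proof (cases "(p, q) = (k, Suc k)")
      case False
      then have "(?s p, ?s q) \<in> inversions r w"
        using z pq transpose_less[of p q k] transpose_bounds[OF k, of p] transpose_bounds[OF k, of q]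
        by (auto simp: inversions_def)
      then have "map_prod ?s ?s (?s p, ?s q) \<in> map_prod ?s ?s ` inversions r w" by blast
      then show ?thesis using pq by simp
    qed (simp add: pq)
  next
    fix z assume z: "z \<in> insert (k, Suc k) (map_prod ?s ?s ` inversions r w)"
    then consider "z = (k, Suc k)" | p q where "(p, q) \<in> inversions r w" "z = (?s p, ?s q)"
      by auto
    then show "z \<in> inversions r (w \<circ> ?s)"
    proof cases
      case 1
      then show ?thesis using k asc by (simp add: inversions_def)
    next
      case (2 p q)
      then have "(p, q) \<noteq> (k, Suc k)" using asc by (auto simp: inversions_def)
      then show ?thesis
        using 2 transpose_less[of p q k] transpose_bounds[OF k, of p] transpose_bounds[OF k, of q]
        by (auto simp: inversions_def)
    qed
  qed
  moreover have "(k, Suc k) \<notin> map_prod ?s ?s ` inversions r w"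
  proof
    assume "(k, Suc k) \<in> map_prod ?s ?s ` inversions r w"
    then obtain p q where "(p, q) \<in> inversions r w" "?s p = k" "?s q = Suc k" by auto
    then show False
      by (auto simp: inversions_def Transposition.transpose_def split: if_splits)
  qed
  moreover have "inj_on (map_prod ?s ?s) (inversions r w)"
    by (rule inj_on_subset[OF prod.inj_map[OF inj_transpose inj_transpose]]) simp
  ultimately show ?thesis
    by (simp add: card_image finite_inversions)
qed

lemma card_inversions_descent:
  assumes k: "1 \<le> k" "k < r" and desc: "w (Suc k) < w k"
  shows "Suc (card (inversions r (w \<circ> Transposition.transpose k (Suc k)))) = card (inversions r w)"
  using card_inversions_ascent[OF k, of "w \<circ> Transposition.transpose k (Suc k)"] desc
  by (simp add: comp_assoc)

lemma foldr_comp_id: "foldr (\<circ>) ss f = foldr (\<circ>) ss id \<circ> f"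
  by (induction ss) (simp_all add: comp_assoc)

lemma transpose_permutes:
  "1 \<le> k \<Longrightarrow> k < r \<Longrightarrow> Transposition.transpose k (Suc k) permutes {1..r}"
  by (rule permutes_swap_id) auto

lemma word_permutes:
  "set ss \<subseteq> simple_reflections r \<Longrightarrow> foldr (\<circ>) ss id permutes {1..r}"
proof (induction ss)
  case (Cons s ss)
  then have "s permutes {1..r}"
    using transpose_permutes by (auto simp: simple_reflections_def)
  moreover have "foldr (\<circ>) ss id permutes {1..r}"
    by (rule Cons.IH) (use Cons.prems in simp)
  moreover have "foldr (\<circ>) (s # ss) id = s \<circ> foldr (\<circ>) ss id" by simp
  ultimately show ?case using permutes_compose by metis
qed (simp add: permutes_id)

text \<open>Appending a letter changes the number of inversions by exactly one, which makes this
  number a lower bound for the length of any word.\<close>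

lemma card_inversions_word:
  "set ss \<subseteq> simple_reflections r \<Longrightarrow> card (inversions r (foldr (\<circ>) ss id)) \<le> length ss"
proof (induction ss rule: rev_induct)
  case (snoc s ss)
  let ?w = "foldr (\<circ>) ss id"
  obtain k where k: "1 \<le> k" "k < r" "s = Transposition.transpose k (Suc k)"
    using snoc by (auto simp: simple_reflections_def)
  have "?w permutes {1..r}" using snoc by (intro word_permutes) simp
  then have "?w k \<noteq> ?w (Suc k)"
    using permutes_inj by (metis injD n_not_Suc_n)
  then have "card (inversions r (?w \<circ> s)) \<le> Suc (card (inversions r ?w))"
    using card_inversions_ascent[OF k(1,2), of ?w] card_inversions_descent[OF k(1,2), of ?w] k(3)
    by (cases "?w k < ?w (Suc k)") auto
  moreover have "foldr (\<circ>) (ss @ [s]) id = ?w \<circ> s"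
    by (simp add: foldr_comp_id[of ss s])
  moreover have "card (inversions r ?w) \<le> length ss"
    by (rule snoc.IH) (use snoc.prems in simp)
  ultimately show ?case by (metis Suc_le_mono length_append_singleton order_trans)
qed (simp add: inversions_id[unfolded id_def] inversions_id)

lemma adjacent_trans:
  fixes w :: "nat \<Rightarrow> nat"
  assumes trans: "transp R" and adj: "\<And>k. p \<le> k \<Longrightarrow> k < q \<Longrightarrow> R (w k) (w (Suc k))" and "p < q"
  shows "R (w p) (w q)"
proof -
  have *: "Suc p \<le> q' \<Longrightarrow> q' \<le> q \<Longrightarrow> R (w p) (w q')" for q'
  proof (induction rule: dec_induct)
    case base
    then show ?case using adj[of p] by simp
  next
    case (step k)
    then have "R (w p) (w k)" "R (w k) (w (Suc k))" using adj[of k] by simp_all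
    then show ?case by (rule transpD[OF trans])
  qed
  show ?thesis using *[of q] \<open>p < q\<close> by simp
qed

lemma no_descent_id:
  assumes w: "w permutes {1..r}" and "\<And>k. 1 \<le> k \<Longrightarrow> k < r \<Longrightarrow> w k < w (Suc k)"
  shows "w = id"
proof (rule permutes_eqI_order[OF w permutes_id])
  fix p q assume pq: "p \<in> {1..r}" "q \<in> {1..r}"
  have "w p < w q" if "p < q" "1 \<le> p" "q \<le> r" for p q
    by (rule adjacent_trans[where R = "(<)" and w = w]) (use that assms(2) in auto)
  from this[of p q] this[of q p] show "w p < w q \<longleftrightarrow> id p < id q"
    using pq by (cases p q rule: linorder_cases) auto
qed

text \<open>Bubble sort: as long as an inversion is left, some neighbours form a descent, and
  swapping them removes exactly one inversion. Undoing the swaps spells a word that attains the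
  lower bound of \<open>card_inversions_word\<close>.\<close>

lemma reduced_word_exists:
  assumes "w permutes {1..r}"
  shows "\<exists>ss. length ss = card (inversions r w) \<and> set ss \<subseteq> simple_reflections r \<and>
    w = foldr (\<circ>) ss id"
  using assms
proof (induction "card (inversions r w)" arbitrary: w)
  case 0
  have "w k < w (Suc k)" if "1 \<le> k" "k < r" for k
  proof (rule ccontr)
    assume "\<not> w k < w (Suc k)"
    moreover have "w k \<noteq> w (Suc k)"
      using permutes_inj[OF 0(2)] by (metis injD n_not_Suc_n)
    ultimately show False using card_inversions_descent[OF that, of w] 0(1) by simp
  qed
  then have "w = id" using no_descent_id[OF 0(2)] by blast
  then show ?case using 0(1) by (intro exI[of _ "[]"]) (simp add: inversions_id)
next
  case (Suc c)
  have "\<exists>k. 1 \<le> k \<and> k < r \<and> w (Suc k) < w k"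
  proof (rule ccontr)
    assume no: "\<nexists>k. 1 \<le> k \<and> k < r \<and> w (Suc k) < w k"
    have "w = id"
    proof (rule no_descent_id[OF Suc(3)])
      fix k assume "1 \<le> k" "k < r"
      moreover have "w k \<noteq> w (Suc k)"
        using permutes_inj[OF Suc(3)] by (metis injD n_not_Suc_n)
      ultimately show "w k < w (Suc k)" using no by (metis nat_neq_iff)
    qed
    then have "inversions r w = {}" using inversions_id by blast
    then show False using Suc(2) by simp
  qed
  then obtain k where k: "1 \<le> k" "k < r" "w (Suc k) < w k" by blast
  let ?s = "Transposition.transpose k (Suc k)"
  have "c = card (inversions r (w \<circ> ?s))"
    using card_inversions_descent[OF k] Suc(2) by simp
  moreover have "w \<circ> ?s permutes {1..r}"
    using transpose_permutes[OF k(1,2)] Suc(3) by (rule permutes_compose)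
  ultimately obtain ss where ss: "length ss = c" "set ss \<subseteq> simple_reflections r"
      "w \<circ> ?s = foldr (\<circ>) ss id"
    using Suc(1)[of "w \<circ> ?s"] by auto
  have "w = foldr (\<circ>) (ss @ [?s]) id"
    using ss(3) foldr_comp_id[of ss ?s] by (simp flip: ss(3) add: comp_assoc)
  moreover have "set (ss @ [?s]) \<subseteq> simple_reflections r"
    using ss(2) k by (auto simp: simple_reflections_def)
  ultimately show ?case
    using ss(1) Suc(2) by (intro exI[of _ "ss @ [?s]"]) simp
qed

lemma perm_length_inversions:
  assumes "w permutes {1..r}"
  shows "perm_length r w = card (inversions r w)"
  unfolding perm_length_def
  using reduced_word_exists[OF assms] card_inversions_word[of _ r]
  by (intro Least_equality) auto

text \<open>The two values of an inversion, read as positions, form an inversion of the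
  inverse.\<close>

lemma card_inversions_inv:
  assumes w: "w permutes {1..r}"
  shows "card (inversions r (pinv w)) = card (inversions r w)"
proof -
  have im: "(\<lambda>(p, q). (u q, u p)) z \<in> inversions r (pinv u)"
    if "z \<in> inversions r u" "u permutes {1..r}" for u z
  proof -
    obtain p q where pq: "z = (p, q)" by (cases z)
    then have "u p \<in> {1..r}" "u q \<in> {1..r}"
      using that(1) permutes_mem[OF that(2)] by (auto simp: inversions_def)
    then show ?thesis
      using that(1) pq by (simp add: inversions_def permutes_inverses(2)[OF that(2)])
  qed
  have "bij_betw (\<lambda>(p, q). (w q, w p)) (inversions r w) (inversions r (pinv w))"
  proof (rule bij_betw_byWitness[where f' = "\<lambda>(p, q). (pinv w q, pinv w p)"])
    show "(\<lambda>(p, q). (w q, w p)) ` inversions r w \<subseteq> inversions r (pinv w)"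
      using im[OF _ w] by blast
    show "(\<lambda>(p, q). (pinv w q, pinv w p)) ` inversions r (pinv w) \<subseteq> inversions r w"
      using im[OF _ permutes_inv[OF w]] unfolding permutes_inv_inv[OF w] by blast
  qed (auto simp: permutes_inverses[OF w])
  then show ?thesis by (simp add: bij_betw_same_card)
qed

lemma length_comp_right:
  assumes w: "w permutes {1..r}" and k: "1 \<le> k" "k < r"
  shows "perm_length r (w \<circ> Transposition.transpose k (Suc k)) < perm_length r w \<longleftrightarrow> w (Suc k) < w k"
    and "perm_length r w < perm_length r (w \<circ> Transposition.transpose k (Suc k)) \<longleftrightarrow> w k < w (Suc k)"
proof -
  have ne: "w k \<noteq> w (Suc k)"
    using permutes_inj[OF w] by (metis injD n_not_Suc_n)
  have "w \<circ> Transposition.transpose k (Suc k) permutes {1..r}"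
    using transpose_permutes[OF k] w by (rule permutes_compose)
  then have len: "perm_length r (w \<circ> Transposition.transpose k (Suc k)) =
      card (inversions r (w \<circ> Transposition.transpose k (Suc k)))" "perm_length r w = card (inversions r w)"
    using w by (simp_all only: perm_length_inversions)
  from ne consider "w k < w (Suc k)" | "w (Suc k) < w k" by linarith
  then have "(perm_length r (w \<circ> Transposition.transpose k (Suc k)) < perm_length r w \<longleftrightarrow> w (Suc k) < w k) \<and>
    (perm_length r w < perm_length r (w \<circ> Transposition.transpose k (Suc k)) \<longleftrightarrow> w k < w (Suc k))"
  proof cases
    case 1
    then have "perm_length r (w \<circ> Transposition.transpose k (Suc k)) = Suc (perm_length r w)"
      unfolding len by (rule card_inversions_ascent[OF k])
    with 1 show ?thesis by simp
  next
    case 2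
    then have "Suc (perm_length r (w \<circ> Transposition.transpose k (Suc k))) = perm_length r w"
      unfolding len by (rule card_inversions_descent[OF k])
    with 2 show ?thesis by linarith
  qed
  then show "perm_length r (w \<circ> Transposition.transpose k (Suc k)) < perm_length r w \<longleftrightarrow> w (Suc k) < w k"
    "perm_length r w < perm_length r (w \<circ> Transposition.transpose k (Suc k)) \<longleftrightarrow> w k < w (Suc k)"
    by blast+
qed

text \<open>Length is invariant under inversion, so the left-hand conditions on \<open>w\<close>
  become right-hand conditions on \<open>pinv w\<close>.\<close>

lemma length_comp_left:
  assumes w: "w permutes {1..r}" and k: "1 \<le> k" "k < r"
  shows "perm_length r (Transposition.transpose k (Suc k) \<circ> w) =
    perm_length r (pinv w \<circ> Transposition.transpose k (Suc k))" "perm_length r (pinv w) = perm_length r w"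
proof -
  let ?s = "Transposition.transpose k (Suc k)"
  have s: "?s permutes {1..r}" using transpose_permutes[OF k] .
  have "pinv (?s \<circ> w) = pinv w \<circ> ?s"
    using o_inv_distrib[OF permutes_bij[OF s] permutes_bij[OF w]] by simp
  moreover have "pinv w \<circ> ?s permutes {1..r}" "?s \<circ> w permutes {1..r}"
    using permutes_compose[OF s permutes_inv[OF w]] permutes_compose[OF w s] .
  ultimately show "perm_length r (?s \<circ> w) = perm_length r (pinv w \<circ> ?s)"
    using card_inversions_inv[of "?s \<circ> w" r] by (simp only: perm_length_inversions)
  show "perm_length r (pinv w) = perm_length r w"
    using w by (simp only: perm_length_inversions permutes_inv card_inversions_inv)
qed

section \<open>Simple reflections in the stabilizers of padded compositions\<close>

lemma transpose_in_row_stabilizer: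
  assumes sum: "sum_list \<rho> = r" and k: "1 \<le> k" "k < r"
  shows "Transposition.transpose k (Suc k) \<in> row_stabilizer r \<rho> \<longleftrightarrow> blk \<rho> k = blk \<rho> (Suc k)"
proof
  let ?s = "Transposition.transpose k (Suc k)"
  assume s: "?s \<in> row_stabilizer r \<rho>"
  have b: "blk \<rho> k < length \<rho>" using blk_less_length[of k \<rho>] k sum by simp
  then have "k \<in> row_block \<rho> (blk \<rho> k)" using k sum by (simp add: row_block_blk)
  moreover have "?s ` row_block \<rho> (blk \<rho> k) = row_block \<rho> (blk \<rho> k)"
    using s b by (simp add: row_stabilizer_def)
  ultimately have "?s k \<in> row_block \<rho> (blk \<rho> k)" by blast
  then show "blk \<rho> k = blk \<rho> (Suc k)" using b by (simp add: row_block_blk)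
next
  let ?s = "Transposition.transpose k (Suc k)"
  assume eq: "blk \<rho> k = blk \<rho> (Suc k)"
  have "?s ` row_block \<rho> j = row_block \<rho> j" if j: "j < length \<rho>" for j
  proof -
    have sub: "?s ` row_block \<rho> j \<subseteq> row_block \<rho> j"
      using eq sum k by (auto simp: row_block_blk[OF j] Transposition.transpose_def)
    then have "?s ` ?s ` row_block \<rho> j \<subseteq> ?s ` row_block \<rho> j" by blast
    then show ?thesis using sub by (simp add: image_image)
  qed
  then show "?s \<in> row_stabilizer r \<rho>"
    using transpose_permutes[OF k] by (simp add: row_stabilizer_def)
qed

lemma blk_append:
  assumes "1 \<le> p" "p \<le> sum_list (xs @ ys)"
  shows "blk (xs @ ys) p = (if p \<le> sum_list xs then blk xs p else length xs + blk ys (p - sum_list xs))"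
proof (cases "p \<le> sum_list xs")
  case True
  have "blk xs p < length xs" using blk_less_length[OF assms(1) True] .
  moreover have "psum xs (blk xs p) < p \<and> p \<le> psum xs (Suc (blk xs p))"
    using blk_eq_iff[OF assms(1) True] by blast
  ultimately have "psum (xs @ ys) (blk xs p) < p \<and> p \<le> psum (xs @ ys) (Suc (blk xs p))"
    by simp
  then show ?thesis using True blk_eq_iff[OF assms] by simp
next
  case False
  then have p: "1 \<le> p - sum_list xs" "p - sum_list xs \<le> sum_list ys" using assms by auto
  have "psum ys (blk ys (p - sum_list xs)) < p - sum_list xs \<and>
      p - sum_list xs \<le> psum ys (Suc (blk ys (p - sum_list xs)))"
    using blk_eq_iff[OF p] by blast
  then have "psum (xs @ ys) (length xs + blk ys (p - sum_list xs)) < p \<and>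
      p \<le> psum (xs @ ys) (Suc (length xs + blk ys (p - sum_list xs)))"
    using False by auto
  then show ?thesis using False blk_eq_iff[OF assms] by simp
qed

lemma blk_replicate: "1 \<le> p \<Longrightarrow> p \<le> N \<Longrightarrow> blk (replicate N 1) p = p - 1"
  by (subst blk_eq_iff) (auto simp: sum_list_replicate)

lemma sum_list_pads:
  assumes "sum_list (lam @ \<mu>) = r"
  shows "sum_list (pad_right r lam) = r" "sum_list (pad_left r \<mu>) = r"
  using assms by (auto simp: pad_right_def pad_left_def sum_list_replicate)

text \<open>Beyond \<open>sum_list lam\<close> every point is a block by itself, so the index
  advances with the point and neighbours never share a block there.\<close>

lemma blk_pad_right:
  assumes "sum_list (lam @ \<mu>) = r" "1 \<le> p" "p \<le> r"
  shows "blk (pad_right r lam) p =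
    (if blk (lam @ \<mu>) p < length lam then blk (lam @ \<mu>) p else length lam + (p - sum_list lam - 1))"
proof -
  have "blk (replicate (r - sum_list lam) 1) (p - sum_list lam) = p - sum_list lam - 1"
    if "\<not> p \<le> sum_list lam"
    using that assms by (intro blk_replicate) auto
  then show ?thesis
    using blk_append[of p lam \<mu>] blk_append[of p lam "replicate (r - sum_list lam) 1"] assms
      sum_list_pads[OF assms(1)] blk_less_length[of p lam]
    by (auto simp: pad_right_def)
qed

lemma blk_pad_left:
  assumes "sum_list (lam @ \<mu>) = r" "1 \<le> p" "p \<le> r"
  shows "blk (pad_left r \<mu>) p =
    (if blk (lam @ \<mu>) p < length lam then p - 1 else sum_list lam + (blk (lam @ \<mu>) p - length lam))"
proof -
  have "blk (replicate (r - sum_list \<mu>) 1) p = p - 1" if "p \<le> sum_list lam"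
    using that assms by (intro blk_replicate) auto
  then show ?thesis
    using blk_append[of p lam \<mu>] blk_append[of p "replicate (r - sum_list \<mu>) 1" \<mu>] assms
      sum_list_pads[OF assms(1)] blk_less_length[of p lam]
    by (auto simp: pad_left_def sum_list_replicate)
qed

text \<open>Blocks are intervals, so comparisons of neighbours chain to comparisons of arbitrary
  pairs. Simple reflections speak of neighbours only, and so do the descents read from Q.\<close>

lemma super_mono_adjacent:
  assumes sum: "sum_list \<rho> = r"
  shows "super_mono m \<rho> w \<longleftrightarrow> (\<forall>k. 1 \<le> k \<and> k < r \<and> blk \<rho> k = blk \<rho> (Suc k) \<longrightarrow>
    (if blk \<rho> k < m then w (Suc k) < w k else w k < w (Suc k)))" (is "_ \<longleftrightarrow> ?adj")
proof
  assume "super_mono m \<rho> w"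
  then show ?adj using super_monoD[of m \<rho> w _ "Suc _"] sum by (metis Suc_leI lessI)
next
  assume adj: ?adj
  show "super_mono m \<rho> w"
    unfolding super_mono_def
  proof (intro allI impI)
    fix p q assume pq: "1 \<le> p \<and> p < q \<and> q \<le> sum_list \<rho> \<and> blk \<rho> p = blk \<rho> q"
    have blk: "blk \<rho> k = blk \<rho> p" if "p \<le> k" "k \<le> q" for k
      using blk_mono[of p k \<rho>] blk_mono[of k q \<rho>] that pq by linarith
    have step: "if blk \<rho> p < m then w (Suc k) < w k else w k < w (Suc k)" if "p \<le> k" "k < q" for k
      using adj[rule_format, of k] blk[of k] blk[of "Suc k"] that pq sum by simp
    show "if blk \<rho> p < m then w q < w p else w p < w q"
    proof (cases "blk \<rho> p < m")
      case True
      have "w q < w p"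
        by (rule adjacent_trans[where R = "\<lambda>a b. b < a" and w = w])
          (use step True pq in \<open>auto simp: transp_def\<close>)
      then show ?thesis using True by simp
    next
      case False
      have "w p < w q"
        by (rule adjacent_trans[where R = "(<)" and w = w])
          (use step False pq in \<open>auto simp: transp_def\<close>)
      then show ?thesis using False by simp
    qed
  qed
qed

text \<open>The two paddings share out the neighbours inside a block of \<open>lam @ \<mu>\<close>:
  pairs in even blocks belong to \<open>pad_right\<close>, pairs in odd blocks to
  \<open>pad_left\<close>. Together the length conditions on one side amount to
  \<open>super_mono\<close>.\<close>

lemma double_coset_reps_iff:
  assumes lm: "(lam, \<mu>) \<in> bicompositions m n r" and xe: "(\<xi>, \<eta>) \<in> bicompositions m n r"
  shows "x \<in> double_coset_reps r (lam, \<mu>) (\<xi>, \<eta>) \<longleftrightarrow>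
    x permutes {1..r} \<and> super_mono m (lam @ \<mu>) (pinv x) \<and> super_mono m (\<xi> @ \<eta>) x"
proof (cases "x permutes {1..r}")
  case True
  let ?s = "\<lambda>k. Transposition.transpose k (Suc k)"
  have reflections: "(\<forall>s \<in> simple_reflections r \<inter> row_stabilizer r \<rho>. F s) \<longleftrightarrow>
      (\<forall>k. 1 \<le> k \<and> k < r \<and> blk \<rho> k = blk \<rho> (Suc k) \<longrightarrow> F (?s k))" if "sum_list \<rho> = r" for F \<rho>
    using transpose_in_row_stabilizer[OF that] unfolding simple_reflections_def by blast
  have right: "sum_list (ys @ zs) = r \<Longrightarrow> 1 \<le> k \<Longrightarrow> k < r \<Longrightarrow>
      blk (pad_right r ys) k = blk (pad_right r ys) (Suc k) \<longleftrightarrow>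
      blk (ys @ zs) k = blk (ys @ zs) (Suc k) \<and> blk (ys @ zs) k < length ys" for ys zs k
    using blk_mono[of k "Suc k" "ys @ zs"] blk_append[of k ys zs] blk_less_length[of k ys]
    by (auto simp: blk_pad_right split: if_splits)
  have left: "sum_list (ys @ zs) = r \<Longrightarrow> 1 \<le> k \<Longrightarrow> k < r \<Longrightarrow>
      blk (pad_left r zs) k = blk (pad_left r zs) (Suc k) \<longleftrightarrow>
      blk (ys @ zs) k = blk (ys @ zs) (Suc k) \<and> \<not> blk (ys @ zs) k < length ys" for ys zs k
    using blk_mono[of k "Suc k" "ys @ zs"] blk_append[of k ys zs] blk_less_length[of k ys]
    by (auto simp: blk_pad_left split: if_splits)
  have side: "(\<forall>k. 1 \<le> k \<and> k < r \<and> blk (pad_right r ys) k = blk (pad_right r ys) (Suc k) \<longrightarrow> w (Suc k) < w k) \<and>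
      (\<forall>k. 1 \<le> k \<and> k < r \<and> blk (pad_left r zs) k = blk (pad_left r zs) (Suc k) \<longrightarrow> w k < w (Suc k))
      \<longleftrightarrow> super_mono m (ys @ zs) w" if "sum_list (ys @ zs) = r" "length ys = m" for ys zs and w :: "nat \<Rightarrow> nat"
    using right[OF that(1)] left[OF that(1)] that(2) unfolding super_mono_adjacent[OF that(1)]
    by (smt (verit, del_insts))
  have sums: "sum_list (lam @ \<mu>) = r" "length lam = m" "sum_list (\<xi> @ \<eta>) = r" "length \<xi> = m"
    using lm xe by (auto simp: bicompositions_def compositions_def)
  have inv: "pinv x permutes {1..r}" using True by (rule permutes_inv)
  have lengths: "perm_length r (?s k \<circ> x) < perm_length r x \<longleftrightarrow> pinv x (Suc k) < pinv x k"
      "perm_length r x < perm_length r (?s k \<circ> x) \<longleftrightarrow> pinv x k < pinv x (Suc k)"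
      "perm_length r (x \<circ> ?s k) < perm_length r x \<longleftrightarrow> x (Suc k) < x k"
      "perm_length r x < perm_length r (x \<circ> ?s k) \<longleftrightarrow> x k < x (Suc k)"
    if "1 \<le> k" "k < r" for k
    using length_comp_right[OF True that] length_comp_right[OF inv that] length_comp_left[OF True that]
    by simp_all
  have "x \<in> double_coset_reps r (lam, \<mu>) (\<xi>, \<eta>) \<longleftrightarrow>
      ((\<forall>k. 1 \<le> k \<and> k < r \<and> blk (pad_right r lam) k = blk (pad_right r lam) (Suc k) \<longrightarrow> pinv x (Suc k) < pinv x k) \<and>
      (\<forall>k. 1 \<le> k \<and> k < r \<and> blk (pad_left r \<mu>) k = blk (pad_left r \<mu>) (Suc k) \<longrightarrow> pinv x k < pinv x (Suc k))) \<and>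
      ((\<forall>k. 1 \<le> k \<and> k < r \<and> blk (pad_right r \<xi>) k = blk (pad_right r \<xi>) (Suc k) \<longrightarrow> x (Suc k) < x k) \<and>
      (\<forall>k. 1 \<le> k \<and> k < r \<and> blk (pad_left r \<eta>) k = blk (pad_left r \<eta>) (Suc k) \<longrightarrow> x k < x (Suc k)))"
    unfolding double_coset_reps_def prod.case mem_Collect_eq
      reflections[OF sum_list_pads(1)[OF sums(1)]] reflections[OF sum_list_pads(2)[OF sums(1)]]
      reflections[OF sum_list_pads(1)[OF sums(3)]] reflections[OF sum_list_pads(2)[OF sums(3)]]
    using True lengths by blast
  then show ?thesis
    unfolding side[OF sums(1,2)] side[OF sums(3,4)] using True by blast
qed (simp add: double_coset_reps_def)

text \<open>The candidate for the longest element: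
  \<open>psum \<rho> k + psum \<rho> (Suc k) + 1\<close> is the sum of the first and the last point
  of block \<open>k\<close>, so each block is reflected in its midpoint.\<close>

definition rev_perm :: "nat list \<Rightarrow> nat \<Rightarrow> nat" where
  "rev_perm \<rho> p = (if p \<in> {1..sum_list \<rho>} then psum \<rho> (blk \<rho> p) + psum \<rho> (Suc (blk \<rho> p)) + 1 - p else p)"

lemma rev_perm_block:
  assumes p: "p \<in> {1..sum_list \<rho>}"
  shows "rev_perm \<rho> p \<in> {1..sum_list \<rho>}" "blk \<rho> (rev_perm \<rho> p) = blk \<rho> p"
    "rev_perm \<rho> (rev_perm \<rho> p) = p"
proof -
  have b: "psum \<rho> (blk \<rho> p) < p" "p \<le> psum \<rho> (Suc (blk \<rho> p))"
    using blk_eq_iff[of p \<rho> "blk \<rho> p"] p by auto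
  then have v: "psum \<rho> (blk \<rho> p) < rev_perm \<rho> p" "rev_perm \<rho> p \<le> psum \<rho> (Suc (blk \<rho> p))"
    using p by (simp_all add: rev_perm_def)
  then show r: "rev_perm \<rho> p \<in> {1..sum_list \<rho>}"
    using psum_le[of "Suc (blk \<rho> p)" \<rho>] by simp
  then show bl: "blk \<rho> (rev_perm \<rho> p) = blk \<rho> p"
    using v blk_eq_iff[of "rev_perm \<rho> p" \<rho> "blk \<rho> p"] by simp
  have "rev_perm \<rho> (rev_perm \<rho> p) = psum \<rho> (blk \<rho> p) + psum \<rho> (Suc (blk \<rho> p)) + 1 - rev_perm \<rho> p"
    using r bl by (simp only: rev_perm_def[of \<rho> "rev_perm \<rho> p"] if_True)
  then show "rev_perm \<rho> (rev_perm \<rho> p) = p"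
    using p b by (simp add: rev_perm_def[of \<rho> p])
qed

lemma rev_perm_permutes: "rev_perm \<rho> permutes {1..sum_list \<rho>}"
proof (rule bij_imp_permutes)
  show "bij_betw (rev_perm \<rho>) {1..sum_list \<rho>} {1..sum_list \<rho>}"
    by (rule bij_betw_byWitness[where f' = "rev_perm \<rho>"]) (use rev_perm_block in blast)+
qed (simp only: rev_perm_def if_not_P if_False)

lemma rev_perm_less:
  assumes "1 \<le> p" "p < q" "q \<le> sum_list \<rho>" "blk \<rho> p = blk \<rho> q"
  shows "rev_perm \<rho> q < rev_perm \<rho> p"
proof -
  have "q \<le> psum \<rho> (Suc (blk \<rho> q))" using blk_eq_iff[of q \<rho> "blk \<rho> q"] assms by simp
  then show ?thesis using assms by (simp add: rev_perm_def)
qed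

lemma row_stabilizer_blk:
  assumes sum: "sum_list \<rho> = r"
  shows "w \<in> row_stabilizer r \<rho> \<longleftrightarrow> w permutes {1..r} \<and> (\<forall>p\<in>{1..r}. blk \<rho> (w p) = blk \<rho> p)"
proof
  assume w: "w \<in> row_stabilizer r \<rho>"
  have "blk \<rho> (w p) = blk \<rho> p" if p: "p \<in> {1..r}" for p
  proof -
    have b: "blk \<rho> p < length \<rho>" using blk_less_length[of p \<rho>] p sum by simp
    then have "p \<in> row_block \<rho> (blk \<rho> p)" using p sum by (simp add: row_block_blk)
    then have "w p \<in> row_block \<rho> (blk \<rho> p)" using w b by (auto simp: row_stabilizer_def)
    then show ?thesis using b by (simp add: row_block_blk)
  qed
  then show "w permutes {1..r} \<and> (\<forall>p\<in>{1..r}. blk \<rho> (w p) = blk \<rho> p)"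
    using w by (simp add: row_stabilizer_def)
next
  assume w: "w permutes {1..r} \<and> (\<forall>p\<in>{1..r}. blk \<rho> (w p) = blk \<rho> p)"
  have "w ` row_block \<rho> j = row_block \<rho> j" if j: "j < length \<rho>" for j
  proof (rule card_subset_eq)
    show "w ` row_block \<rho> j \<subseteq> row_block \<rho> j"
      using w permutes_mem[of w "{1..r}"] sum by (auto simp: row_block_blk[OF j] simp del: atLeastAtMost_iff)
    show "finite (row_block \<rho> j)" by (simp add: row_block_def)
    show "card (w ` row_block \<rho> j) = card (row_block \<rho> j)"
      using w by (intro card_image) (auto intro: permutes_inj_on)
  qed
  then show "w \<in> row_stabilizer r \<rho>" using w by (simp add: row_stabilizer_def)
qed

text \<open>A permutation preserving the blocks can invert only pairs inside a block, and
  \<open>rev_perm\<close> inverts all of them. Its length is therefore maximal, and any other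
  element of that length has the same inversions.\<close>

lemma longest_elt_eq:
  assumes "sum_list lam \<le> r"
  shows "longest_elt r lam = rev_perm (pad_right r lam)"
proof -
  define \<rho> where "\<rho> = pad_right r lam"
  have sum: "sum_list \<rho> = r"
    using assms by (simp add: \<rho>_def pad_right_def sum_list_replicate)
  define pairs where "pairs = {(p, q). 1 \<le> p \<and> p < q \<and> q \<le> r \<and> blk \<rho> p = blk \<rho> q}"
  have fin: "finite pairs"
    by (rule finite_subset[of _ "{1..r} \<times> {1..r}"]) (auto simp: pairs_def)
  have sub: "inversions r w \<subseteq> pairs" if w: "w \<in> row_stabilizer r \<rho>" for w
  proof (clarsimp simp: inversions_def pairs_def)
    fix p q assume pq: "Suc 0 \<le> p" "p < q" "q \<le> r" "w q < w p"
    have wb: "w permutes {1..r}" "blk \<rho> (w p) = blk \<rho> p" "blk \<rho> (w q) = blk \<rho> q"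
      using w pq unfolding row_stabilizer_blk[OF sum] by auto
    have "w p \<in> {1..r}" using permutes_mem[OF wb(1), of p] pq by simp
    then have "blk \<rho> q \<le> blk \<rho> p"
      using blk_mono[of "w q" "w p" \<rho>] pq(4) wb(2,3) sum by simp
    then show "blk \<rho> p = blk \<rho> q"
      using blk_mono[of p q \<rho>] pq sum by simp
  qed
  have stab: "rev_perm \<rho> \<in> row_stabilizer r \<rho>"
    using rev_perm_permutes[of \<rho>] rev_perm_block(2)[of _ \<rho>] sum by (simp add: row_stabilizer_blk)
  have "pairs \<subseteq> inversions r (rev_perm \<rho>)"
    using rev_perm_less[of _ _ \<rho>] sum by (auto simp: inversions_def pairs_def)
  then have rev: "inversions r (rev_perm \<rho>) = pairs" using sub[OF stab] by blast
  have len: "perm_length r w = card (inversions r w)" if "w \<in> row_stabilizer r \<rho>" for w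
    using that by (intro perm_length_inversions) (simp add: row_stabilizer_def)
  have "is_arg_max (perm_length r) (\<lambda>v. v \<in> row_stabilizer r \<rho>) (rev_perm \<rho>)"
    unfolding is_arg_max_def using stab sub len rev card_mono[OF fin] by (simp add: not_less)
  moreover have "w = rev_perm \<rho>"
    if "is_arg_max (perm_length r) (\<lambda>v. v \<in> row_stabilizer r \<rho>) w" for w
  proof -
    have w: "w \<in> row_stabilizer r \<rho>" and "\<not> perm_length r w < perm_length r (rev_perm \<rho>)"
      using that stab by (auto simp: is_arg_max_def)
    then have "card pairs \<le> card (inversions r w)" using len[OF w] len[OF stab] rev by simp
    then have inv: "inversions r w = pairs" using sub[OF w] fin by (metis card_seteq)
    have perm: "w permutes {1..r}" "rev_perm \<rho> permutes {1..r}"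
      using w stab by (auto simp: row_stabilizer_def)
    \<comment> \<open>For an injective function the inversions decide all comparisons.\<close>
    have less: "u p < u q \<longleftrightarrow> (if p < q then (p, q) \<notin> inversions r u else (q, p) \<in> inversions r u)"
      if "u permutes {1..r}" "p \<in> {1..r}" "q \<in> {1..r}" for u p q
      using that permutes_inj[OF that(1)] by (auto simp: inversions_def not_less le_less inj_eq)
    show ?thesis
      using less[OF perm(1)] less[OF perm(2)] unfolding inv rev
      by (intro permutes_eqI_order[OF perm]) simp
  qed
  ultimately show ?thesis
    unfolding longest_elt_def \<rho>_def[symmetric] by (intro the_equality)
qed

section \<open>Row insertion\<close>

fun above :: "nat list \<Rightarrow> nat list list \<Rightarrow> bool" where
  "above R [] \<longleftrightarrow> True"
| "above R (R' # _) \<longleftrightarrow> length R' \<le> length R \<and> (\<forall>j < length R'. R ! j < R' ! j)"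

text \<open>Standard tableaux on an arbitrary set of numbers, as they arise in the middle of an
  insertion. Distinctness of the entries is kept as a separate hypothesis.\<close>

fun tab :: "nat list list \<Rightarrow> bool" where
  "tab [] \<longleftrightarrow> True"
| "tab (R # Rs) \<longleftrightarrow> R \<noteq> [] \<and> sorted_wrt (<) R \<and> above R Rs \<and> tab Rs"

declare dropWhile_eq_Nil_conv [simp del] takeWhile_eq_all_conv [simp del]

lemma row_insert_append:
  "dropWhile (\<lambda>y. y < x) R = [] \<Longrightarrow> row_insert x (R # Rs) = ((R @ [x]) # Rs, 0)"
  by simp

lemma row_insert_bump:
  "dropWhile (\<lambda>y. y < x) R = y # ys \<Longrightarrow> row_insert x (R # Rs) =
     ((takeWhile (\<lambda>y. y < x) R @ x # ys) # fst (row_insert y Rs), Suc (snd (row_insert y Rs)))"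
  by (simp add: Let_def case_prod_beta)

declare row_insert.simps(2) [simp del]

text \<open>If no element is bumped, the truncation below is \<open>tl [] = []\<close>, so that \<open>x\<close> is appended.\<close>

definition row_ins :: "nat \<Rightarrow> nat list \<Rightarrow> nat list" where
  "row_ins x R = takeWhile (\<lambda>y. y < x) R @ x # tl (dropWhile (\<lambda>y. y < x) R)"

lemma fst_row_insert_Cons: "\<exists>Rs'. fst (row_insert x (R # Rs)) = row_ins x R # Rs'"
proof (cases "dropWhile (\<lambda>y. y < x) R")
  case Nil
  moreover from this have "takeWhile (\<lambda>y. y < x) R = R"
    by (metis append_Nil2 takeWhile_dropWhile_id)
  ultimately show ?thesis using \<open>dropWhile (\<lambda>y. y < x) R = []\<close> by (simp add: row_insert_append row_ins_def)
next
  case (Cons y ys)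
  then show ?thesis by (simp add: row_insert_bump row_ins_def)
qed

lemma split_row:
  fixes x :: nat
  assumes "dropWhile (\<lambda>y. y < x) R = y # ys"
  obtains pre where "R = pre @ y # ys" "takeWhile (\<lambda>y. y < x) R = pre" "\<forall>z\<in>set pre. z < x" "x \<le> y"
proof
  show "R = takeWhile (\<lambda>y. y < x) R @ y # ys"
    using takeWhile_dropWhile_id[of "\<lambda>y. y < x" R] assms by simp
  show "\<forall>z\<in>set (takeWhile (\<lambda>y. y < x) R). z < x"
    using set_takeWhileD[of _ "\<lambda>y. y < x" R] by blast
  show "x \<le> y"
    using hd_dropWhile[of "\<lambda>y. y < x" R] assms by simp
qed simp

lemma dropWhile_NilD: "dropWhile (\<lambda>y. y < (x::nat)) R = [] \<Longrightarrow> z \<in> set R \<Longrightarrow> z < x"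
  by (metis dropWhile_eq_Nil_conv)

lemma less_length_takeWhile:
  fixes R :: "nat list"
  assumes "sorted_wrt (<) R" "q < length R"
  shows "q < length (takeWhile (\<lambda>y. y < x) R) \<longleftrightarrow> R ! q < x"
proof
  assume "q < length (takeWhile (\<lambda>y. y < x) R)"
  then show "R ! q < x"
    using nth_mem[of q "takeWhile (\<lambda>y. y < x) R"] set_takeWhileD[of _ "\<lambda>y. y < x" R]
    by (metis takeWhile_nth)
next
  assume q: "R ! q < x"
  show "q < length (takeWhile (\<lambda>y. y < x) R)"
  proof (rule ccontr)
    let ?t = "length (takeWhile (\<lambda>y. y < x) R)"
    assume "\<not> q < ?t"
    then have t: "?t \<le> q" by simp
    then have "\<not> R ! ?t < x"
      using nth_length_takeWhile[of "\<lambda>y. y < x" R] assms(2) by simp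
    moreover have "R ! ?t \<le> R ! q"
      using t assms sorted_wrt_nth_less[OF assms(1), of ?t q] by (cases "?t = q") auto
    ultimately show False using q by simp
  qed
qed

lemma length_row_ins: "length (row_ins x R) = max (length R) (Suc (length (takeWhile (\<lambda>y. y < x) R)))"
proof -
  have "length (takeWhile (\<lambda>y. y < x) R) + length (dropWhile (\<lambda>y. y < x) R) = length R"
    by (metis length_append takeWhile_dropWhile_id)
  then show ?thesis by (auto simp: row_ins_def max_def)
qed

lemma row_ins_nth:
  assumes "q < length (row_ins x R)"
  shows "row_ins x R ! q = (if q = length (takeWhile (\<lambda>y. y < x) R) then x else R ! q)"
proof (cases "dropWhile (\<lambda>y. y < x) R")
  case Nil
  then have "takeWhile (\<lambda>y. y < x) R = R"
    by (metis append_Nil2 takeWhile_dropWhile_id)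
  then show ?thesis using assms Nil by (simp add: row_ins_def nth_append)
next
  case (Cons y ys)
  then obtain pre where "R = pre @ y # ys" "takeWhile (\<lambda>y. y < x) R = pre"
    by (rule split_row)
  then show ?thesis using assms Cons by (simp add: row_ins_def nth_append nth_Cons')
qed

lemma sorted_row_ins:
  assumes "sorted_wrt (<) R" "x \<notin> set R"
  shows "sorted_wrt (<) (row_ins x R)"
proof (cases "dropWhile (\<lambda>y. y < x) R")
  case Nil
  then have "takeWhile (\<lambda>y. y < x) R = R"
    by (metis append_Nil2 takeWhile_dropWhile_id)
  then show ?thesis
    using assms Nil dropWhile_NilD[OF Nil] by (simp add: row_ins_def sorted_wrt_append)
next
  case (Cons y ys)
  then obtain pre where R: "R = pre @ y # ys" "takeWhile (\<lambda>y. y < x) R = pre"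
      "\<forall>z\<in>set pre. z < x" "x \<le> y"
    by (rule split_row)
  then have "x < y" using assms(2) by (metis in_set_conv_decomp le_neq_implies_less)
  moreover have "sorted_wrt (<) (pre @ y # ys)" using assms R(1) by simp
  ultimately show ?thesis
    using R Cons by (auto simp: row_ins_def sorted_wrt_append)
qed

lemma mset_row_insert: "mset (concat (fst (row_insert x P))) = add_mset x (mset (concat P))"
proof (induction P arbitrary: x)
  case (Cons R Rs)
  show ?case
  proof (cases "dropWhile (\<lambda>y. y < x) R")
    case Nil
    then show ?thesis by (simp add: row_insert_append)
  next
    case C: (Cons y ys)
    then obtain pre where R: "R = pre @ y # ys" "takeWhile (\<lambda>y. y < x) R = pre"
      by (rule split_row)
    show ?thesis
      unfolding row_insert_bump[OF C] R(2) using Cons[of y] by (simp add: R(1))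
  qed
qed simp

lemma set_row_insert: "set (concat (fst (row_insert x P))) = insert x (set (concat P))"
  using mset_row_insert[of x P] by (metis set_mset_add_mset_insert set_mset_mset)

lemma distinct_row_insert:
  "distinct (concat P) \<Longrightarrow> x \<notin> set (concat P) \<Longrightarrow> distinct (concat (fst (row_insert x P)))"
proof -
  assume "distinct (concat P)" "x \<notin> set (concat P)"
  then have "distinct (x # concat P)" by simp
  moreover have "mset (concat (fst (row_insert x P))) = mset (x # concat P)"
    by (simp only: mset_row_insert mset.simps)
  ultimately show ?thesis using mset_eq_imp_distinct_iff by blast
qed

section \<open>Effect of an insertion on the shape and on the tableau property\<close>

definition inc_shape :: "nat \<Rightarrow> nat list \<Rightarrow> nat list" where
  "inc_shape k s = (if k < length s then s[k := Suc (s ! k)] else s @ [1])"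

lemma shape_row_insert:
  "shape (fst (row_insert x P)) = inc_shape (snd (row_insert x P)) (shape P) \<and>
     snd (row_insert x P) \<le> length P"
proof (induction P arbitrary: x)
  case (Cons R Rs)
  show ?case
  proof (cases "dropWhile (\<lambda>y. y < x) R")
    case Nil
    then show ?thesis by (simp add: row_insert_append shape_def inc_shape_def)
  next
    case C: (Cons y ys)
    then obtain pre where R: "R = pre @ y # ys" "takeWhile (\<lambda>y. y < x) R = pre"
      by (rule split_row)
    show ?thesis
      unfolding row_insert_bump[OF C] R(2) using Cons[of y] by (simp add: R(1) shape_def inc_shape_def)
  qed
qed (simp add: shape_def inc_shape_def)

lemma shape_add_cell: "shape (add_cell k i Q) = inc_shape k (shape Q)"
  by (auto simp: shape_def inc_shape_def add_cell_def map_update)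

text \<open>The bumped entry \<open>y\<close> moves weakly to the left: the entry below its old
  place \<open>p\<close> exceeds \<open>y\<close>, so \<open>y\<close> lands at some
  \<open>q0\<close> with \<open>q0 \<le> p\<close>. Up to \<open>p\<close> the new upper row has
  only entries smaller than \<open>y\<close>, and elsewhere its entries have not grown.\<close>

lemma above_row_insert:
  assumes sorted: "sorted_wrt (<) R" and drop: "dropWhile (\<lambda>y. y < x) R = y # ys"
    and above: "above R Rs" and tab: "tab Rs"
    and dist: "x \<notin> set R" "y \<notin> set (concat Rs)"
  shows "above (row_ins x R) (fst (row_insert y Rs))"
proof -
  define p where "p = length (takeWhile (\<lambda>y. y < x) R)"
  obtain pre where R: "R = pre @ y # ys" "takeWhile (\<lambda>y. y < x) R = pre"
      "\<forall>z\<in>set pre. z < x" "x \<le> y"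
    using drop by (rule split_row)
  then have p: "p < length R" "R ! p = y" by (simp_all add: p_def)
  have "x < y" using R(1,4) dist(1) by (metis in_set_conv_decomp le_neq_implies_less)
  have len: "length (row_ins x R) = length R"
    using p(1) unfolding length_row_ins p_def by simp
  have le: "row_ins x R ! q \<le> R ! q" "q \<noteq> p \<Longrightarrow> row_ins x R ! q = R ! q" if "q < length R" for q
    using row_ins_nth[of q x R] that len p R(4) by (simp_all add: p_def[symmetric])
  have le_p: "row_ins x R ! q < y" if "q \<le> p" for q
  proof (cases "q = p")
    case True
    then show ?thesis using row_ins_nth[of p x R] p len \<open>x < y\<close> by (simp add: p_def[symmetric])
  next
    case False
    then have "R ! q < R ! p" using sorted_wrt_nth_less[OF sorted, of q p] that p by simp
    then show ?thesis using le(2)[of q] False that p by simp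
  qed
  show ?thesis
  proof (cases Rs)
    case Nil
    then show ?thesis using le_p[of 0] len p by (simp; linarith)
  next
    case (Cons S Ss)
    define q0 where "q0 = length (takeWhile (\<lambda>z. z < y) S)"
    have S: "sorted_wrt (<) S" "length S \<le> length R" "\<And>j. j < length S \<Longrightarrow> R ! j < S ! j"
      using tab above Cons by auto
    have q0: "q0 \<le> p"
    proof (rule ccontr)
      assume "\<not> q0 \<le> p"
      then have "p < length (takeWhile (\<lambda>z. z < y) S)" by (simp add: q0_def)
      moreover from this have "p < length S"
        using length_takeWhile_le[of "\<lambda>z. z < y" S] by linarith
      ultimately show False
        using less_length_takeWhile[OF S(1), of p y] S(3)[of p] p by simp
    qed
    obtain Ss' where Ss': "fst (row_insert y Rs) = row_ins y S # Ss'"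
      using fst_row_insert_Cons Cons by blast
    have "length (row_ins y S) \<le> length (row_ins x R)"
      using len length_row_ins[of y S] S(2) q0 p by (simp add: q0_def)
    moreover have "row_ins x R ! q < row_ins y S ! q" if q: "q < length (row_ins y S)" for q
    proof (cases "q = q0")
      case True
      then show ?thesis
        using row_ins_nth[OF q] le_p[of q0] q0 by (simp add: q0_def)
    next
      case False
      then have "q < length S" using q unfolding length_row_ins q0_def[symmetric]
        using length_takeWhile_le[of "\<lambda>z. z < y" S] by (simp add: q0_def max_def split: if_splits)
      then show ?thesis
        using row_ins_nth[OF q] le(1)[of q] S(2) S(3)[of q] False by (simp add: q0_def)
    qed
    ultimately show ?thesis by (simp add: Ss')
  qed
qed

lemma tab_row_insert:
  "tab P \<Longrightarrow> distinct (concat P) \<Longrightarrow> x \<notin> set (concat P) \<Longrightarrow> tab (fst (row_insert x P))"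
proof (induction P arbitrary: x)
  case (Cons R Rs)
  then have R: "R \<noteq> []" "sorted_wrt (<) R" "above R Rs" "tab Rs" "x \<notin> set R"
    by auto
  have sorted: "sorted_wrt (<) (row_ins x R)" using R by (intro sorted_row_ins)
  have ne: "row_ins x R \<noteq> []" by (simp add: row_ins_def)
  show ?case
  proof (cases "dropWhile (\<lambda>y. y < x) R")
    case Nil
    then have "row_ins x R = R @ [x]"
      unfolding row_ins_def by (metis append_Nil2 list.sel(2) takeWhile_dropWhile_id)
    moreover have "above (R @ [x]) Rs"
      using R(3) by (cases Rs) (auto simp: nth_append)
    ultimately show ?thesis
      using sorted R Nil by (simp add: row_insert_append)
  next
    case C: (Cons y ys)
    then obtain pre where pre: "R = pre @ y # ys" "takeWhile (\<lambda>y. y < x) R = pre"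
      by (rule split_row)
    then have y: "y \<notin> set (concat Rs)" using Cons.prems(2) by auto
    have "tab (fst (row_insert y Rs))"
      using Cons.prems(2) y by (intro Cons.IH R) auto
    moreover have "above (row_ins x R) (fst (row_insert y Rs))"
      using R y C by (intro above_row_insert)
    moreover have "fst (row_insert x (R # Rs)) = row_ins x R # fst (row_insert y Rs)"
      using C by (simp add: row_insert_bump row_ins_def)
    ultimately show ?thesis using sorted ne by simp
  qed
qed simp

text \<open>Row bumping lemma for an ascent: in each row the second path runs strictly to the right
  of the first and bumps, if anything, a larger entry. So it ends no lower.\<close>

lemma row_bumping_less:
  "tab P \<Longrightarrow> x < x' \<Longrightarrow> snd (row_insert x' (fst (row_insert x P))) \<le> snd (row_insert x P)"
proof (induction P arbitrary: x x')
  case Nil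
  then show ?case by (simp add: row_insert_append)
next
  case (Cons R Rs)
  show ?case
  proof (cases "dropWhile (\<lambda>y. y < x) R")
    case Nil
    have "z < x'" if "z \<in> set (R @ [x])" for z
      using that dropWhile_NilD[OF Nil, of z] Cons.prems(2) by auto
    then have "dropWhile (\<lambda>y. y < x') (R @ [x]) = []"
      unfolding dropWhile_eq_Nil_conv by blast
    then show ?thesis using Nil by (simp add: row_insert_append)
  next
    case C: (Cons y ys)
    then obtain pre where pre: "R = pre @ y # ys" "takeWhile (\<lambda>y. y < x) R = pre" "\<forall>z\<in>set pre. z < x"
      by (rule split_row)
    have drop: "dropWhile (\<lambda>y. y < x') (pre @ x # ys) = dropWhile (\<lambda>y. y < x') ys"
      using pre(3) Cons.prems(2) by (subst dropWhile_append2) auto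
    show ?thesis
    proof (cases "dropWhile (\<lambda>y. y < x') ys")
      case Nil
      then show ?thesis
        using C pre(2) drop by (simp add: row_insert_append row_insert_bump)
    next
      case D: (Cons y' ys')
      then have "y' \<in> set ys" using set_dropWhileD[of y' "\<lambda>y. y < x'" ys] by simp
      then have "y < y'" using Cons.prems(1) pre(1) by (auto simp: sorted_wrt_append)
      then have "snd (row_insert y' (fst (row_insert y Rs))) \<le> snd (row_insert y Rs)"
        using Cons by simp
      moreover have "dropWhile (\<lambda>y. y < x') (pre @ x # ys) = y' # ys'" using drop D by simp
      ultimately show ?thesis
        using C pre(2) by (simp add: row_insert_bump)
    qed
  qed
qed

text \<open>Row bumping lemma for a descent: where the first path has put \<open>x\<close>, the
  second bumps an entry that is at most \<open>x\<close>, hence smaller than the one bumped before.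
  So it always continues at least one row further.\<close>

lemma row_bumping_greater:
  "tab P \<Longrightarrow> distinct (concat P) \<Longrightarrow> x \<notin> set (concat P) \<Longrightarrow> x' < x \<Longrightarrow>
     snd (row_insert x P) < snd (row_insert x' (fst (row_insert x P)))"
proof (induction P arbitrary: x x')
  case Nil
  then have "dropWhile (\<lambda>y. y < x') [x] = [x]" by simp
  then show ?case by (simp add: row_insert_bump)
next
  case (Cons R Rs)
  show ?case
  proof (cases "dropWhile (\<lambda>y. y < x) R")
    case Nil
    have "dropWhile (\<lambda>y. y < x') (R @ [x]) \<noteq> []"
      using Cons.prems(4) by (simp add: dropWhile_eq_Nil_conv)
    then obtain y' ys' where "dropWhile (\<lambda>y. y < x') (R @ [x]) = y' # ys'"
      by (meson neq_Nil_conv)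
    then show ?thesis using Nil by (simp add: row_insert_append row_insert_bump)
  next
    case C: (Cons y ys)
    then obtain pre where pre: "R = pre @ y # ys" "takeWhile (\<lambda>y. y < x) R = pre"
        "\<forall>z\<in>set pre. z < x" "x \<le> y"
      by (rule split_row)
    have y: "y \<notin> set (concat Rs)" using Cons.prems(2) pre(1) by auto
    have xy: "x < y" using Cons.prems(3) pre(1,4) by (cases "x = y") auto
    have "\<exists>y' ys'. dropWhile (\<lambda>y. y < x') (pre @ x # ys) = y' # ys' \<and> y' \<le> x"
    proof (cases "dropWhile (\<lambda>y. y < x') pre")
      case Nil
      then have "\<forall>z\<in>set pre. z < x'" by (metis dropWhile_NilD)
      then have "dropWhile (\<lambda>y. y < x') (pre @ x # ys) = x # ys"
        using Cons.prems(4) by (subst dropWhile_append2) auto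
      then show ?thesis by blast
    next
      case D: (Cons y' ys')
      then have "y' \<in> set pre" using set_dropWhileD[of y' "\<lambda>y. y < x'" pre] by simp
      then have "y' \<le> x" using pre(3) by (simp add: less_imp_le)
      moreover have "\<not> y' < x'" using hd_dropWhile[of "\<lambda>y. y < x'" pre] D by simp
      then have "dropWhile (\<lambda>y. y < x') (pre @ x # ys) = y' # ys' @ x # ys"
        using dropWhile_append1[OF \<open>y' \<in> set pre\<close>, of "\<lambda>y. y < x'"] D by simp
      ultimately show ?thesis by blast
    qed
    then obtain y' ys' where y': "dropWhile (\<lambda>y. y < x') (pre @ x # ys) = y' # ys'" "y' \<le> x"
      by blast
    have "snd (row_insert y Rs) < snd (row_insert y' (fst (row_insert y Rs)))"
      using Cons.prems xy y' y by (intro Cons.IH) auto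
    then show ?thesis
      using C pre(2) y' by (simp add: row_insert_bump)
  qed
qed

text \<open>The row index shows whether the first row grew or passed an entry \<open>y\<close> on.
  In the latter case \<open>y\<close> is known by induction, and \<open>x\<close> is the last entry
  of the new first row below \<open>y\<close>, since the entries to its right already exceeded
  \<open>y\<close>.\<close>

lemma row_insert_inject:
  "tab P \<Longrightarrow> tab P' \<Longrightarrow> distinct (concat P) \<Longrightarrow> distinct (concat P') \<Longrightarrow>
     x \<notin> set (concat P) \<Longrightarrow> x' \<notin> set (concat P') \<Longrightarrow>
     row_insert x P = row_insert x' P' \<Longrightarrow> x = x' \<and> P = P'"
proof (induction P arbitrary: x x' P')
  case Nil
  show ?case
  proof (cases P')
    case (Cons R Rs)
    then have "R \<noteq> []" using Nil.prems by simp
    then show ?thesis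
      using Nil.prems Cons
      by (cases "dropWhile (\<lambda>y. y < x') R") (simp_all add: row_insert_append row_insert_bump)
  qed (use Nil.prems in simp)
next
  case (Cons R Rs)
  have R: "R \<noteq> []" "sorted_wrt (<) R" using Cons.prems by simp_all
  show ?case
  proof (cases P')
    case Nil
    then show ?thesis
      using Cons.prems R
      by (cases "dropWhile (\<lambda>y. y < x) R") (simp_all add: row_insert_append row_insert_bump)
  next
    case P': (Cons R' Rs')
    have R': "R' \<noteq> []" "sorted_wrt (<) R'" using Cons.prems P' by simp_all
    show ?thesis
    proof (cases "dropWhile (\<lambda>y. y < x) R")
      case Nil
      then show ?thesis
        using Cons.prems(7) P'
        by (cases "dropWhile (\<lambda>y. y < x') R'") (simp_all add: row_insert_append row_insert_bump)
    next
      case C: (Cons y ys)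
      show ?thesis
      proof (cases "dropWhile (\<lambda>y. y < x') R'")
        case Nil
        then show ?thesis
          using Cons.prems(7) P' C by (simp add: row_insert_append row_insert_bump)
      next
        case C': (Cons y' ys')
        obtain pre where pre: "R = pre @ y # ys" "takeWhile (\<lambda>y. y < x) R = pre"
            "\<forall>z\<in>set pre. z < x" "x \<le> y"
          using C by (rule split_row)
        obtain pre' where pre': "R' = pre' @ y' # ys'" "takeWhile (\<lambda>y. y < x') R' = pre'"
            "\<forall>z\<in>set pre'. z < x'" "x' \<le> y'"
          using C' by (rule split_row)
        have eq: "pre @ x # ys = pre' @ x' # ys'"
            "row_insert y Rs = row_insert y' Rs'"
          using Cons.prems(7) P' C C' pre(2) pre'(2)
          by (simp_all add: row_insert_bump prod_eq_iff)
        have "y = y' \<and> Rs = Rs'"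
          using Cons.prems P' pre(1) pre'(1) eq(2) by (intro Cons.IH) auto
        then have yy: "y = y'" "Rs = Rs'" by auto
        have xy: "x < y" using Cons.prems(5) pre(1,4) by (cases "x = y") auto
        have xy': "x' < y'" using Cons.prems(6) pre'(1,4) P' by (cases "x' = y'") auto
        have tw: "takeWhile (\<lambda>z. z < y) (pre @ x # ys) = pre @ [x]"
        proof -
          have "\<forall>z\<in>set (pre @ [x]). z < y" using pre(3) xy by auto
          moreover have "takeWhile (\<lambda>z. z < y) ys = []"
            using R(2) pre(1) by (cases ys) (auto simp: sorted_wrt_append)
          ultimately show ?thesis
            using takeWhile_append2[of "pre @ [x]" "\<lambda>z. z < y" ys] by simp
        qed
        have tw': "takeWhile (\<lambda>z. z < y) (pre' @ x' # ys') = pre' @ [x']"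
        proof -
          have "\<forall>z\<in>set (pre' @ [x']). z < y" using pre'(3) xy' yy by auto
          moreover have "takeWhile (\<lambda>z. z < y) ys' = []"
            using R'(2) pre'(1) yy by (cases ys') (auto simp: sorted_wrt_append)
          ultimately show ?thesis
            using takeWhile_append2[of "pre' @ [x']" "\<lambda>z. z < y" ys'] by simp
        qed
        have "pre @ [x] = pre' @ [x']" using tw tw' eq(1) by simp
        then show ?thesis using eq(1) yy pre(1) pre'(1) P' by simp
      qed
    qed
  qed
qed

section \<open>Reverse insertion\<close>

lemma sorted_first_le: "sorted_wrt (<) S \<Longrightarrow> z \<in> set S \<Longrightarrow> S ! 0 \<le> (z::nat)"
  by (cases S) auto

text \<open>Guarantees in the reverse insertion that a number coming up from below finds a smaller
  entry to replace.\<close>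

lemma tab_first_least: "tab (R # Rs) \<Longrightarrow> z \<in> set (concat Rs) \<Longrightarrow> R ! 0 < z"
proof (induction Rs arbitrary: R)
  case (Cons S Ss)
  have S: "tab (S # Ss)" "above R (S # Ss)" using Cons.prems(1) by simp_all
  then have S': "S \<noteq> []" "sorted_wrt (<) S" by simp_all
  then have lt: "R ! 0 < S ! 0" using S(2) by simp
  show ?case
  proof (cases "z \<in> set S")
    case True
    then show ?thesis using sorted_first_le[OF S'(2)] lt by (meson less_le_trans)
  next
    case False
    then have "z \<in> set (concat Ss)" using Cons.prems(2) by simp
    then have "S ! 0 < z" using S(1) by (intro Cons.IH)
    then show ?thesis using lt by (rule less_trans[rotated])
  qed
qed simp

text \<open>The number \<open>y\<close> expelled from the rows below replaces the last entry
  \<open>x\<close> smaller than it, and \<open>x\<close> is expelled in turn. The corner condition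
  allows the last cell of row \<open>k\<close> to be removed at the start.\<close>

lemma reverse_row_insert:
  "tab P \<Longrightarrow> distinct (concat P) \<Longrightarrow> k < length P \<Longrightarrow>
     (Suc k < length P \<Longrightarrow> length (P ! Suc k) < length (P ! k)) \<Longrightarrow>
     \<exists>x P'. tab P' \<and> row_insert x P' = (P, k)"
proof (induction P arbitrary: k)
  case (Cons R Rs)
  have R: "R \<noteq> []" "sorted_wrt (<) R" "above R Rs" "tab Rs"
    using Cons.prems(1) by auto
  show ?case
  proof (cases k)
    case 0
    obtain R0 x where R0: "R = R0 @ [x]" using R(1) by (metis rev_exhaust)
    show ?thesis
    proof (cases "R0 = []")
      case True
      have "Rs = []"
        using Cons.prems(4) 0 R0 True R(4) by (cases Rs) auto
      then have "row_insert x [] = (R # Rs, k)" using R0 True 0 by simp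
      then show ?thesis by (metis tab.simps(1))
    next
      case False
      have "\<forall>z\<in>set R0. z < x" using R(2) R0 by (simp add: sorted_wrt_append)
      then have "row_insert x (R0 # Rs) = (R # Rs, k)"
        using R0 0 by (simp add: row_insert_append dropWhile_eq_Nil_conv)
      moreover have "above R0 Rs"
        using R(3) R0 Cons.prems(4) 0 by (cases Rs) (auto simp: nth_append)
      then have "tab (R0 # Rs)" using R R0 False by (simp add: sorted_wrt_append)
      ultimately show ?thesis by blast
    qed
  next
    case (Suc k')
    obtain y Rs' where IH: "tab Rs'" "row_insert y Rs' = (Rs, k')"
      using Cons.IH[of k'] Cons.prems Suc R(4) by auto
    have set: "set (concat Rs) = insert y (set (concat Rs'))"
      using set_row_insert[of y Rs'] IH(2) by simp
    have dist: "distinct (y # concat Rs')"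
    proof -
      have "mset (concat Rs) = mset (y # concat Rs')"
        using mset_row_insert[of y Rs'] IH(2) by simp
      then show ?thesis using Cons.prems(2) by (metis concat.simps(2) distinct_append mset_eq_imp_distinct_iff)
    qed
    have y0: "R ! 0 < y" using tab_first_least[OF Cons.prems(1), of y] set by blast
    have yR: "y \<notin> set R" using Cons.prems(2) set by auto
    define l where "l = length (takeWhile (\<lambda>z. z < y) R)"
    have "0 < l" unfolding l_def using less_length_takeWhile[OF R(2), of 0 y] y0 R(1) by simp
    then obtain pre x where pre: "takeWhile (\<lambda>z. z < y) R = pre @ [x]"
      unfolding l_def by (metis length_greater_0_conv rev_exhaust)
    define ys where "ys = dropWhile (\<lambda>z. z < y) R"
    have Req: "R = pre @ x # ys"
      using takeWhile_dropWhile_id[of "\<lambda>z. z < y" R] pre by (simp add: ys_def)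
    have l: "l = Suc (length pre)" using pre by (simp add: l_def)
    have less: "\<forall>z\<in>set pre. z < x" "x < y"
      using R(2) Req set_takeWhileD[of x "\<lambda>z. z < y" R] pre by (auto simp: sorted_wrt_append)
    have greater: "\<forall>z\<in>set ys. y < z"
    proof
      fix z assume "z \<in> set ys"
      then obtain q where q: "q < length ys" "z = ys ! q" by (metis in_set_conv_nth)
      then have "R ! (l + q) = z" "l + q < length R" by (simp_all add: Req l nth_append)
      then have "y \<le> z" using less_length_takeWhile[OF R(2), of "l + q" y] by (simp add: l_def)
      moreover have "z \<noteq> y" using yR \<open>z \<in> set ys\<close> Req by auto
      ultimately show "y < z" by simp
    qed
    let ?R' = "pre @ y # ys"
    have "dropWhile (\<lambda>z. z < x) ?R' = y # ys" "takeWhile (\<lambda>z. z < x) ?R' = pre"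
      using less by (subst dropWhile_append2 takeWhile_append2; simp)+
    then have ins: "row_insert x (?R' # Rs') = (R # Rs, k)"
      using IH(2) Suc by (simp add: row_insert_bump Req)
    have sorted: "sorted_wrt (<) ?R'"
      using R(2) less greater Req by (fastforce simp: sorted_wrt_append)
    have "above ?R' Rs'"
    proof (cases Rs')
      case (Cons S' Ss)
      obtain Ss' where Ss': "Rs = row_ins y S' # Ss'"
        using fst_row_insert_Cons[of y S' Ss] IH(2) Cons by auto
      define q0 where "q0 = length (takeWhile (\<lambda>z. z < y) S')"
      have S': "sorted_wrt (<) S'" "y \<notin> set S'" using IH(1) Cons dist by auto
      have aS: "length (row_ins y S') \<le> length R"
          "\<And>q. q < length (row_ins y S') \<Longrightarrow> R ! q < row_ins y S' ! q"
        using R(3) Ss' by auto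
      have len: "length S' \<le> length (row_ins y S')" "q0 < length (row_ins y S')"
        by (simp_all add: length_row_ins q0_def)
      have "R ! q0 < y" using aS(2)[OF len(2)] row_ins_nth[OF len(2)] by (simp add: q0_def)
      \<comment> \<open>The cell of \<open>y\<close> in the row below lies under an entry smaller
        than \<open>y\<close>, hence weakly to the left of the place that \<open>y\<close> now
        takes. So the entry below that place, if any, exceeds \<open>y\<close>.\<close>
      then have q0: "q0 < l"
        unfolding l_def using less_length_takeWhile[OF R(2), of q0 y] len(2) aS(1) by simp
      have "?R' ! q < S' ! q" if q: "q < length S'" for q
      proof (cases "q = length pre")
        case True
        have "\<not> S' ! q < y"
          using less_length_takeWhile[OF S'(1) q, of y] q0 True l by (simp add: q0_def)
        moreover have "S' ! q \<noteq> y" using S'(2) q nth_mem by metis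
        ultimately show ?thesis using True by simp
      next
        case False
        then have "?R' ! q = R ! q" by (simp add: Req nth_append nth_Cons')
        also have "\<dots> < row_ins y S' ! q" using aS(2)[of q] q len(1) by simp
        also have "\<dots> \<le> S' ! q"
          using row_ins_nth[of q y S'] q len(1) less_length_takeWhile[OF S'(1) q, of y]
          by (auto simp: not_less)
        finally show ?thesis .
      qed
      then show ?thesis using Cons len(1) aS(1) by (simp add: Req)
    qed simp
    then have "tab (?R' # Rs')" using sorted IH(1) by simp
    then show ?thesis using ins by blast
  qed
qed simp

section \<open>The Robinson--Schensted correspondence\<close>

lemma tab_nth:
  "tab P \<Longrightarrow> k < length P \<Longrightarrow> P ! k \<noteq> [] \<and> sorted_wrt (<) (P ! k) \<and>
     (Suc k < length P \<longrightarrow> length (P ! Suc k) \<le> length (P ! k) \<and>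
        (\<forall>j < length (P ! Suc k). P ! k ! j < P ! Suc k ! j))"
proof (induction P arbitrary: k)
  case (Cons R Rs)
  show ?case
  proof (cases k)
    case 0
    then show ?thesis using Cons.prems by (cases Rs) auto
  next
    case (Suc k')
    then show ?thesis using Cons.prems Cons.IH[of k'] by simp
  qed
qed simp

text \<open>The row of the cell created at time \<open>Suc i\<close>; these rows are the information
  that the recording tableau carries.\<close>

definition row_step :: "nat \<Rightarrow> (nat \<Rightarrow> nat) \<Rightarrow> nat" where
  "row_step i w = snd (row_insert (w (Suc i)) (fst (RS i w)))"

lemma RS_Suc:
  "RS (Suc r) w = (fst (row_insert (w (Suc r)) (fst (RS r w))), add_cell (row_step r w) (Suc r) (snd (RS r w)))"
  by (simp add: case_prod_beta Let_def row_step_def)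

declare RS.simps(2) [simp del]

lemma RS_P:
  "inj_on w {1..r} \<Longrightarrow> tab (fst (RS r w)) \<and> distinct (concat (fst (RS r w))) \<and>
     set (concat (fst (RS r w))) = w ` {1..r}"
proof (induction r)
  case (Suc r)
  have ins: "{1..Suc r} = insert (Suc r) {1..r}" by auto
  have inj: "inj_on w {1..r}" and new: "w (Suc r) \<notin> w ` {1..r}"
    using Suc.prems unfolding ins by auto
  have IH: "tab (fst (RS r w))" "distinct (concat (fst (RS r w)))"
      "set (concat (fst (RS r w))) = w ` {1..r}"
    using Suc.IH[OF inj] by blast+
  show ?case
    unfolding RS_Suc fst_conv ins image_insert set_row_insert IH(3)
    using tab_row_insert[OF IH(1,2)] distinct_row_insert[OF IH(2)] new unfolding IH(3) by blast
qed simp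

lemma shape_RS: "shape (snd (RS r w)) = shape (fst (RS r w))"
proof (induction r)
  case (Suc r)
  then show ?case
    using shape_row_insert[of "w (Suc r)" "fst (RS r w)"]
    by (simp add: RS_Suc shape_add_cell row_step_def)
qed (simp add: shape_def)

lemma length_RS: "length (snd (RS r w)) = length (fst (RS r w))"
  using shape_RS[of r w] unfolding shape_def by (metis length_map)

lemma row_step_le: "row_step r w \<le> length (snd (RS r w))"
  using shape_row_insert[of "w (Suc r)" "fst (RS r w)"] by (simp add: row_step_def length_RS)

lemma add_cell_simps [simp]:
  "add_cell k i [] = [[i]]"
  "add_cell 0 i (R # Q) = (R @ [i]) # Q"
  "add_cell (Suc k) i (R # Q) = R # add_cell k i Q"
  by (simp_all add: add_cell_def)

lemma mset_add_cell: "mset (concat (add_cell k i Q)) = add_mset i (mset (concat Q))"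
proof (induction Q arbitrary: k)
  case (Cons R Q)
  then show ?case by (cases k) simp_all
qed simp

lemma mset_Q: "mset (concat (snd (RS r w))) = mset [1..<Suc r]"
proof (induction r)
  case (Suc r)
  then show ?case by (simp add: RS_Suc mset_add_cell)
qed simp

lemma Q_entries: "set (concat (snd (RS r w))) = {1..r}"
proof -
  have "set (concat (snd (RS r w))) = set [1..<Suc r]"
    using mset_Q[of r w] by (metis set_mset_mset)
  then show ?thesis by (simp only: set_upt atLeastLessThanSuc_atLeastAtMost)
qed

lemma add_cell_rows:
  "R \<in> set (add_cell k i Q) \<Longrightarrow> R \<in> set Q \<or> R = [i] \<or> (\<exists>R'\<in>set Q. R = R' @ [i])"
proof (induction Q arbitrary: k)
  case (Cons S Q)
  then show ?case by (cases k) auto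
qed simp

lemma Q_rows: "R \<in> set (snd (RS r w)) \<Longrightarrow> R \<noteq> [] \<and> sorted_wrt (<) R"
proof (induction r arbitrary: R)
  case (Suc r)
  then consider "R \<in> set (snd (RS r w))" | "R = [Suc r]" | R' where "R' \<in> set (snd (RS r w))" "R = R' @ [Suc r]"
    using add_cell_rows[of R "row_step r w" "Suc r" "snd (RS r w)"] by (auto simp: RS_Suc)
  then show ?case
  proof cases
    case (3 R')
    have "set R' \<subseteq> {1..r}" using Q_entries[of r w] 3(1) by auto
    then show ?thesis using Suc.IH[OF 3(1)] 3(2) by (auto simp: sorted_wrt_append)
  qed (use Suc.IH in auto)
qed simp

text \<open>The entry \<open>i\<close> occurs only in the new cell, so this cell can be found and
  deleted. Nonempty rows exclude confusing a new row with an empty row that was lengthened.\<close>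

lemma add_cell_inject:
  "add_cell k i Q = add_cell k' i Q' \<Longrightarrow> k \<le> length Q \<Longrightarrow> k' \<le> length Q' \<Longrightarrow>
     i \<notin> set (concat Q) \<Longrightarrow> i \<notin> set (concat Q') \<Longrightarrow> [] \<notin> set Q \<Longrightarrow> [] \<notin> set Q' \<Longrightarrow> k = k' \<and> Q = Q'"
proof (induction Q arbitrary: k k' Q')
  case Nil
  then show ?case by (cases Q'; cases k') auto
next
  case (Cons R Q)
  show ?case
  proof (cases Q')
    case Nil
    then show ?thesis using Cons.prems by (cases k) auto
  next
    case Q': (Cons R' Qs')
    show ?thesis
    proof (cases k; cases k')
      fix j j' assume "k = Suc j" "k' = Suc j'"
      then show ?thesis using Cons.prems Cons.IH[of j j' Qs'] Q' by simp
    qed (use Cons.prems Q' in auto)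
  qed
qed

lemma Q_step_inject:
  assumes "snd (RS (Suc r) w) = snd (RS (Suc r) w')"
  shows "row_step r w = row_step r w'" "snd (RS r w) = snd (RS r w')"
proof -
  have "Suc r \<notin> set (concat (snd (RS r u)))" "[] \<notin> set (snd (RS r u))" for u
    using Q_entries[of r u] Q_rows[of "[]" r u] by auto
  then have "row_step r w = row_step r w' \<and> snd (RS r w) = snd (RS r w')"
    using assms by (intro add_cell_inject[where i = "Suc r"]) (auto simp: RS_Suc row_step_le)
  then show "row_step r w = row_step r w'" "snd (RS r w) = snd (RS r w')" by blast+
qed

lemma row_steps_eq:
  "snd (RS r w) = snd (RS r w') \<Longrightarrow> i < r \<Longrightarrow> row_step i w = row_step i w'"
proof (induction r)
  case (Suc r)
  then show ?case using Q_step_inject[OF Suc.prems(1)] by (cases "i = r") auto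
qed simp

text \<open>The two row bumping lemmas are exclusive alternatives, so the rows of two successive
  cells tell whether \<open>w\<close> ascends there. This is why descents are visible in Q.\<close>

lemma row_step_ascent:
  assumes inj: "inj_on w {1..r}" and i: "Suc (Suc i) \<le> r"
  shows "row_step (Suc i) w \<le> row_step i w \<longleftrightarrow> w (Suc i) < w (Suc (Suc i))"
proof -
  have inj': "inj_on w {1..i}" by (rule inj_on_subset[OF inj]) (use i in auto)
  have P: "tab (fst (RS i w))" "distinct (concat (fst (RS i w)))"
      "set (concat (fst (RS i w))) = w ` {1..i}"
    using RS_P[OF inj'] by blast+
  have new: "w (Suc i) \<notin> set (concat (fst (RS i w)))"
  proof
    assume "w (Suc i) \<in> set (concat (fst (RS i w)))"
    then obtain j where "j \<in> {1..i}" "w (Suc i) = w j" unfolding P(3) by blast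
    then show False using inj_onD[OF inj, of "Suc i" j] i by simp
  qed
  have ne: "w (Suc i) \<noteq> w (Suc (Suc i))"
    using inj_onD[OF inj, of "Suc i" "Suc (Suc i)"] i by auto
  have step: "row_step (Suc i) w = snd (row_insert (w (Suc (Suc i))) (fst (row_insert (w (Suc i)) (fst (RS i w)))))"
    by (simp add: row_step_def[of "Suc i"] RS_Suc)
  show ?thesis
    using row_bumping_less[OF P(1), of "w (Suc i)" "w (Suc (Suc i))"]
      row_bumping_greater[OF P(1,2) new, of "w (Suc (Suc i))"] ne
    unfolding step row_step_def[of i] by (metis leD linorder_neqE_nat)
qed

lemma same_Q_same_descents:
  assumes "snd (RS r w) = snd (RS r w')" "inj_on w {1..r}" "inj_on w' {1..r}" "1 \<le> i" "i < r"
  shows "w i < w (Suc i) \<longleftrightarrow> w' i < w' (Suc i)"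
proof -
  obtain j where j: "i = Suc j" using assms(4) by (cases i) auto
  have "row_step j w = row_step j w'" "row_step (Suc j) w = row_step (Suc j) w'"
    using row_steps_eq[OF assms(1)] assms(5) j by auto
  then show ?thesis
    using row_step_ascent[OF assms(2), of j] row_step_ascent[OF assms(3), of j] assms(5) j by simp
qed

lemma RS_inject:
  "RS r w = RS r w' \<Longrightarrow> inj_on w {1..r} \<Longrightarrow> inj_on w' {1..r} \<Longrightarrow> i \<in> {1..r} \<Longrightarrow> w i = w' i"
proof (induction r)
  case (Suc r)
  have ins: "{1..Suc r} = insert (Suc r) {1..r}" by auto
  have P: "tab (fst (RS r u))" "distinct (concat (fst (RS r u)))" "u (Suc r) \<notin> set (concat (fst (RS r u)))"
    if "inj_on u {1..Suc r}" for u
  proof -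
    have inj: "inj_on u {1..r}" and new: "u (Suc r) \<notin> u ` {1..r}"
      using that unfolding ins by auto
    then show "tab (fst (RS r u))" "distinct (concat (fst (RS r u)))" "u (Suc r) \<notin> set (concat (fst (RS r u)))"
      using RS_P[OF inj] by auto
  qed
  have Q: "row_step r w = row_step r w'" "snd (RS r w) = snd (RS r w')"
    using Q_step_inject[of r w w'] Suc.prems(1) by simp_all
  have "row_insert (w (Suc r)) (fst (RS r w)) = row_insert (w' (Suc r)) (fst (RS r w'))"
    using Suc.prems(1) Q(1) by (simp add: RS_Suc row_step_def prod_eq_iff)
  then have "w (Suc r) = w' (Suc r) \<and> fst (RS r w) = fst (RS r w')"
    using P[OF Suc.prems(2)] P[OF Suc.prems(3)] by (intro row_insert_inject)
  moreover from this have "RS r w = RS r w'" using Q(2) by (simp add: prod_eq_iff)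
  moreover have "inj_on w {1..r}" "inj_on w' {1..r}"
    using Suc.prems(2,3) unfolding ins by auto
  ultimately show ?case using Suc.IH Suc.prems(4) unfolding ins by blast
qed simp

lemma RS_inject_permutes:
  assumes "w permutes {1..r}" "w' permutes {1..r}" "RS r w = RS r w'"
  shows "w = w'"
proof
  fix i
  show "w i = w' i"
    using RS_inject[OF assms(3) permutes_inj_on[OF assms(1)] permutes_inj_on[OF assms(2)], of i] assms(1,2)
      permutes_not_in[OF assms(1), of i] permutes_not_in[OF assms(2), of i] by metis
qed

lemma RS_cong: "(\<And>i. 1 \<le> i \<Longrightarrow> i \<le> r \<Longrightarrow> w i = w' i) \<Longrightarrow> RS r w = RS r w'"
proof (induction r)
  case (Suc r)
  then have "RS r w = RS r w'" "w (Suc r) = w' (Suc r)" by simp_all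
  then show ?case by (simp add: RS_Suc row_step_def)
qed simp

section \<open>Surjectivity of the correspondence\<close>

lemma above_add_cell: "above R (add_cell k i Q) \<Longrightarrow> above R Q"
proof (cases Q)
  case (Cons S Ss)
  assume "above R (add_cell k i Q)"
  then obtain S' Ss' where S': "add_cell k i Q = S' # Ss'" "above R (S' # Ss')" "S' = S \<or> S' = S @ [i]"
    using Cons by (cases k) auto
  have "R ! j < S ! j" if "j < length S" for j
  proof -
    have "R ! j < S' ! j" using S'(2,3) that by auto
    then show ?thesis using S'(3) that by (auto simp: nth_append)
  qed
  then show ?thesis using S'(2,3) Cons by auto
qed simp

lemma remove_corner:
  "tab Q \<Longrightarrow> k < length Q \<Longrightarrow> (Suc k < length Q \<Longrightarrow> length (Q ! Suc k) < length (Q ! k)) \<Longrightarrow>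
     \<exists>Q'. tab Q' \<and> k \<le> length Q' \<and> add_cell k (last (Q ! k)) Q' = Q"
proof (induction Q arbitrary: k)
  case (Cons R Rs)
  have R: "R \<noteq> []" "sorted_wrt (<) R" "above R Rs" "tab Rs"
    using Cons.prems(1) by auto
  show ?case
  proof (cases k)
    case 0
    obtain R0 x where R0: "R = R0 @ [x]" using R(1) by (metis rev_exhaust)
    show ?thesis
    proof (cases "R0 = []")
      case True
      have "Rs = []" using Cons.prems(3) 0 R0 True R(4) by (cases Rs) auto
      then show ?thesis using R0 True 0 by (intro exI[of _ "[]"]) simp
    next
      case False
      have "above R0 Rs"
        using R(3) R0 Cons.prems(3) 0 by (cases Rs) (auto simp: nth_append)
      then have "tab (R0 # Rs)" using R R0 False by (simp add: sorted_wrt_append)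
      then show ?thesis using R0 0 by (intro exI[of _ "R0 # Rs"]) simp
    qed
  next
    case (Suc k')
    obtain Q' where Q': "tab Q'" "k' \<le> length Q'" "add_cell k' (last (Rs ! k')) Q' = Rs"
      using Cons.IH[of k'] Cons.prems Suc R(4) by auto
    have "above R Q'"
      using R(3) above_add_cell[of R k' "last (Rs ! k')" Q'] Q'(3) by simp
    then have "tab (R # Q')" using R Q'(1) by simp
    then show ?thesis using Q' Suc by (intro exI[of _ "R # Q'"]) simp
  qed
qed simp

lemma tab_nonempty: "tab P \<Longrightarrow> [] \<notin> set P"
  by (induction P) auto

text \<open>With positive parts, the new part \<open>k\<close> equals 1 exactly when a row was
  opened, so the increment can be undone.\<close>

lemma inc_shape_inject:
  assumes eq: "inc_shape k s = inc_shape k s'" and "k \<le> length s" "k \<le> length s'" "0 \<notin> set s" "0 \<notin> set s'"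
  shows "s = s'"
proof -
  have *: "k < length t \<longleftrightarrow> 1 < inc_shape k t ! k" if "k \<le> length t" "0 \<notin> set t" for t
  proof (cases "k < length t")
    case True
    then have "t ! k \<noteq> 0" using that(2) nth_mem[of k t] by metis
    then show ?thesis using True by (simp add: inc_shape_def)
  qed (use that in \<open>simp add: inc_shape_def nth_append\<close>)
  show ?thesis
  proof (cases "k < length s")
    case True
    then have True': "k < length s'" using *[of s] *[of s'] assms by simp
    have upd: "s[k := Suc (s ! k)] = s'[k := Suc (s' ! k)]"
      using eq True True' by (simp add: inc_shape_def)
    then have "s ! k = s' ! k" using True True' by (metis Suc_inject nth_list_update_eq)
    then show ?thesis using upd by (metis list_update_id list_update_overwrite)
  next
    case False
    then have "\<not> k < length s'" using *[of s] *[of s'] assms by simp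
    then show ?thesis using eq False by (simp add: inc_shape_def)
  qed
qed

text \<open>The largest number of Q sits in a corner, which names the row where the last insertion
  ended; deleting it and reversing the insertion leaves tableaux of equal shape. P may have
  arbitrary distinct entries because each step of the induction removes an arbitrary one.\<close>

lemma RS_surj:
  "tab P \<Longrightarrow> tab Q \<Longrightarrow> shape P = shape Q \<Longrightarrow> distinct (concat P) \<Longrightarrow> distinct (concat Q) \<Longrightarrow>
     set (concat Q) = {1..r} \<Longrightarrow> \<exists>w. RS r w = (P, Q)"
proof (induction r arbitrary: P Q)
  case 0
  have "Q = []" using 0(2,6) by (cases Q) auto
  moreover from this have "P = []" using 0(3) by (simp add: shape_def)
  ultimately show ?case by simp
next
  case (Suc r)
  have "Suc r \<in> set (concat Q)" using Suc.prems(6) by simp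
  then obtain k j where kj: "k < length Q" "j < length (Q ! k)" "Q ! k ! j = Suc r"
    by (auto simp: in_set_conv_nth)
  have le: "Q ! k' ! j' \<le> Suc r" if "k' < length Q" "j' < length (Q ! k')" for k' j'
  proof -
    have "Q ! k' \<in> set Q" "Q ! k' ! j' \<in> set (Q ! k')" using that by simp_all
    then have "Q ! k' ! j' \<in> set (concat Q)" by auto
    then show ?thesis unfolding Suc.prems(6) by simp
  qed
  have last: "j = length (Q ! k) - 1"
  proof (rule ccontr)
    assume "j \<noteq> length (Q ! k) - 1"
    then have j: "Suc j < length (Q ! k)" using kj(2) by simp
    have "sorted_wrt (<) (Q ! k)" using tab_nth[OF Suc.prems(2) kj(1)] by blast
    then have "Q ! k ! j < Q ! k ! Suc j" using j by (simp add: sorted_wrt_nth_less)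
    then show False using le[OF kj(1) j] kj(3) by simp
  qed
  then have last': "last (Q ! k) = Suc r" using kj by (subst last_conv_nth) auto
  have corner: "length (Q ! Suc k) < length (Q ! k)" if "Suc k < length Q"
  proof (rule ccontr)
    assume "\<not> length (Q ! Suc k) < length (Q ! k)"
    then have "j < length (Q ! Suc k)" using kj(2) by simp
    then have "Q ! k ! j < Q ! Suc k ! j" using tab_nth[OF Suc.prems(2) kj(1)] that by blast
    then show False using le[OF that \<open>j < length (Q ! Suc k)\<close>] kj(3) by simp
  qed
  obtain Q' where Q': "tab Q'" "k \<le> length Q'" "add_cell k (Suc r) Q' = Q"
    using remove_corner[OF Suc.prems(2) kj(1) corner] last' by auto
  have len: "length P = length Q" "\<And>i. i < length Q \<Longrightarrow> length (P ! i) = length (Q ! i)"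
  proof -
    show "length P = length Q" using Suc.prems(3) unfolding shape_def by (metis length_map)
    then show "length (P ! i) = length (Q ! i)" if "i < length Q" for i
      using that Suc.prems(3) unfolding shape_def by (metis nth_map)
  qed
  have "k < length P" using len kj(1) by simp
  moreover have "length (P ! Suc k) < length (P ! k)" if "Suc k < length P"
    using corner that len kj(1) by simp
  ultimately obtain x P' where P': "tab P'" "row_insert x P' = (P, k)"
    using reverse_row_insert[OF Suc.prems(1,4), of k] by blast
  have "mset (concat P) = mset (x # concat P')"
    using mset_row_insert[of x P'] P'(2) by simp
  then have dP: "distinct (concat P')"
    using Suc.prems(4) by (metis distinct.simps(2) mset_eq_imp_distinct_iff)
  have msQ: "mset (concat Q) = mset (Suc r # concat Q')"
    using mset_add_cell[of k "Suc r" Q'] Q'(3) by simp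
  then have dQ: "distinct (Suc r # concat Q')"
    using Suc.prems(5) by (metis mset_eq_imp_distinct_iff)
  have sQ: "set (concat Q') = {1..r}"
  proof -
    have eq: "set (concat Q) = insert (Suc r) (set (concat Q'))"
      using msQ by (metis list.simps(15) set_mset_mset)
    have "{1..Suc r} = insert (Suc r) {1..r}" by auto
    then have "insert (Suc r) (set (concat Q')) = insert (Suc r) {1..r}"
      using eq Suc.prems(6) by metis
    moreover have "Suc r \<notin> set (concat Q')" using dQ by simp
    ultimately show ?thesis using insert_ident[of "Suc r" "set (concat Q')" "{1..r}"] by simp
  qed
  have inc: "inc_shape k (shape P') = inc_shape k (shape Q')"
    using shape_row_insert[of x P'] P'(2) shape_add_cell[of k "Suc r" Q'] Q'(3) Suc.prems(3) by simp
  have kP: "k \<le> length P'" using shape_row_insert[of x P'] P'(2) by simp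
  have "0 \<notin> set (shape P')" "0 \<notin> set (shape Q')"
    using tab_nonempty[OF P'(1)] tab_nonempty[OF Q'(1)] by (auto simp: shape_def)
  then have shape: "shape P' = shape Q'"
    using inc_shape_inject[OF inc] kP Q'(2) by (simp add: shape_def)
  obtain w where w: "RS r w = (P', Q')"
    using Suc.IH[OF P'(1) Q'(1) shape dP _ sQ] dQ by auto
  have "RS r (w(Suc r := x)) = RS r w" by (rule RS_cong) simp
  then have "RS (Suc r) (w(Suc r := x)) = (P, Q)"
    using w P'(2) Q'(3) by (simp add: RS_Suc row_step_def)
  then show ?case by blast
qed

lemma RS_surj_permutes:
  assumes "tab P" "tab Q" "shape P = shape Q" "distinct (concat P)" "distinct (concat Q)"
    "set (concat P) = {1..r}" "set (concat Q) = {1..r}"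
  shows "\<exists>w. w permutes {1..r} \<and> RS r w = (P, Q)"
proof -
  obtain w where w: "RS r w = (P, Q)" using RS_surj[OF assms(1-5,7)] by blast
  have set: "set (concat (fst (RS i u))) = u ` {1..i}" for i u
  proof (induction i)
    case (Suc i)
    have "{1..Suc i} = insert (Suc i) {1..i}" by auto
    then show ?case using Suc by (simp only: RS_Suc fst_conv set_row_insert image_insert)
  qed simp
  \<comment> \<open>\<open>RS\<close> does not see the values outside {1..r}; they are reset so that
    a permutation results.\<close>
  define w' where "w' i = (if i \<in> {1..r} then w i else i)" for i
  have "w' ` {1..r} = w ` {1..r}" by (rule image_cong) (simp_all add: w'_def)
  then have "w' ` {1..r} = {1..r}" using set[of r w] w assms(6) by simp
  then have "bij_betw w' {1..r} {1..r}"
    by (simp add: bij_betw_def eq_card_imp_inj_on)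
  then have "w' permutes {1..r}"
    by (rule bij_imp_permutes) (simp only: w'_def if_not_P if_False)
  moreover have "RS r w' = (P, Q)"
    using w by (subst RS_cong[of r w' w]) (simp_all add: w'_def)
  ultimately show ?thesis by blast
qed

section \<open>Growth diagrams and the symmetry of the correspondence\<close>

text \<open>The vertices of the growth diagram: shapes are functions giving the row lengths.\<close>

fun subshape :: "nat list list \<Rightarrow> nat \<Rightarrow> nat \<Rightarrow> nat" where
  "subshape [] j = (\<lambda>a. 0)"
| "subshape (R # Rs) j = case_nat (length (filter (\<lambda>z. z \<le> j) R)) (subshape Rs j)"

definition add_box :: "nat \<Rightarrow> (nat \<Rightarrow> nat) \<Rightarrow> nat \<Rightarrow> nat" where
  "add_box k f = f(k := Suc (f k))"

lemma add_box_case_nat [simp]: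
  "add_box 0 (case_nat a f) = case_nat (Suc a) f"
  "add_box (Suc k) (case_nat a f) = case_nat a (add_box k f)"
  by (auto simp: add_box_def fun_eq_iff split: nat.splits)

lemma case_nat_eq_iff [simp]: "case_nat a f = case_nat b g \<longleftrightarrow> a = b \<and> f = g"
proof
  assume "case_nat a f = case_nat b g"
  then have "case_nat a f n = case_nat b g n" for n by simp
  from this[of 0] this[of "Suc _"] show "a = b \<and> f = g" by auto
qed simp

lemma filter_le_Suc_absent:
  "Suc j \<notin> set R \<Longrightarrow> filter (\<lambda>z. z \<le> Suc j) R = filter (\<lambda>z. z \<le> j) R"
  by (rule filter_cong) (auto simp: le_Suc_eq)

lemma filter_le_Suc_present:
  "Suc j \<in> set R \<Longrightarrow> distinct R \<Longrightarrow>
     length (filter (\<lambda>z. z \<le> Suc j) R) = Suc (length (filter (\<lambda>z. z \<le> j) R))"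
proof (induction R)
  case (Cons z R)
  then show ?case by (cases "z = Suc j") (auto simp: filter_le_Suc_absent)
qed simp

lemma subshape_absent: "Suc j \<notin> set (concat P) \<Longrightarrow> subshape P (Suc j) = subshape P j"
  by (induction P) (simp_all add: filter_le_Suc_absent)

lemma subshape_present:
  "Suc j \<in> set (concat P) \<Longrightarrow> distinct (concat P) \<Longrightarrow>
     \<exists>c. subshape P (Suc j) = add_box c (subshape P j)"
proof (induction P)
  case (Cons R Rs)
  show ?case
  proof (cases "Suc j \<in> set R")
    case True
    then have "Suc j \<notin> set (concat Rs)" using Cons.prems(2) by auto
    then have "subshape (R # Rs) (Suc j) = add_box 0 (subshape (R # Rs) j)"
      using True Cons.prems(2) filter_le_Suc_present[OF True] by (simp add: subshape_absent)
    then show ?thesis by blast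
  next
    case False
    then obtain c where "subshape Rs (Suc j) = add_box c (subshape Rs j)"
      using Cons by auto
    then have "subshape (R # Rs) (Suc j) = add_box (Suc c) (subshape (R # Rs) j)"
      using False by (simp add: filter_le_Suc_absent)
    then show ?thesis by blast
  qed
qed simp

text \<open>The numbers moved along the path are all at least \<open>x\<close>, so the cells with
  entries up to \<open>j\<close> stay untouched.\<close>

lemma subshape_insert_large: "j < x \<Longrightarrow> subshape (fst (row_insert x P)) j = subshape P j"
proof (induction P arbitrary: x)
  case (Cons R Rs)
  show ?case
  proof (cases "dropWhile (\<lambda>y. y < x) R")
    case Nil
    then show ?thesis using Cons.prems by (simp add: row_insert_append)
  next
    case C: (Cons y ys)
    then obtain pre where R: "R = pre @ y # ys" "takeWhile (\<lambda>y. y < x) R = pre"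
        "\<forall>z\<in>set pre. z < x" "x \<le> y"
      by (rule split_row)
    show ?thesis
      unfolding row_insert_bump[OF C] R(2) using Cons.IH[of y] Cons.prems R(4) by (simp add: R(1))
  qed
qed (simp add: fun_eq_iff split: nat.splits)

text \<open>The numbers up to \<open>j\<close> undergo a row insertion of their own. It ends in the
  first row where the path bumps nothing or a number above \<open>j\<close>.\<close>

lemma subshape_insert_small:
  "x \<le> j \<Longrightarrow> \<exists>k. subshape (fst (row_insert x P)) j = add_box k (subshape P j)"
proof (induction P arbitrary: x)
  case Nil
  have "subshape (fst (row_insert x [])) j = add_box 0 (subshape [] j)"
    using Nil by (simp add: fun_eq_iff add_box_def split: nat.splits)
  then show ?case by blast
next
  case (Cons R Rs)
  show ?case
  proof (cases "dropWhile (\<lambda>y. y < x) R")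
    case Nil
    then have "subshape (fst (row_insert x (R # Rs))) j = add_box 0 (subshape (R # Rs) j)"
      using Cons.prems by (simp add: row_insert_append)
    then show ?thesis by blast
  next
    case C: (Cons y ys)
    then obtain pre where R: "R = pre @ y # ys" "takeWhile (\<lambda>y. y < x) R = pre"
        "\<forall>z\<in>set pre. z < x" "x \<le> y"
      by (rule split_row)
    show ?thesis
    proof (cases "y \<le> j")
      case True
      then obtain k where "subshape (fst (row_insert y Rs)) j = add_box k (subshape Rs j)"
        using Cons.IH by blast
      then have "subshape (fst (row_insert x (R # Rs))) j = add_box (Suc k) (subshape (R # Rs) j)"
        unfolding row_insert_bump[OF C] R(2) using True Cons.prems by (simp add: R(1))
      then show ?thesis by blast
    next
      case False
      then have "subshape (fst (row_insert x (R # Rs))) j = add_box 0 (subshape (R # Rs) j)"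
        unfolding row_insert_bump[OF C] R(2) using subshape_insert_large[of j y Rs] Cons.prems
        by (simp add: R(1))
      then show ?thesis by blast
    qed
  qed
qed

text \<open>Among the numbers up to \<open>Suc j\<close> the inserted one is the largest, so it
  settles at the end of the first row.\<close>

lemma subshape_insert_new:
  assumes "Suc j \<notin> set (concat P)"
  shows "subshape (fst (row_insert (Suc j) P)) (Suc j) = add_box 0 (subshape P j)"
proof (cases P)
  case Nil
  then show ?thesis by (simp add: fun_eq_iff add_box_def split: nat.splits)
next
  case P: (Cons R Rs)
  have absent: "filter (\<lambda>z. z \<le> Suc j) R = filter (\<lambda>z. z \<le> j) R" "subshape Rs (Suc j) = subshape Rs j"
    using assms P by (auto intro: filter_le_Suc_absent subshape_absent)
  show ?thesis
  proof (cases "dropWhile (\<lambda>y. y < Suc j) R")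
    case Nil
    then show ?thesis using absent P by (simp add: row_insert_append)
  next
    case C: (Cons y ys)
    then obtain pre where R: "R = pre @ y # ys" "takeWhile (\<lambda>y. y < Suc j) R = pre"
        "\<forall>z\<in>set pre. z < Suc j" "Suc j \<le> y"
      by (rule split_row)
    then have "Suc j < y" using assms P by (cases "y = Suc j") auto
    then show ?thesis
      unfolding P row_insert_bump[OF C] R(2)
      using arg_cong[OF absent(1), of length] absent(2) subshape_insert_large[of "Suc j" y Rs]
      by (simp add: R(1))
  qed
qed

text \<open>The insertion and the number \<open>Suc j\<close> each add a box to the shape of the
  numbers up to \<open>j\<close>, in rows \<open>k\<close> and \<open>c\<close>. They collide when
  the path displaces \<open>Suc j\<close> from row \<open>c\<close>; as the largest number under
  consideration it then settles at the end of row \<open>Suc c\<close>.\<close>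

lemma subshape_insert:
  "tab P \<Longrightarrow> distinct (concat P) \<Longrightarrow> x \<notin> set (concat P) \<Longrightarrow> x < Suc j \<Longrightarrow> Suc j \<in> set (concat P) \<Longrightarrow>
     \<exists>k c. subshape (fst (row_insert x P)) j = add_box k (subshape P j) \<and>
       subshape P (Suc j) = add_box c (subshape P j) \<and>
       subshape (fst (row_insert x P)) (Suc j) =
         (if k = c then add_box (Suc c) (add_box c (subshape P j)) else add_box k (add_box c (subshape P j)))"
proof (induction P arbitrary: x)
  case (Cons R Rs)
  have R: "sorted_wrt (<) R" "tab Rs" "distinct R" "distinct (concat Rs)"
    using Cons.prems by auto
  show ?case
  proof (cases "dropWhile (\<lambda>y. y < x) R")
    case Nil
    then have absent: "Suc j \<notin> set R" using dropWhile_NilD[OF Nil, of "Suc j"] Cons.prems(4) by auto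
    then have "Suc j \<in> set (concat Rs)" using Cons.prems(5) by simp
    then obtain c where c: "subshape Rs (Suc j) = add_box c (subshape Rs j)"
      using subshape_present R(4) by blast
    show ?thesis
      using Nil Cons.prems(4) c filter_le_Suc_absent[OF absent]
      by (intro exI[of _ 0] exI[of _ "Suc c"]) (simp add: row_insert_append)
  next
    case C: (Cons y ys)
    then obtain pre where pre: "R = pre @ y # ys" "takeWhile (\<lambda>y. y < x) R = pre"
        "\<forall>z\<in>set pre. z < x" "x \<le> y"
      by (rule split_row)
    have y: "y \<notin> set (concat Rs)" using Cons.prems(2) pre(1) by auto
    have xy: "x < y" using Cons.prems(3) pre(1,4) by (cases "x = y") auto
    have ys: "\<forall>z\<in>set ys. y < z" using R(1) pre(1) by (simp add: sorted_wrt_append)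
    have npre: "Suc j \<notin> set pre" using pre(3) Cons.prems(4) by auto
    have ins: "fst (row_insert x (R # Rs)) = (pre @ x # ys) # fst (row_insert y Rs)"
      by (simp add: row_insert_bump[OF C] pre(2))
    \<comment> \<open>The place of \<open>Suc j\<close> relative to the bumped entry
      \<open>y\<close>: to its right, below it with a path going on among smaller numbers, equal to
      it, or below it and left alone by the path.\<close>
    consider "y < Suc j" "Suc j \<in> set R" | "y < Suc j" "Suc j \<notin> set R" | "y = Suc j" | "Suc j < y"
      by linarith
    then show ?thesis
    proof cases
      case 1
      then have "Suc j \<notin> set (concat Rs)" using Cons.prems(2) by auto
      then have absent: "subshape Rs (Suc j) = subshape Rs j"
          "subshape (fst (row_insert y Rs)) (Suc j) = subshape (fst (row_insert y Rs)) j"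
        using set_row_insert[of y Rs] 1(1) by (auto intro!: subshape_absent)
      obtain k where k: "subshape (fst (row_insert y Rs)) j = add_box k (subshape Rs j)"
        using subshape_insert_small[of y j Rs] 1(1) by auto
      have "Suc j \<in> set ys" using 1 npre pre(1) by auto
      then have "length (filter (\<lambda>z. z \<le> Suc j) ys) = Suc (length (filter (\<lambda>z. z \<le> j) ys))"
        using R(3) pre(1) by (intro filter_le_Suc_present) simp_all
      then show ?thesis
        using 1(1) Cons.prems(4) absent k filter_le_Suc_absent[OF npre] unfolding ins
        by (intro exI[of _ "Suc k"] exI[of _ 0]) (simp add: pre(1))
    next
      case 2
      then have "Suc j \<in> set (concat Rs)" using Cons.prems(5) by simp
      then obtain k c where kc: "subshape (fst (row_insert y Rs)) j = add_box k (subshape Rs j)"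
          "subshape Rs (Suc j) = add_box c (subshape Rs j)"
          "subshape (fst (row_insert y Rs)) (Suc j) =
            (if k = c then add_box (Suc c) (add_box c (subshape Rs j)) else add_box k (add_box c (subshape Rs j)))"
        using Cons.IH[OF R(2,4) y 2(1)] by blast
      have "filter (\<lambda>z. z \<le> Suc j) ys = filter (\<lambda>z. z \<le> j) ys"
        using 2(2) pre(1) by (intro filter_le_Suc_absent) simp
      then show ?thesis
        using 2(1) Cons.prems(4) kc filter_le_Suc_absent[OF npre] unfolding ins
        by (intro exI[of _ "Suc k"] exI[of _ "Suc c"]) (simp add: pre(1))
    next
      case 3
      have absent: "subshape Rs (Suc j) = subshape Rs j" using y 3 by (intro subshape_absent) simp
      have "subshape (fst (row_insert y Rs)) j = subshape Rs j" using 3 by (intro subshape_insert_large) simp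
      moreover have "subshape (fst (row_insert y Rs)) (Suc j) = add_box 0 (subshape Rs j)"
        unfolding 3 by (rule subshape_insert_new) (use y 3 in simp)
      moreover have "filter (\<lambda>z. z \<le> Suc j) ys = filter (\<lambda>z. z \<le> j) ys"
        using ys 3 by (intro filter_le_Suc_absent) auto
      ultimately show ?thesis
        using 3 Cons.prems(4) absent filter_le_Suc_absent[OF npre] unfolding ins
        by (intro exI[of _ 0] exI[of _ 0]) (simp add: pre(1))
    next
      case 4
      then have "Suc j \<notin> set R" using npre pre(1) ys by auto
      then have "Suc j \<in> set (concat Rs)" using Cons.prems(5) by simp
      then obtain c where c: "subshape Rs (Suc j) = add_box c (subshape Rs j)"
        using subshape_present R(4) by blast
      have "subshape (fst (row_insert y Rs)) j = subshape Rs j"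
          "subshape (fst (row_insert y Rs)) (Suc j) = subshape Rs (Suc j)"
        using 4 by (simp_all add: subshape_insert_large)
      moreover have "filter (\<lambda>z. z \<le> Suc j) ys = filter (\<lambda>z. z \<le> j) ys"
        using ys 4 by (intro filter_le_Suc_absent) auto
      ultimately show ?thesis
        using 4 Cons.prems(4) c filter_le_Suc_absent[OF npre] unfolding ins
        by (intro exI[of _ 0] exI[of _ "Suc c"]) (simp add: pre(1))
    qed
  qed
qed simp

text \<open>Fomin's local rule; its symmetry in \<open>\<beta>\<close> and \<open>\<gamma>\<close> is the reason for \<open>Q(w) = P(w\<^sup>-\<^sup>1)\<close>.\<close>

definition local_rule :: "(nat \<Rightarrow> nat) \<Rightarrow> (nat \<Rightarrow> nat) \<Rightarrow> (nat \<Rightarrow> nat) \<Rightarrow> bool \<Rightarrow> nat \<Rightarrow> nat" where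
  "local_rule \<alpha> \<beta> \<gamma> marked =
     (if marked then add_box 0 \<alpha> else if \<beta> = \<alpha> then \<gamma> else if \<gamma> = \<alpha> then \<beta>
      else if \<beta> = \<gamma> then add_box (Suc (THE k. \<beta> = add_box k \<alpha>)) \<beta> else (\<lambda>a. max (\<beta> a) (\<gamma> a)))"

lemma local_rule_commute: "local_rule \<alpha> \<beta> \<gamma> b = local_rule \<alpha> \<gamma> \<beta> b"
  by (auto simp: local_rule_def max.commute)

lemma add_box_neq [simp]: "add_box k f \<noteq> f" "f \<noteq> add_box k f"
  by (auto simp: add_box_def fun_eq_iff)

lemma add_box_inject [simp]: "add_box k f = add_box c f \<longleftrightarrow> k = c"
  by (auto simp: add_box_def fun_eq_iff split: if_splits)

lemma max_add_box: "k \<noteq> c \<Longrightarrow> (\<lambda>a. max (add_box c f a) (add_box k f a)) = add_box k (add_box c f)"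
  by (auto simp: add_box_def fun_eq_iff)

text \<open>The vertex \<open>(i, j)\<close> carries the shape of the entries up to \<open>j\<close>
  after \<open>i\<close> insertions. Only when a smaller number is inserted while
  \<open>Suc j\<close> is already present can both neighbouring shapes grow; that case is
  \<open>subshape_insert\<close>.\<close>

lemma growth:
  assumes inj: "inj_on w {1..Suc i}"
  shows "subshape (fst (RS (Suc i) w)) (Suc j) =
    local_rule (subshape (fst (RS i w)) j) (subshape (fst (RS i w)) (Suc j))
      (subshape (fst (RS (Suc i) w)) j) (w (Suc i) = Suc j)"
proof -
  let ?P = "fst (RS i w)" and ?x = "w (Suc i)"
  have ins: "{1..Suc i} = insert (Suc i) {1..i}" by auto
  have inj': "inj_on w {1..i}" and "?x \<notin> w ` {1..i}"
    using inj unfolding ins by auto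
  then have P: "tab ?P" "distinct (concat ?P)" "?x \<notin> set (concat ?P)"
    using RS_P[OF inj'] by auto
  have RS: "fst (RS (Suc i) w) = fst (row_insert ?x ?P)" by (simp add: RS_Suc)
  consider "?x = Suc j" | "Suc j < ?x" | "?x < Suc j" "Suc j \<notin> set (concat ?P)"
    | "?x < Suc j" "Suc j \<in> set (concat ?P)"
    by linarith
  then show ?thesis
  proof cases
    case 1
    then show ?thesis
      unfolding RS using subshape_insert_new[of j ?P] P(3) by (simp add: local_rule_def)
  next
    case 2
    then show ?thesis
      unfolding RS using subshape_insert_large[of j ?x ?P] subshape_insert_large[of "Suc j" ?x ?P]
      by (simp add: local_rule_def)
  next
    case 3
    then have "Suc j \<notin> set (concat (fst (row_insert ?x ?P)))" by (simp only: set_row_insert) simp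
    then show ?thesis
      unfolding RS using 3 by (simp add: local_rule_def subshape_absent)
  next
    case 4
    obtain k c where kc: "subshape (fst (row_insert ?x ?P)) j = add_box k (subshape ?P j)"
        "subshape ?P (Suc j) = add_box c (subshape ?P j)"
        "subshape (fst (row_insert ?x ?P)) (Suc j) =
          (if k = c then add_box (Suc c) (add_box c (subshape ?P j)) else add_box k (add_box c (subshape ?P j)))"
      using subshape_insert[OF P 4] by blast
    show ?thesis
      unfolding RS kc using 4(1) by (auto simp: local_rule_def max_add_box)
  qed
qed

lemma subshape_0: "0 \<notin> set (concat P) \<Longrightarrow> subshape P 0 = (\<lambda>a. 0)"
proof (induction P)
  case (Cons R Rs)
  then have "filter (\<lambda>z. z \<le> 0) R = []" by (auto simp: filter_empty_conv intro!: gr0I)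
  then show ?case using Cons by (auto simp: fun_eq_iff split: nat.splits)
qed simp

text \<open>Inverting \<open>w\<close> reflects the marked squares in the diagonal, the boundary
  shapes are empty, and the local rule is symmetric. So the diagram of the inverse is the reflected
  diagram, by an induction over the grid.\<close>

lemma growth_symmetric:
  assumes w: "w permutes {1..r}" and "i \<le> r" "j \<le> r"
  shows "subshape (fst (RS i w)) j = subshape (fst (RS j (pinv w))) i"
  using assms(2,3)
proof (induction i arbitrary: j)
  have pos: "subshape (fst (RS l u)) 0 = (\<lambda>a. 0)" if "l \<le> r" "u permutes {1..r}" for l u
  proof (rule subshape_0)
    have sub: "{1..l} \<subseteq> {1..r}" using that by simp
    have "inj_on u {1..l}" using permutes_inj_on[OF that(2)] by blast
    moreover have "0 \<notin> u ` {1..l}"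
      using permutes_image[OF that(2)] image_mono[OF sub, of u] by auto
    ultimately show "0 \<notin> set (concat (fst (RS l u)))" using RS_P by blast
  qed
  {
    case 0
    then show ?case using pos[of j "pinv w"] permutes_inv[OF w] by simp
  next
    case (Suc i)
    note outer = Suc.IH
    show ?case using Suc.prems(2)
    proof (induction j)
      case 0
      then show ?case using pos[OF Suc.prems(1) w] by simp
    next
      case (Suc j)
      have inv: "pinv w permutes {1..r}" using w by (rule permutes_inv)
      have eqs: "subshape (fst (RS i w)) j = subshape (fst (RS j (pinv w))) i"
          "subshape (fst (RS i w)) (Suc j) = subshape (fst (RS (Suc j) (pinv w))) i"
          "subshape (fst (RS (Suc i) w)) j = subshape (fst (RS j (pinv w))) (Suc i)"
          "w (Suc i) = Suc j \<longleftrightarrow> pinv w (Suc j) = Suc i"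
        using outer[of j] outer[of "Suc j"] Suc \<open>Suc i \<le> r\<close> permutes_inv_eq[OF w, of "Suc j" "Suc i"]
        by auto
      show ?case
        unfolding growth[OF permutes_inj_on[OF w], of i j]
          growth[OF permutes_inj_on[OF inv], of j i] eqs
        by (rule local_rule_commute)
    qed
  }
qed

section \<open>The recording tableau in the growth diagram\<close>

lemma subshape_all:
  "\<forall>z\<in>set (concat P). z \<le> j \<Longrightarrow> subshape P j a = (if a < length P then length (P ! a) else 0)"
proof (induction P arbitrary: a)
  case (Cons R Rs)
  then have "filter (\<lambda>z. z \<le> j) R = R" by (auto simp: filter_id_conv)
  then show ?case using Cons by (cases a) auto
qed simp

lemma subshape_add_cell: "j < i \<Longrightarrow> subshape (add_cell k i Q) j = subshape Q j"
proof (induction Q arbitrary: k)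
  case (Cons R Q)
  then show ?case by (cases k) simp_all
qed (simp add: fun_eq_iff split: nat.splits)

lemma subshape_Q:
  assumes w: "w permutes {1..r}" and "i \<le> r'" "r' \<le> r"
  shows "subshape (snd (RS r' w)) i = subshape (fst (RS i w)) r"
  using assms(2,3)
proof (induction r')
  case 0
  then show ?case by simp
next
  case (Suc r')
  show ?case
  proof (cases "i = Suc r'")
    case True
    have inj: "inj_on w {1..i}" using permutes_inj_on[OF w] .
    have "w ` {1..i} \<subseteq> w ` {1..r}" using Suc.prems(2) True by (intro image_mono) simp
    then have "set (concat (fst (RS i w))) \<subseteq> {1..r}"
      using RS_P[OF inj] permutes_image[OF w] by simp
    then have P: "subshape (fst (RS i w)) r = (\<lambda>a. if a < length (fst (RS i w)) then length (fst (RS i w) ! a) else 0)"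
      by (intro ext subshape_all) auto
    have Q: "subshape (snd (RS i w)) i = (\<lambda>a. if a < length (snd (RS i w)) then length (snd (RS i w) ! a) else 0)"
      by (intro ext subshape_all) (simp only: Q_entries, simp)
    have "length (snd (RS i w) ! a) = length (fst (RS i w) ! a)" if "a < length (fst (RS i w))" for a
      using that shape_RS[of i w] length_RS[of i w] unfolding shape_def by (metis nth_map)
    then show ?thesis
      unfolding P True[symmetric] Q using length_RS[of i w] by auto
  next
    case False
    then show ?thesis using Suc by (simp add: RS_Suc[of r'] subshape_add_cell)
  qed
qed

lemma sorted_row_eqI:
  fixes R R' :: "nat list"
  assumes "sorted_wrt (<) R" "sorted_wrt (<) R'"
    and eq: "\<And>j. length (filter (\<lambda>z. z \<le> j) R) = length (filter (\<lambda>z. z \<le> j) R')"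
  shows "R = R'"
proof -
  have mem: "v \<in> set S \<longleftrightarrow> (case v of 0 \<Rightarrow> length (filter (\<lambda>z. z \<le> 0) S) \<noteq> 0
      | Suc u \<Rightarrow> length (filter (\<lambda>z. z \<le> Suc u) S) \<noteq> length (filter (\<lambda>z. z \<le> u) S))"
    if "sorted_wrt (<) S" for S v
  proof -
    have "distinct S" using that strict_sorted_iff by blast
    then show ?thesis
      using filter_le_Suc_present[of "v - 1" S] filter_le_Suc_absent[of "v - 1" S]
      by (cases v; cases "v \<in> set S") (auto simp: filter_empty_conv)
  qed
  have "set R = set R'"
    unfolding set_eq_iff mem[OF assms(1)] mem[OF assms(2)] eq by simp
  then show ?thesis using assms(1,2) strict_sorted_equal by blast
qed

lemma tableau_eqI:
  "(\<And>R. R \<in> set P \<Longrightarrow> R \<noteq> [] \<and> sorted_wrt (<) R) \<Longrightarrow> (\<And>R. R \<in> set Q \<Longrightarrow> R \<noteq> [] \<and> sorted_wrt (<) R) \<Longrightarrow>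
     (\<And>j. subshape P j = subshape Q j) \<Longrightarrow> P = Q"
proof (induction P arbitrary: Q)
  have nonempty: "False" if "\<And>j. subshape [] j = subshape (R # Rs) j" "R \<noteq> []" for R Rs
  proof -
    have "subshape [] (hd R) 0 = subshape (R # Rs) (hd R) 0" using that(1) by simp
    then have "filter (\<lambda>z. z \<le> hd R) R = []" by simp
    then show False using that(2) by (cases R) auto
  qed
  {
    case Nil
    then show ?case using nonempty[of "hd Q" "tl Q"] by (cases Q) auto
  next
    case (Cons R Rs)
    show ?case
    proof (cases Q)
      case Nil
      then show ?thesis using nonempty[of R Rs] Cons.prems by auto
    next
      case Q: (Cons S Ss)
      have "length (filter (\<lambda>z. z \<le> j) R) = length (filter (\<lambda>z. z \<le> j) S)"
          "subshape Rs j = subshape Ss j" for j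
        using Cons.prems(3)[of j] Q by simp_all
      moreover from this have "R = S" using Cons.prems(1,2) Q by (intro sorted_row_eqI) auto
      ultimately show ?thesis using Cons.prems(1,2) Q Cons.IH[of Ss] by auto
    qed
  }
qed

lemma subshape_large: "\<forall>z\<in>set (concat P). z \<le> r \<Longrightarrow> r \<le> j \<Longrightarrow> subshape P j = subshape P r"
proof -
  assume le: "\<forall>z\<in>set (concat P). z \<le> r" and "r \<le> j"
  then have "\<forall>z\<in>set (concat P). z \<le> j" by (meson le_trans)
  then show ?thesis using le by (intro ext) (simp only: subshape_all)
qed

theorem Q_eq_P_inv:
  assumes w: "w permutes {1..r}"
  shows "snd (RS r w) = fst (RS r (pinv w))"
proof (rule tableau_eqI)
  have inv: "pinv w permutes {1..r}" using w by (rule permutes_inv)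
  have P: "tab (fst (RS r (pinv w)))" "set (concat (fst (RS r (pinv w)))) = {1..r}"
    using RS_P[OF permutes_inj_on[OF inv]] permutes_image[OF inv] by auto
  show "R \<noteq> [] \<and> sorted_wrt (<) R" if "R \<in> set (fst (RS r (pinv w)))" for R
    using that tab_nth[OF P(1)] by (auto simp: in_set_conv_nth)
  show "R \<noteq> [] \<and> sorted_wrt (<) R" if "R \<in> set (snd (RS r w))" for R
    using Q_rows[OF that] .
  have le: "subshape (snd (RS r w)) j = subshape (fst (RS r (pinv w))) j" if "j \<le> r" for j
    using subshape_Q[OF w that order_refl] growth_symmetric[OF w that order_refl] by simp
  show "subshape (snd (RS r w)) j = subshape (fst (RS r (pinv w))) j" for j
  proof (cases "j \<le> r")
    case False
    have "subshape (snd (RS r w)) j = subshape (snd (RS r w)) r"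
      using False Q_entries[of r w] by (intro subshape_large) auto
    moreover have "subshape (fst (RS r (pinv w))) j = subshape (fst (RS r (pinv w))) r"
      using False P(2) by (intro subshape_large) auto
    ultimately show ?thesis using le[of r] by simp
  qed (rule le)
qed

section \<open>Partitions\<close>

definition part :: "nat list \<Rightarrow> nat \<Rightarrow> nat" where
  "part \<nu> b = (if b < length \<nu> then \<nu> ! b else 0)"

definition is_partition :: "nat list \<Rightarrow> bool" where
  "is_partition \<nu> \<longleftrightarrow> sorted_wrt (\<ge>) \<nu> \<and> 0 \<notin> set \<nu>"

lemma partitions_iff: "\<nu> \<in> partitions r \<longleftrightarrow> is_partition \<nu> \<and> sum_list \<nu> = r"
  by (simp add: partitions_def is_partition_def)

lemma part_antimono: "is_partition \<nu> \<Longrightarrow> b \<le> b' \<Longrightarrow> part \<nu> b' \<le> part \<nu> b"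
  using sorted_wrt_nth_less[of "(\<ge>)" \<nu> b b'] by (cases "b = b'") (auto simp: part_def is_partition_def)

lemma part_pos_iff:
  assumes "is_partition \<nu>"
  shows "0 < part \<nu> b \<longleftrightarrow> b < length \<nu>"
proof (cases "b < length \<nu>")
  case True
  then have "\<nu> ! b \<noteq> 0" using assms nth_mem[OF True] unfolding is_partition_def by metis
  then show ?thesis using True by (simp add: part_def)
qed (simp add: part_def)

lemma part_Cons [simp]: "part (p # \<nu>) 0 = p" "part (p # \<nu>) (Suc b) = part \<nu> b"
  by (simp_all add: part_def)

lemma partition_eqI:
  assumes "is_partition \<nu>" "is_partition \<nu>'" and "\<And>a b. a < part \<nu> b \<longleftrightarrow> a < part \<nu>' b"
  shows "\<nu> = \<nu>'"
proof -
  have part: "part \<nu> b = part \<nu>' b" for b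
    using assms(3)[of "part \<nu> b" b] assms(3)[of "part \<nu>' b" b] by (meson less_irrefl linorder_neqE_nat)
  have iff: "b < length \<nu> \<longleftrightarrow> b < length \<nu>'" for b
    using part_pos_iff[OF assms(1), of b] part_pos_iff[OF assms(2), of b] part by simp
  have "length \<nu> = length \<nu>'"
    using iff[of "length \<nu>"] iff[of "length \<nu>'"] by (meson less_irrefl linorder_neqE_nat)
  then show ?thesis
    using part by (intro nth_equalityI) (auto simp: part_def, metis)
qed

lemma less_length_filter:
  "sorted_wrt (\<ge>) \<nu> \<Longrightarrow> b < length (filter (\<lambda>p. j < p) \<nu>) \<longleftrightarrow> j < part \<nu> b"
proof (induction \<nu> arbitrary: b)
  case Nil
  then show ?case by (simp add: part_def)
next
  case (Cons p \<nu>)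
  show ?case
  proof (cases "j < p")
    case True
    then show ?thesis using Cons by (cases b) auto
  next
    case False
    then have "filter (\<lambda>p. j < p) (p # \<nu>) = []"
      using Cons.prems by (auto simp: filter_empty_conv)
    moreover have "\<forall>x\<in>set (p # \<nu>). x \<le> j" using False Cons.prems by auto
    then have "part (p # \<nu>) b \<le> j" unfolding part_def by (metis le0 nth_mem)
    ultimately show ?thesis by simp
  qed
qed

lemma less_foldr_max: "j < foldr max \<nu> 0 \<longleftrightarrow> (\<exists>p\<in>set \<nu>. j < (p::nat))"
  by (induction \<nu>) auto

text \<open>Reflection of the diagram in its diagonal, as an equivalence for all indices thanks to
  the padding by zeros. That dualizing is an involution follows at once.\<close>

lemma part_dual:
  assumes "is_partition \<nu>"
  shows "b < part (dual_partition \<nu>) a \<longleftrightarrow> a < part \<nu> b"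
proof -
  have sorted: "sorted_wrt (\<ge>) \<nu>" using assms by (simp add: is_partition_def)
  have len: "length (dual_partition \<nu>) = foldr max \<nu> 0" by (simp add: dual_partition_def)
  show ?thesis
  proof (cases "a < length (dual_partition \<nu>)")
    case True
    then have "part (dual_partition \<nu>) a = length (filter (\<lambda>p. a < p) \<nu>)"
      by (simp add: part_def) (simp add: dual_partition_def)
    then show ?thesis using less_length_filter[OF sorted] by simp
  next
    case False
    then have "\<not> (\<exists>p\<in>set \<nu>. a < p)" unfolding len less_foldr_max .
    then have "\<not> a < part \<nu> b" by (auto simp: part_def)
    then show ?thesis using False by (simp add: part_def)
  qed
qed

lemma is_partition_dual:
  assumes "is_partition \<nu>"
  shows "is_partition (dual_partition \<nu>)"
  unfolding is_partition_def
proof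
  have "length (filter (\<lambda>p. j' < p) \<nu>) \<le> length (filter (\<lambda>p. j < p) \<nu>)" if "j \<le> j'" for j j'
    using that by (induction \<nu>) auto
  then show "sorted_wrt (\<ge>) (dual_partition \<nu>)"
    by (auto simp: dual_partition_def sorted_wrt_iff_nth_less)
  show "0 \<notin> set (dual_partition \<nu>)"
    by (auto simp: dual_partition_def less_foldr_max filter_empty_conv)
qed

lemma dual_dual: "is_partition \<nu> \<Longrightarrow> dual_partition (dual_partition \<nu>) = \<nu>"
  by (rule partition_eqI) (simp_all add: is_partition_dual part_dual)

lemma sum_list_card: "sum_list \<nu> = card {(b, a). a < part \<nu> b}"
proof -
  have "{(b, a). a < part \<nu> b} = (SIGMA b:{..<length \<nu>}. {..<\<nu> ! b})"
    by (auto simp: part_def split: if_splits)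
  then show ?thesis by (simp add: sum_list_sum_nth atLeast0LessThan)
qed

lemma sum_list_dual: "is_partition \<nu> \<Longrightarrow> sum_list (dual_partition \<nu>) = sum_list \<nu>"
proof -
  assume "is_partition \<nu>"
  then have "{(b, a). a < part (dual_partition \<nu>) b} = prod.swap ` {(b, a). a < part \<nu> b}"
    by (auto simp: part_dual image_iff)
  then show ?thesis unfolding sum_list_card by (simp add: card_image)
qed

lemma is_partition_shape: "tab P \<Longrightarrow> is_partition (shape P)"
proof (induction P)
  case (Cons R Rs)
  have "length R' \<le> length R" if "R' \<in> set Rs" for R'
  proof (cases Rs)
    case (Cons S Ss)
    then have "length S \<le> length R" using Cons.prems by simp
    moreover have "length R' \<le> length S"
      using Cons Cons.IH Cons.prems that by (auto simp: is_partition_def shape_def)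
    ultimately show ?thesis by simp
  qed (use that in simp)
  then show ?case using Cons by (auto simp: is_partition_def shape_def)
qed (simp add: is_partition_def shape_def)

lemma sum_list_shape: "sum_list (shape P) = length (concat P)"
  by (simp add: shape_def length_concat)

lemma shape_in_partitions:
  assumes "w permutes {1..r}"
  shows "shape (fst (RS r w)) \<in> partitions r"
proof -
  have P: "tab (fst (RS r w))" "distinct (concat (fst (RS r w)))" "set (concat (fst (RS r w))) = {1..r}"
    using RS_P[OF permutes_inj_on[OF assms]] permutes_image[OF assms] by auto
  then have "length (concat (fst (RS r w))) = r"
    using distinct_card[OF P(2)] by simp
  then show ?thesis using is_partition_shape[OF P(1)] by (simp add: partitions_iff sum_list_shape)
qed

section \<open>Permutations whose insertion tableau is a column tableau\<close>

text \<open>The value of \<open>w\<^sub>0\<^sub>,\<^sub>\<nu>(t\<^sup>\<nu>)\<close> in row \<open>b\<close> and column \<open>a\<close>.\<close>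

definition cell_value :: "nat list \<Rightarrow> nat \<Rightarrow> nat \<Rightarrow> nat" where
  "cell_value \<nu> b a = psum \<nu> (Suc b) - a"

lemma psum_part: "psum \<nu> (Suc b) = psum \<nu> b + part \<nu> b"
  by (cases "b < length \<nu>") (simp_all add: psum_Suc part_def)

lemma cell_value_props:
  assumes "a < part \<nu> b"
  shows "cell_value \<nu> b a \<in> {1..sum_list \<nu>}" "blk \<nu> (cell_value \<nu> b a) = b"
proof -
  have *: "psum \<nu> b < cell_value \<nu> b a" "cell_value \<nu> b a \<le> psum \<nu> (Suc b)"
    using assms unfolding cell_value_def psum_part by auto
  then show r: "cell_value \<nu> b a \<in> {1..sum_list \<nu>}"
    using psum_le[of "Suc b" \<nu>] by simp
  then show "blk \<nu> (cell_value \<nu> b a) = b"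
    using * blk_eq_iff[of "cell_value \<nu> b a" \<nu> b] by simp
qed

lemma cell_value_exists:
  assumes "v \<in> {1..sum_list \<nu>}"
  shows "v = cell_value \<nu> (blk \<nu> v) (psum \<nu> (Suc (blk \<nu> v)) - v)"
    "psum \<nu> (Suc (blk \<nu> v)) - v < part \<nu> (blk \<nu> v)"
proof -
  have "psum \<nu> (blk \<nu> v) < v" "v \<le> psum \<nu> (Suc (blk \<nu> v))"
    using blk_eq_iff[of v \<nu> "blk \<nu> v"] assms by auto
  then show "v = cell_value \<nu> (blk \<nu> v) (psum \<nu> (Suc (blk \<nu> v)) - v)"
    "psum \<nu> (Suc (blk \<nu> v)) - v < part \<nu> (blk \<nu> v)"
    unfolding cell_value_def psum_part by auto
qed

lemma cell_value_inject:
  assumes "a < part \<nu> b" "a' < part \<nu> b'" "cell_value \<nu> b a = cell_value \<nu> b' a'"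
  shows "b = b'" "a = a'"
proof -
  show b: "b = b'" using cell_value_props(2)[OF assms(1)] cell_value_props(2)[OF assms(2)] assms(3) by simp
  have "a < psum \<nu> (Suc b)" "a' < psum \<nu> (Suc b)" using assms(1,2) b by (auto simp: psum_part)
  then show "a = a'" using assms(3) b unfolding cell_value_def by simp
qed

text \<open>A standard filling of the diagram as a function of row and column. It will hold the
  times at which the values attached to the cells are inserted.\<close>

definition std_array :: "nat list \<Rightarrow> (nat \<Rightarrow> nat \<Rightarrow> nat) \<Rightarrow> bool" where
  "std_array \<nu> pos \<longleftrightarrow> (\<forall>b a. Suc a < part \<nu> b \<longrightarrow> pos b a < pos b (Suc a)) \<and>
     (\<forall>b a. a < part \<nu> (Suc b) \<longrightarrow> pos b a < pos (Suc b) a)"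

lemma std_array_row:
  assumes "std_array \<nu> pos" "a < a'" "a' < part \<nu> b"
  shows "pos b a < pos b a'"
  using assms(2,3)
proof (induction a')
  case (Suc a')
  then have "pos b a' < pos b (Suc a')" using assms(1) by (simp add: std_array_def)
  then show ?case using Suc by (cases "a = a'") auto
qed simp

lemma std_array_col:
  assumes "std_array \<nu> pos" "is_partition \<nu>" "b < b'" "a < part \<nu> b'"
  shows "pos b a < pos b' a"
  using assms(3,4)
proof (induction b')
  case (Suc b')
  then have "pos b' a < pos (Suc b') a" using assms(1) by (simp add: std_array_def)
  moreover have "a < part \<nu> b'" using Suc.prems(2) part_antimono[OF assms(2), of b' "Suc b'"] by simp
  ultimately show ?case using Suc by (cases "b = b'") auto
qed simp

section \<open>Tableaux stored by their columns\<close>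

definition col_length :: "(nat \<Rightarrow> nat) \<Rightarrow> nat \<Rightarrow> nat" where
  "col_length q a = (LEAST b. q b \<le> a)"

text \<open>Row \<open>a\<close> of the result is column \<open>a\<close> of the diagram with row
  lengths \<open>q\<close>: the insertion and recording tableaux have the dual of the shape whose
  rows index the blocks.\<close>

definition col_array :: "(nat \<Rightarrow> nat) \<Rightarrow> (nat \<Rightarrow> nat \<Rightarrow> nat) \<Rightarrow> nat list list" where
  "col_array q f = map (\<lambda>a. map (\<lambda>b. f b a) [0..<col_length q a]) [0..<q 0]"

locale columns =
  fixes q :: "nat \<Rightarrow> nat"
  assumes antimono: "b \<le> b' \<Longrightarrow> q b' \<le> q b"
    and vanish: "\<exists>L. q L = 0"
begin

lemma less_col_length: "b < col_length q a \<longleftrightarrow> a < q b"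
proof
  show "b < col_length q a \<Longrightarrow> a < q b"
    unfolding col_length_def using not_less_Least[of b "\<lambda>b. q b \<le> a"] by simp
  assume a: "a < q b"
  obtain L where "q L = 0" using vanish by blast
  then have "q (col_length q a) \<le> a"
    unfolding col_length_def using LeastI[of "\<lambda>b. q b \<le> a" L] by simp
  then show "b < col_length q a"
    using a antimono[of "col_length q a" b] by linarith
qed

end

lemma col_length_eqI:
  assumes "columns q" "\<And>b. a < q b \<longleftrightarrow> b < c"
  shows "col_length q a = c"
  using columns.less_col_length[OF assms(1), of c a] columns.less_col_length[OF assms(1), of "col_length q a" a]
    assms(2)[of c] assms(2)[of "col_length q a"] by linarith

lemma columns_part: "is_partition \<nu> \<Longrightarrow> columns (part \<nu>)"
proof
  show "is_partition \<nu> \<Longrightarrow> b \<le> b' \<Longrightarrow> part \<nu> b' \<le> part \<nu> b" for b b' by (rule part_antimono)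
  show "\<exists>L. part \<nu> L = 0" by (rule exI[of _ "length \<nu>"]) (simp add: part_def)
qed

text \<open>Row insertion into a tableau in which column \<open>b\<close> consists of the \<open>q b\<close> numbers up to \<open>V b\<close>:
  the largest number below column \<open>b0\<close> extends that column, by pushing it down.\<close>

lemma row_insert_col_array:
  fixes V :: "nat \<Rightarrow> nat"
  defines "g q \<equiv> \<lambda>b a. V b - q b + 1 + a"
  assumes q: "columns q" and q': "columns (q(b0 := Suc (q b0)))"
    and V: "\<And>b. b < b0 \<Longrightarrow> V b + q b0 < V b0" "\<And>b. q b \<le> V b" "q b0 < V b0"
  shows "row_insert (V b0 - q b0) (col_array q (g q)) =
    (col_array (q(b0 := Suc (q b0))) (g (q(b0 := Suc (q b0)))), q b0)"
proof -
  let ?q = "q(b0 := Suc (q b0))"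
  let ?row = "\<lambda>q a. map (\<lambda>b. g q b a) [0..<col_length q a]"
  have less: "b < col_length q a \<longleftrightarrow> a < q b" "b < col_length ?q a \<longleftrightarrow> a < ?q b" for a b
    using columns.less_col_length[OF q] columns.less_col_length[OF q'] by auto
  have other: "col_length ?q a = col_length q a" if "a \<noteq> q b0" for a
    by (rule col_length_eqI[OF q']) (use that less(1) in auto)
  \<comment> \<open>Row \<open>q b0\<close> of the tableau meets exactly the columns left of
    \<open>b0\<close>; the new cell goes to its end.\<close>
  have corner: "col_length q (q b0) = b0" "col_length ?q (q b0) = Suc b0"
  proof -
    have iff: "q b0 < q b \<longleftrightarrow> b < b0" for b
      using columns.antimono[OF q', of b b0] columns.antimono[OF q, of b0 b] by (cases "b < b0") auto
    show "col_length q (q b0) = b0" by (rule col_length_eqI[OF q iff])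
    show "col_length ?q (q b0) = Suc b0" by (rule col_length_eqI[OF q']) (use iff in \<open>auto simp: less_Suc_eq\<close>)
  qed
  have small: "g q b a < V b0 - q b0 + a" if "b < b0" "a < q b" for a b
    using V(1)[OF that(1)] V(2)[of b] that(2) by (simp add: g_def)
  have rest: "map (?row q) [a..<q 0] = map (?row ?q) [a..<?q 0]" if "q b0 < a" for a
  proof -
    have eq: "?row q a' = ?row ?q a'" if "a' > q b0" for a'
      using that less(1)[of b0 a'] unfolding other[of a', OF less_imp_neq[OF that, symmetric]]
      by (intro map_cong) (auto simp: g_def)
    have rows: "map (?row q) [a..<q 0] = map (?row ?q) [a..<q 0]"
      using that by (intro map_cong refl eq) simp
    have up: "[a..<q 0] = [a..<?q 0]" using that by (cases "b0 = 0") auto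
    show ?thesis using rows unfolding up .
  qed
  \<comment> \<open>Row \<open>a\<close> receives \<open>V b0 - q b0 + a\<close>, one less than the
    entry of column \<open>b0\<close> there, and so bumps this entry into the next row. The
    induction goes upwards from the row of the new cell.\<close>
  have "a \<le> q b0 \<Longrightarrow> row_insert (V b0 - q b0 + a) (map (?row q) [a..<q 0]) =
      (map (?row ?q) [a..<?q 0], q b0 - a)" for a
  proof (induction "q b0 - a" arbitrary: a)
    case 0
    then have a: "a = q b0" by simp
    have new: "?row ?q a = ?row q a @ [V b0 - q b0 + a]"
      unfolding a corner using V(3) by (auto simp: g_def)
    show ?case
    proof (cases "a < q 0")
      case True
      then have up: "[a..<q 0] = a # [Suc a..<q 0]" "[a..<?q 0] = a # [Suc a..<?q 0]"
        by (simp_all add: upt_conv_Cons)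
      have "dropWhile (\<lambda>y. y < V b0 - q b0 + a) (?row q a) = []"
        unfolding dropWhile_eq_Nil_conv
      proof
        fix z assume "z \<in> set (?row q a)"
        then obtain b where b: "b < col_length q a" "z = g q b a" by auto
        then show "z < V b0 - q b0 + a" using small[of b a] less(1)[of b a] corner(1) a by simp
      qed
      then show ?thesis
        unfolding up list.map rest[of "Suc a", unfolded a, OF lessI, folded a] new
        using a by (simp add: row_insert_append)
    next
      case False
      then have "b0 = 0" using a columns.antimono[OF q', of 0 b0] by (cases "b0 = 0") auto
      then have up: "[a..<q 0] = []" "[a..<?q 0] = [a]" and "?row q a = []"
        using a corner(1) by simp_all
      then show ?thesis unfolding up list.map new using a by simp
    qed
  next
    case (Suc d)
    then have a: "a < q b0" by simp
    then have a0: "a < q 0" using columns.antimono[OF q, of 0 b0] by simp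
    then have up: "[a..<q 0] = a # [Suc a..<q 0]" "[a..<?q 0] = a # [Suc a..<?q 0]"
      by (simp_all add: upt_conv_Cons)
    have b0: "b0 < col_length q a" using a less(1) by simp
    have split: "[0..<col_length q a] = [0..<b0] @ b0 # [Suc b0..<col_length q a]"
      using b0 upt_add_eq_append[of 0 b0 "col_length q a - b0"] by (simp add: upt_conv_Cons)
    have row: "?row q a = map (\<lambda>b. g q b a) [0..<b0] @ (V b0 - q b0 + Suc a) # map (\<lambda>b. g q b a) [Suc b0..<col_length q a]"
      unfolding split by (simp add: g_def)
    have row': "?row ?q a = map (\<lambda>b. g q b a) [0..<b0] @ (V b0 - q b0 + a) # map (\<lambda>b. g q b a) [Suc b0..<col_length q a]"
      unfolding other[of a, OF less_imp_neq[OF a]] split using V(3) by (auto simp: g_def)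
    have lt: "\<forall>z\<in>set (map (\<lambda>b. g q b a) [0..<b0]). z < V b0 - q b0 + a"
    proof
      fix z assume "z \<in> set (map (\<lambda>b. g q b a) [0..<b0])"
      then obtain b where b: "b < b0" "z = g q b a" by auto
      have "a < q b" using columns.antimono[OF q, of b b0] a b(1) by simp
      then show "z < V b0 - q b0 + a" using small[of b a] b by simp
    qed
    have drop: "dropWhile (\<lambda>y. y < V b0 - q b0 + a) (?row q a) =
        (V b0 - q b0 + Suc a) # map (\<lambda>b. g q b a) [Suc b0..<col_length q a]"
      unfolding row using lt by (subst dropWhile_append2) auto
    have take: "takeWhile (\<lambda>y. y < V b0 - q b0 + a) (?row q a) = map (\<lambda>b. g q b a) [0..<b0]"
      unfolding row using lt by (subst takeWhile_append2) auto
    have IH: "row_insert (V b0 - q b0 + Suc a) (map (?row q) [Suc a..<q 0]) =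
        (map (?row ?q) [Suc a..<?q 0], q b0 - Suc a)"
      using Suc a by (intro Suc(1)) auto
    show ?case
      unfolding up list.map row_insert_bump[OF drop] take IH fst_conv snd_conv row'
      using a by simp
  qed
  from this[of 0] show ?thesis by (simp add: col_array_def)
qed

lemma add_cell_col_array:
  assumes q: "columns q" and q': "columns (q(b0 := Suc (q b0)))"
  shows "add_cell (q b0) (f b0 (q b0)) (col_array q f) = col_array (q(b0 := Suc (q b0))) f"
proof -
  let ?q = "q(b0 := Suc (q b0))"
  have other: "col_length ?q a = col_length q a" if "a \<noteq> q b0" for a
    by (rule col_length_eqI[OF q']) (use that columns.less_col_length[OF q] in auto)
  have iff: "q b0 < q b \<longleftrightarrow> b < b0" for b
    using columns.antimono[OF q', of b b0] columns.antimono[OF q, of b0 b] by (cases "b < b0") auto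
  have corner: "col_length q (q b0) = b0" by (rule col_length_eqI[OF q iff])
  have corner': "col_length ?q (q b0) = Suc b0"
    by (rule col_length_eqI[OF q']) (use iff in \<open>auto simp: less_Suc_eq\<close>)
  show ?thesis
  proof (cases "q b0 < q 0")
    case True
    then have "b0 \<noteq> 0" by (cases "b0 = 0") auto
    then have "?q 0 = q 0" by simp
    then show ?thesis
      using True other corner corner'
      by (intro nth_equalityI) (auto simp: add_cell_def col_array_def nth_list_update)
  next
    case False
    then have "b0 = 0" using columns.antimono[OF q', of 0 b0] by (cases "b0 = 0") auto
    then show ?thesis
      using other corner corner' by (auto simp: add_cell_def col_array_def)
  qed
qed

text \<open>The elements with insertion tableau \<open>t\<^sub>\<kappa>\<close>, \<open>\<kappa> = \<nu>\<^sup>t\<close>, i.e. those of the cell \<open>\<varpi>\<^sub>\<nu>\<close>: the number inserted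
  at time \<open>i\<close> belongs to the block given by the column of \<open>i\<close> in the recording tableau.\<close>

lemma RS_std_array:
  assumes \<nu>: "\<nu> \<in> partitions r" and y: "y permutes {1..r}"
    and std: "std_array \<nu> (\<lambda>b a. pinv y (cell_value \<nu> b a))"
  shows "RS r y = (col_array (part \<nu>) (\<lambda>b a. psum \<nu> b + 1 + a), col_array (part \<nu>) (\<lambda>b a. pinv y (cell_value \<nu> b a)))"
proof -
  let ?pos = "\<lambda>b a. pinv y (cell_value \<nu> b a)"
  have p: "is_partition \<nu>" and sum: "sum_list \<nu> = r" using \<nu> by (simp_all add: partitions_iff)
  \<comment> \<open>The number of cells in row \<open>b\<close> whose values have been inserted by
    time \<open>i\<close>; by \<open>std_array\<close> these are the first cells of the row.\<close>
  define q where "q i b = card {a. a < part \<nu> b \<and> ?pos b a \<le> i}" for i b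
  have fin: "finite {a. a < part \<nu> b \<and> ?pos b a \<le> i}" for i b by simp
  have q_iff: "a < q i b \<longleftrightarrow> a < part \<nu> b \<and> ?pos b a \<le> i" for i b a
  proof -
    let ?D = "{a. a < part \<nu> b \<and> ?pos b a \<le> i}"
    have "Suc ` ?D = {1..card (Suc ` ?D)}"
    proof (rule down_closed_eq[of _ "part \<nu> b"])
      fix k l assume "l \<in> Suc ` ?D" "1 \<le> k" "k \<le> l"
      then obtain l' where l': "l = Suc l'" "l' < part \<nu> b" "?pos b l' \<le> i" by auto
      have "?pos b (k - 1) \<le> ?pos b l'"
      proof (cases "k - 1 = l'")
        case False
        then have "k - 1 < l'" using l'(1) \<open>1 \<le> k\<close> \<open>k \<le> l\<close> by linarith
        then show ?thesis using std_array_row[OF std _ l'(2)] by (simp add: less_imp_le)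
      qed simp
      then have "k - 1 \<in> ?D" using l' \<open>1 \<le> k\<close> \<open>k \<le> l\<close> by auto
      then have "Suc (k - 1) \<in> Suc ` ?D" by blast
      then show "k \<in> Suc ` ?D" using \<open>1 \<le> k\<close> by simp
    qed auto
    then have "Suc ` ?D = {1..q i b}" by (simp add: card_image q_def)
    then have "Suc a \<in> Suc ` ?D \<longleftrightarrow> Suc a \<in> {1..q i b}" by simp
    then show ?thesis by auto
  qed
  have columns: "columns (q i)" for i
  proof
    fix b b' :: nat assume "b \<le> b'"
    show "q i b' \<le> q i b"
    proof (rule ccontr)
      assume "\<not> q i b' \<le> q i b"
      then have "q i b < part \<nu> b'" "?pos b' (q i b) \<le> i" using q_iff[of "q i b" i b'] by auto
      moreover from this have "q i b < part \<nu> b" using part_antimono[OF p \<open>b \<le> b'\<close>] by simp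
      moreover have "?pos b (q i b) \<le> ?pos b' (q i b)"
        using std_array_col[OF std p, of b b' "q i b"] \<open>b \<le> b'\<close> calculation(1) by (cases "b = b'") auto
      ultimately show False using q_iff[of "q i b" i b] by simp
    qed
  next
    show "\<exists>L. q i L = 0" by (rule exI[of _ "length \<nu>"]) (simp add: q_def part_def)
  qed
  \<comment> \<open>Block \<open>b\<close> is inserted from its largest value
    \<open>psum \<nu> (Suc b)\<close> downwards. At time \<open>i\<close> its \<open>q i b\<close>
    largest values fill column \<open>b\<close> consecutively, so each insertion pushes one column
    down.\<close>
  have "i \<le> r \<Longrightarrow> RS i y = (col_array (q i) (\<lambda>b a. psum \<nu> (Suc b) - q i b + 1 + a), col_array (q i) ?pos)" for i
  proof (induction i)
    case 0
    have "?pos 0 a \<noteq> 0" if "a < part \<nu> 0" for a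
      using permutes_mem[OF permutes_inv[OF y], of "cell_value \<nu> 0 a"] cell_value_props(1)[OF that] sum by simp
    then have "q 0 0 = 0" unfolding q_def by auto
    then show ?case by (simp add: col_array_def)
  next
    case (Suc i)
    define b0 where "b0 = blk \<nu> (y (Suc i))"
    define a0 where "a0 = psum \<nu> (Suc b0) - y (Suc i)"
    have yr: "y (Suc i) \<in> {1..sum_list \<nu>}"
      unfolding sum by (rule permutes_mem[OF y]) (use Suc.prems in simp)
    have cell: "y (Suc i) = cell_value \<nu> b0 a0" "a0 < part \<nu> b0"
      using cell_value_exists[OF yr] by (simp_all add: a0_def b0_def)
    have pos0: "?pos b0 a0 = Suc i" using permutes_inverses(2)[OF y] cell(1) by metis
    have step: "a < q (Suc i) b \<longleftrightarrow> a < q i b \<or> (b = b0 \<and> a = a0)" for a b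
    proof -
      have "?pos b a = Suc i \<longleftrightarrow> b = b0 \<and> a = a0" if "a < part \<nu> b"
      proof
        assume "?pos b a = Suc i"
        then have "cell_value \<nu> b a = cell_value \<nu> b0 a0"
          using permutes_inverses(1)[OF y, of "cell_value \<nu> b a"] cell(1) by simp
        then show "b = b0 \<and> a = a0" using cell_value_inject that cell(2) by blast
      qed (use pos0 in simp)
      then show ?thesis unfolding q_iff using cell(2) by (auto simp: le_Suc_eq)
    qed
    have a0: "q i b0 = a0"
    proof -
      have "\<not> a0 < q i b0" using q_iff[of a0 i b0] pos0 by simp
      moreover have "a < q i b0" if "a < a0" for a
        using step[of a b0] step[of a0 b0] that by auto
      ultimately show ?thesis by (metis less_irrefl linorder_neqE_nat)
    qed
    have q_Suc: "q (Suc i) = (q i)(b0 := Suc (q i b0))"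
    proof
      fix b
      have "a < q (Suc i) b \<longleftrightarrow> a < ((q i)(b0 := Suc (q i b0))) b" for a
        using step[of a b] a0 by auto
      then show "q (Suc i) b = ((q i)(b0 := Suc (q i b0))) b"
        by (meson less_irrefl linorder_neqE_nat)
    qed
    have q': "columns ((q i)(b0 := Suc (q i b0)))" using columns[of "Suc i"] by (simp add: q_Suc)
    have le: "q i b \<le> part \<nu> b" for b
      using q_iff[of "part \<nu> b" i b] by (meson less_irrefl not_le)
    have V1: "psum \<nu> (Suc b) + q i b0 < psum \<nu> (Suc b0)" if "b < b0" for b
      using psum_mono[of "Suc b" b0 \<nu>] that cell(2) a0 psum_part[of b0 \<nu>] by simp
    have V2: "q i b \<le> psum \<nu> (Suc b)" for b using le[of b] psum_part[of b \<nu>] by simp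
    have V3: "q i b0 < psum \<nu> (Suc b0)" using cell(2) a0 psum_part[of b0 \<nu>] by simp
    have IH: "RS i y = (col_array (q i) (\<lambda>b a. psum \<nu> (Suc b) - q i b + 1 + a), col_array (q i) ?pos)"
      using Suc by simp
    have ins: "row_insert (y (Suc i)) (fst (RS i y)) =
        (col_array (q (Suc i)) (\<lambda>b a. psum \<nu> (Suc b) - q (Suc i) b + 1 + a), q i b0)"
      using row_insert_col_array[where V = "\<lambda>b. psum \<nu> (Suc b)", OF columns[of i] q' V1 V2 V3]
      unfolding IH fst_conv q_Suc cell(1) cell_value_def a0 .
    have "add_cell (q i b0) (Suc i) (snd (RS i y)) = col_array (q (Suc i)) ?pos"
      using add_cell_col_array[OF columns[of i] q', of ?pos] pos0 a0 unfolding IH snd_conv q_Suc by simp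
    then show ?case using ins by (simp add: RS_Suc row_step_def)
  qed
  from this[of r] have RS: "RS r y = (col_array (q r) (\<lambda>b a. psum \<nu> (Suc b) - q r b + 1 + a), col_array (q r) ?pos)"
    by simp
  have q_r: "q r = part \<nu>"
  proof
    fix b
    have "a < q r b \<longleftrightarrow> a < part \<nu> b" for a
      using q_iff[of a r b] permutes_mem[OF permutes_inv[OF y], of "cell_value \<nu> b a"]
        cell_value_props(1)[of a \<nu> b] sum by auto
    then show "q r b = part \<nu> b" by (meson less_irrefl linorder_neqE_nat)
  qed
  have "(\<lambda>b a. psum \<nu> (Suc b) - part \<nu> b + 1 + a) = (\<lambda>b a. psum \<nu> b + 1 + a)"
    unfolding psum_part by simp
  then show ?thesis unfolding RS q_r by (simp only:)
qed

lemma dual_col_length: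
  assumes "is_partition \<nu>"
  shows "length (dual_partition \<nu>) = part \<nu> 0"
    "a < length (dual_partition \<nu>) \<Longrightarrow> dual_partition \<nu> ! a = col_length (part \<nu>) a"
proof -
  have iff: "a < length (dual_partition \<nu>) \<longleftrightarrow> a < part \<nu> 0" for a
    using part_pos_iff[OF is_partition_dual[OF assms], of a] part_dual[OF assms, of 0 a] by simp
  show "length (dual_partition \<nu>) = part \<nu> 0"
    using iff[of "length (dual_partition \<nu>)"] iff[of "part \<nu> 0"] by simp
  show "dual_partition \<nu> ! a = col_length (part \<nu>) a" if "a < length (dual_partition \<nu>)"
  proof -
    have "part (dual_partition \<nu>) a = dual_partition \<nu> ! a" using that by (simp add: part_def)
    then have "a < part \<nu> b \<longleftrightarrow> b < dual_partition \<nu> ! a" for b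
      using part_dual[OF assms, of b a] by simp
    then have "col_length (part \<nu>) a = dual_partition \<nu> ! a"
      by (rule col_length_eqI[OF columns_part[OF assms]])
    then show ?thesis by (rule sym)
  qed
qed

lemma row_tableau_nth:
  "b < length \<nu> \<Longrightarrow> a < part \<nu> b \<Longrightarrow> row_tableau \<nu> ! b ! a = psum \<nu> b + 1 + a"
  using psum_part[of b \<nu>] by (simp add: row_tableau_def nth_append del: upt_Suc)

lemma column_tableau_dual:
  assumes p: "is_partition \<nu>"
  shows "column_tableau (dual_partition \<nu>) = col_array (part \<nu>) (\<lambda>b a. psum \<nu> b + 1 + a)"
proof -
  have "row_tableau \<nu> ! b ! a = psum \<nu> b + 1 + a" if "b < col_length (part \<nu>) a" for a b
  proof -
    have "a < part \<nu> b" using that columns.less_col_length[OF columns_part[OF p]] by simp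
    moreover from this have "b < length \<nu>" using part_pos_iff[OF p, of b] by simp
    ultimately show ?thesis by (rule row_tableau_nth[rotated])
  qed
  then show ?thesis
    unfolding column_tableau_def col_array_def dual_dual[OF p]
    using dual_col_length[OF p] by (intro map_cong) auto
qed

lemma col_array_of_tableau:
  assumes p: "is_partition \<nu>" and shape: "shape Q = dual_partition \<nu>"
  shows "col_array (part \<nu>) (\<lambda>b a. Q ! a ! b) = Q"
proof (rule nth_equalityI)
  have len: "length Q = part \<nu> 0" using shape dual_col_length(1)[OF p] unfolding shape_def by (metis length_map)
  then show "length (col_array (part \<nu>) (\<lambda>b a. Q ! a ! b)) = length Q" by (simp add: col_array_def)
  fix a assume "a < length (col_array (part \<nu>) (\<lambda>b a. Q ! a ! b))"
  then have a: "a < part \<nu> 0" by (simp add: col_array_def)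
  then have "length (Q ! a) = dual_partition \<nu> ! a" using len shape unfolding shape_def by (metis nth_map)
  then have "length (Q ! a) = col_length (part \<nu>) a" using a dual_col_length[OF p] by simp
  then show "col_array (part \<nu>) (\<lambda>b a. Q ! a ! b) ! a = Q ! a"
    using a by (simp add: col_array_def list_eq_iff_nth_eq)
qed

section \<open>Standardization of supertableaux\<close>

text \<open>\<open>T\<close> transported from cells to values: its entry in the cell to which
  \<open>cell_value\<close> assigns \<open>v\<close>.\<close>

definition value_at :: "nat list \<Rightarrow> nat list list \<Rightarrow> nat \<Rightarrow> nat" where
  "value_at \<nu> T v = T ! blk \<nu> v ! (psum \<nu> (Suc (blk \<nu> v)) - v)"

lemma value_at_cell: "a < part \<nu> b \<Longrightarrow> value_at \<nu> T (cell_value \<nu> b a) = T ! b ! a"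
  using cell_value_props(2)[of a \<nu> b] by (simp add: value_at_def cell_value_def psum_part)

lemma bij_cell_value:
  "bij_betw (\<lambda>(b, a). cell_value \<nu> b a) {(b, a). a < part \<nu> b} {1..sum_list \<nu>}"
proof (rule bij_betw_imageI)
  show "inj_on (\<lambda>(b, a). cell_value \<nu> b a) {(b, a). a < part \<nu> b}"
  proof (rule inj_onI)
    fix z z' assume "z \<in> {(b, a). a < part \<nu> b}" "z' \<in> {(b, a). a < part \<nu> b}"
      "(case z of (b, a) \<Rightarrow> cell_value \<nu> b a) = (case z' of (b, a) \<Rightarrow> cell_value \<nu> b a)"
    then show "z = z'"
      using cell_value_inject[of "snd z" \<nu> "fst z" "snd z'" "fst z'"] by (auto simp: case_prod_beta prod_eq_iff)
  qed
  show "(\<lambda>(b, a). cell_value \<nu> b a) ` {(b, a). a < part \<nu> b} = {1..sum_list \<nu>}"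
  proof (intro equalityI subsetI)
    fix v assume "v \<in> {1..sum_list \<nu>}"
    note v = cell_value_exists[OF this]
    show "v \<in> (\<lambda>(b, a). cell_value \<nu> b a) ` {(b, a). a < part \<nu> b}"
      by (rule image_eqI[of _ _ "(blk \<nu> v, psum \<nu> (Suc (blk \<nu> v)) - v)"]) (use v in auto)
  next
    fix v assume "v \<in> (\<lambda>(b, a). cell_value \<nu> b a) ` {(b, a). a < part \<nu> b}"
    then obtain b a where "a < part \<nu> b" "v = cell_value \<nu> b a" by auto
    then show "v \<in> {1..sum_list \<nu>}" using cell_value_props(1) by blast
  qed
qed

lemma shape_part:
  assumes "shape T = \<nu>"
  shows "length T = length \<nu>" "b < length T \<Longrightarrow> length (T ! b) = \<nu> ! b"
    "b < length T \<and> a < length (T ! b) \<longleftrightarrow> a < part \<nu> b"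
  using assms by (auto simp: shape_def part_def)

lemma count_list_card: "count_list xs x = card {a. a < length xs \<and> xs ! a = x}"
proof -
  have "count_list xs x = length (filter (\<lambda>y. y = x) xs)"
    by (induction xs) auto
  then show ?thesis by (simp add: length_filter_conv_card)
qed

lemma count_list_concat_card:
  assumes "shape T = \<nu>"
  shows "count_list (concat T) x = card {(b, a). a < part \<nu> b \<and> T ! b ! a = x}"
proof -
  have "count_list (concat T) x = (\<Sum>b<length T. count_list (T ! b) x)"
  proof (induction T)
    case (Cons R T)
    show ?case using Cons by (simp add: sum.lessThan_Suc_shift del: sum.lessThan_Suc)
  qed simp
  also have "\<dots> = card (SIGMA b:{..<length T}. {a. a < length (T ! b) \<and> T ! b ! a = x})"
    by (simp add: count_list_card)
  also have "(SIGMA b:{..<length T}. {a. a < length (T ! b) \<and> T ! b ! a = x}) =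
      {(b, a). a < part \<nu> b \<and> T ! b ! a = x}"
    using shape_part(3)[OF assms] by auto
  finally show ?thesis .
qed

lemma card_value_at:
  assumes "shape T = \<nu>"
  shows "card {v \<in> {1..sum_list \<nu>}. value_at \<nu> T v = x} = count_list (concat T) x"
proof -
  have "bij_betw (\<lambda>(b, a). cell_value \<nu> b a) {(b, a). a < part \<nu> b \<and> T ! b ! a = x}
      {v \<in> {1..sum_list \<nu>}. value_at \<nu> T v = x}"
  proof (rule bij_betw_imageI)
    show "inj_on (\<lambda>(b, a). cell_value \<nu> b a) {(b, a). a < part \<nu> b \<and> T ! b ! a = x}"
      by (rule inj_on_subset[OF bij_betw_imp_inj_on[OF bij_cell_value]]) auto
    show "(\<lambda>(b, a). cell_value \<nu> b a) ` {(b, a). a < part \<nu> b \<and> T ! b ! a = x} =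
        {v \<in> {1..sum_list \<nu>}. value_at \<nu> T v = x}" (is "?L = ?R")
    proof (intro equalityI subsetI)
      fix v assume "v \<in> ?L"
      then obtain b a where "a < part \<nu> b" "T ! b ! a = x" "v = cell_value \<nu> b a" by auto
      then show "v \<in> ?R" using cell_value_props(1)[of a \<nu> b] value_at_cell[of a \<nu> b T] by simp
    next
      fix v assume v: "v \<in> ?R"
      then have "v \<in> {1..sum_list \<nu>}" by blast
      note cell = cell_value_exists[OF this]
      then have "T ! blk \<nu> v ! (psum \<nu> (Suc (blk \<nu> v)) - v) = x"
        using v by (simp add: value_at_def)
      then show "v \<in> ?L"
        by (intro image_eqI[of _ _ "(blk \<nu> v, psum \<nu> (Suc (blk \<nu> v)) - v)"]) (use cell in auto)
    qed
  qed
  then show ?thesis using count_list_concat_card[OF assms] by (simp add: bij_betw_same_card)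
qed

lemma value_at_mem:
  assumes "shape T = \<nu>" "v \<in> {1..sum_list \<nu>}"
  shows "value_at \<nu> T v \<in> set (concat T)"
proof -
  have "blk \<nu> v < length T \<and> psum \<nu> (Suc (blk \<nu> v)) - v < length (T ! blk \<nu> v)"
    using shape_part(3)[OF assms(1)] cell_value_exists(2)[OF assms(2)] by simp
  then have "T ! blk \<nu> v \<in> set T" "value_at \<nu> T v \<in> set (T ! blk \<nu> v)"
    by (simp_all add: value_at_def)
  then show ?thesis by auto
qed

lemma supertableaux_iff:
  assumes "length \<xi> = m"
  shows "T \<in> supertableaux \<nu> (\<xi>, \<eta>) \<longleftrightarrow> shape T = \<nu> \<and> set (concat T) \<subseteq> {1..length (\<xi> @ \<eta>)} \<and>
    (\<forall>k < length (\<xi> @ \<eta>). count_list (concat T) (Suc k) = (\<xi> @ \<eta>) ! k) \<and>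
    (\<forall>b a a'. a < part \<nu> b \<and> a' < a \<longrightarrow>
      T ! b ! a' \<le> T ! b ! a \<and> (m < T ! b ! a' \<longrightarrow> T ! b ! a' < T ! b ! a)) \<and>
    (\<forall>b b' a. a < part \<nu> b \<and> b' < b \<longrightarrow>
      T ! b' ! a \<le> T ! b ! a \<and> (T ! b ! a \<le> m \<longrightarrow> T ! b' ! a < T ! b ! a))"
proof (cases "shape T = \<nu>")
  case True
  show ?thesis
    unfolding supertableaux_def prod.case mem_Collect_eq assms shape_part(3)[OF True, symmetric]
    by blast
qed (simp add: supertableaux_def)

text \<open>This characterizes \<open>w\<^sub>T w\<^sub>0\<^sub>,\<^sub>\<xi>\<close>, where \<open>w = w\<^sub>0\<^sub>,\<^sub>\<nu>\<close>, and for \<open>m = 0\<close> the element \<open>w\<^sub>T\<close> itself.\<close>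

definition standardizes :: "nat \<Rightarrow> nat \<Rightarrow> nat list \<Rightarrow> nat list \<Rightarrow> nat list list \<Rightarrow> (nat \<Rightarrow> nat) \<Rightarrow> bool" where
  "standardizes r m \<nu> \<rho> T y \<longleftrightarrow> y permutes {1..r} \<and> super_mono m \<rho> y \<and>
     (\<forall>p\<in>{1..r}. value_at \<nu> T (y p) = Suc (blk \<rho> p))"

text \<open>The values are sorted by the entries of \<open>T\<close> in their cells; the content of
  \<open>T\<close> provides the block sizes.\<close>

lemma standardizes_ex1:
  assumes sum: "sum_list \<nu> = r" "sum_list \<rho> = r" and shape: "shape T = \<nu>"
    and set: "set (concat T) \<subseteq> {1..length \<rho>}"
    and count: "\<forall>k < length \<rho>. count_list (concat T) (Suc k) = \<rho> ! k"
  shows "\<exists>!y. standardizes r m \<nu> \<rho> T y"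
proof -
  have mem: "value_at \<nu> T v \<in> {1..length \<rho>}" if "v \<in> {1..r}" for v
    using value_at_mem[OF shape, of v] that set sum(1) by blast
  \<comment> \<open>Colours start at 0 and entries at 1; no entry is 0, so the subtraction loses
    nothing.\<close>
  let ?c = "\<lambda>v. value_at \<nu> T v - 1"
  have "{v \<in> {1..r}. ?c v = k} = {v \<in> {1..r}. value_at \<nu> T v = Suc k}" for k
    using mem by force
  then have card: "card {v \<in> {1..r}. ?c v = k} = \<rho> ! k" if "k < length \<rho>" for k
    using card_value_at[OF shape, of "Suc k"] count that sum(1) by simp
  have less: "?c v < length \<rho>" if "v \<in> {1..r}" for v
    using mem[OF that] by auto
  have eq: "standardizes r m \<nu> \<rho> T y \<longleftrightarrow>
      y permutes {1..r} \<and> super_mono m \<rho> y \<and> (\<forall>p\<in>{1..r}. ?c (y p) = blk \<rho> p)" for y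
  proof -
    have "value_at \<nu> T (y p) = Suc (blk \<rho> p) \<longleftrightarrow> ?c (y p) = blk \<rho> p"
      if "y permutes {1..r}" "p \<in> {1..r}" for p
      using mem[OF permutes_mem[OF that]] by auto
    then show ?thesis unfolding standardizes_def by blast
  qed
  show ?thesis
    using sorting_permutation[OF sum(2), of ?c m] card less unfolding eq by blast
qed

section \<open>The element \<open>tableau_perm\<close> and its twist by the longest element\<close>

lemma sorted_map_upt:
  fixes u :: "nat \<Rightarrow> nat"
  shows "sorted_wrt (<) (map u [i..<j]) \<longleftrightarrow> (\<forall>p q. i \<le> p \<and> p < q \<and> q < j \<longrightarrow> u p < u q)"
proof
  assume sorted: "sorted_wrt (<) (map u [i..<j])"
  show "\<forall>p q. i \<le> p \<and> p < q \<and> q < j \<longrightarrow> u p < u q"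
  proof (intro allI impI)
    fix p q assume "i \<le> p \<and> p < q \<and> q < j"
    then have "i \<le> p" "p < q" "q < j" by simp_all
    then show "u p < u q"
      using sorted_wrt_nth_less[OF sorted, of "p - i" "q - i"] by simp
  qed
qed (auto simp: sorted_wrt_iff_nth_less)

text \<open>The longest element reflects each row of the row tableau, which explains the descending
  numbering in \<open>cell_value\<close>.\<close>

lemma longest_elt_partition:
  assumes "sum_list \<nu> = r" "a < part \<nu> b"
  shows "longest_elt r \<nu> (row_tableau \<nu> ! b ! a) = cell_value \<nu> b a"
proof -
  have b: "b < length \<nu>" using assms(2) by (simp add: part_def split: if_splits)
  let ?p = "psum \<nu> b + 1 + a"
  have p: "1 \<le> ?p" "psum \<nu> b < ?p" "?p \<le> psum \<nu> (Suc b)" using assms(2) psum_part[of b \<nu>] by auto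
  then have p': "?p \<le> sum_list \<nu>" using psum_le[of "Suc b" \<nu>] by simp
  have "blk \<nu> ?p = b" using blk_eq_iff[OF p(1) p'] p(2,3) by blast
  moreover have "longest_elt r \<nu> = rev_perm \<nu>"
    using longest_elt_eq[of \<nu> r] assms(1) by (simp add: pad_right_def)
  ultimately show ?thesis
    using p p' row_tableau_nth[OF b assms(2)] by (simp add: rev_perm_def cell_value_def)
qed

text \<open>The defining conditions of \<open>tableau_perm\<close> are \<open>standardizes\<close>
  with all blocks increasing: prescribing the set of values of each row says that \<open>u\<close>
  carries blocks onto colour classes.\<close>

lemma tableau_perm_standardizes:
  assumes sum: "sum_list \<nu> = r" "sum_list \<rho> = r" and shape: "shape T = \<nu>"
    and set: "set (concat T) \<subseteq> {1..length \<rho>}"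
    and count: "\<forall>k < length \<rho>. count_list (concat T) (Suc k) = \<rho> ! k"
  shows "standardizes r 0 \<nu> \<rho> T (tableau_perm r (longest_elt r \<nu>) \<rho> T)"
proof -
  have mem: "value_at \<nu> T v \<in> {1..length \<rho>}" if "v \<in> {1..r}" for v
    using value_at_mem[OF shape, of v] that set sum(1) by blast
  have cells: "{longest_elt r \<nu> (row_tableau (shape T) ! i ! j) | i j.
      i < length T \<and> j < length (T ! i) \<and> T ! i ! j = x} = {v \<in> {1..r}. value_at \<nu> T v = x}" (is "?L = ?R") for x
  proof (intro equalityI subsetI)
    fix v assume "v \<in> ?L"
    then obtain i j where ij: "v = longest_elt r \<nu> (row_tableau \<nu> ! i ! j)" "j < part \<nu> i" "T ! i ! j = x"
      using shape_part(3)[OF shape] shape by blast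
    then have "v = cell_value \<nu> i j" using longest_elt_partition[OF sum(1)] by simp
    then show "v \<in> ?R" using ij cell_value_props(1)[of j \<nu> i] value_at_cell[of j \<nu> i T] sum(1) by simp
  next
    fix v assume v: "v \<in> ?R"
    then have "v \<in> {1..sum_list \<nu>}" using sum(1) by blast
    note cell = cell_value_exists[OF this]
    let ?i = "blk \<nu> v" and ?j = "psum \<nu> (Suc (blk \<nu> v)) - v"
    have "T ! ?i ! ?j = x" using v by (simp add: value_at_def)
    moreover have "v = longest_elt r \<nu> (row_tableau (shape T) ! ?i ! ?j)"
      unfolding shape longest_elt_partition[OF sum(1) cell(2)] by (rule cell(1))
    moreover have "?i < length T \<and> ?j < length (T ! ?i)" using shape_part(3)[OF shape] cell(2) by blast
    ultimately show "v \<in> ?L" by blast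
  qed
  have sorted: "(\<forall>k < length \<rho>. sorted_wrt (<) (map u (row_tableau \<rho> ! k))) \<longleftrightarrow> super_mono 0 \<rho> u" for u
  proof -
    have "(sorted_wrt (<) (map u (row_tableau \<rho> ! k))) \<longleftrightarrow>
        (\<forall>p q. 1 \<le> p \<and> p < q \<and> q \<le> r \<and> blk \<rho> p = k \<and> blk \<rho> q = k \<longrightarrow> u p < u q)"
      if k: "k < length \<rho>" for k
    proof -
      have row: "row_tableau \<rho> ! k = [psum \<rho> k + 1..<psum \<rho> (Suc k) + 1]"
        using k by (simp add: row_tableau_def del: upt_Suc)
      have iff: "psum \<rho> k + 1 \<le> p \<and> p < q \<and> q < psum \<rho> (Suc k) + 1 \<longleftrightarrow>
          1 \<le> p \<and> p < q \<and> q \<le> r \<and> blk \<rho> p = k \<and> blk \<rho> q = k" for p q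
        using blk_eq_iff[of p \<rho> k] blk_eq_iff[of q \<rho> k] psum_le[of "Suc k" \<rho>] sum(2) by auto
      show ?thesis unfolding row sorted_map_upt iff ..
    qed
    then have "(\<forall>k < length \<rho>. sorted_wrt (<) (map u (row_tableau \<rho> ! k))) \<longleftrightarrow> (\<forall>k < length \<rho>.
        \<forall>p q. 1 \<le> p \<and> p < q \<and> q \<le> r \<and> blk \<rho> p = k \<and> blk \<rho> q = k \<longrightarrow> u p < u q)" by simp
    also have "\<dots> \<longleftrightarrow> (\<forall>p q. 1 \<le> p \<and> p < q \<and> q \<le> r \<and> blk \<rho> p = blk \<rho> q \<longrightarrow> u p < u q)"
    proof (intro iffI allI impI)
      fix p q assume L: "\<forall>k < length \<rho>. \<forall>p q. 1 \<le> p \<and> p < q \<and> q \<le> r \<and> blk \<rho> p = k \<and> blk \<rho> q = k \<longrightarrow> u p < u q"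
        and pq: "1 \<le> p \<and> p < q \<and> q \<le> r \<and> blk \<rho> p = blk \<rho> q"
      have "blk \<rho> p < length \<rho>" using blk_less_length[of p \<rho>] pq sum(2) by simp
      then show "u p < u q" using L pq by metis
    next
      fix k p q assume "\<forall>p q. 1 \<le> p \<and> p < q \<and> q \<le> r \<and> blk \<rho> p = blk \<rho> q \<longrightarrow> u p < u q"
        and "1 \<le> p \<and> p < q \<and> q \<le> r \<and> blk \<rho> p = k \<and> blk \<rho> q = k"
      then show "u p < u q" by metis
    qed
    finally show ?thesis unfolding super_mono_def sum(2) by simp
  qed
  have images: "(\<forall>k < length \<rho>. set (map u (row_tableau \<rho> ! k)) = {v \<in> {1..r}. value_at \<nu> T v = Suc k}) \<longleftrightarrow>
      (\<forall>p\<in>{1..r}. value_at \<nu> T (u p) = Suc (blk \<rho> p))" if u: "u permutes {1..r}" for u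
  proof -
    have "set (map u (row_tableau \<rho> ! k)) = u ` {p \<in> {1..r}. blk \<rho> p = k}" if "k < length \<rho>" for k
      using row_block_blk[OF that] sum(2) by (simp add: row_block_def)
    moreover have "(\<forall>k < length \<rho>. u ` {p \<in> {1..r}. blk \<rho> p = k} = {v \<in> {1..r}. value_at \<nu> T v = Suc k}) \<longleftrightarrow>
        (\<forall>p\<in>{1..r}. value_at \<nu> T (u p) = Suc (blk \<rho> p))"
    proof (intro iffI ballI allI impI)
      fix p
      assume eq: "\<forall>k < length \<rho>. u ` {p \<in> {1..r}. blk \<rho> p = k} = {v \<in> {1..r}. value_at \<nu> T v = Suc k}"
        and p: "p \<in> {1..r}"
      have "blk \<rho> p < length \<rho>" using blk_less_length[of p \<rho>] p sum(2) by simp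
      moreover have "u p \<in> u ` {q \<in> {1..r}. blk \<rho> q = blk \<rho> p}" using p by blast
      ultimately show "value_at \<nu> T (u p) = Suc (blk \<rho> p)" using eq by blast
    next
      fix k assume eq: "\<forall>p\<in>{1..r}. value_at \<nu> T (u p) = Suc (blk \<rho> p)"
      show "u ` {p \<in> {1..r}. blk \<rho> p = k} = {v \<in> {1..r}. value_at \<nu> T v = Suc k}"
      proof (intro equalityI subsetI)
        fix v assume v: "v \<in> {v \<in> {1..r}. value_at \<nu> T v = Suc k}"
        then obtain p where p: "p \<in> {1..r}" "v = u p" using permutes_image[OF u] by blast
        then have "Suc (blk \<rho> p) = Suc k" using eq v by simp
        then show "v \<in> u ` {p \<in> {1..r}. blk \<rho> p = k}" using p by blast
      next
        fix v assume "v \<in> u ` {p \<in> {1..r}. blk \<rho> p = k}"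
        then obtain p where "p \<in> {1..r}" "blk \<rho> p = k" "v = u p" by blast
        then show "v \<in> {v \<in> {1..r}. value_at \<nu> T v = Suc k}"
          using eq permutes_mem[OF u, of p] by blast
      qed
    qed
    ultimately show ?thesis by simp
  qed
  have "(u permutes {1..r} \<and> (\<forall>k < length \<rho>. sorted_wrt (<) (map u (row_tableau \<rho> ! k)) \<and>
        set (map u (row_tableau \<rho> ! k)) = {longest_elt r \<nu> (row_tableau (shape T) ! i ! j) | i j.
             i < length T \<and> j < length (T ! i) \<and> T ! i ! j = Suc k})) \<longleftrightarrow> standardizes r 0 \<nu> \<rho> T u" for u
    unfolding cells standardizes_def using sorted[of u] images[of u] by blast
  then show ?thesis
    unfolding tableau_perm_def using theI'[OF standardizes_ex1[OF assms, of 0]] by presburger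
qed

text \<open>The padding after \<open>\<xi>\<close> consists of singletons, so the longest element
  reverses the even blocks and fixes the points of the odd ones.\<close>

lemma longest_elt_blocks:
  assumes "(\<xi>, \<eta>) \<in> bicompositions m n r" and p: "p \<in> {1..r}"
  shows "longest_elt r \<xi> p \<in> {1..r}" "blk (\<xi> @ \<eta>) (longest_elt r \<xi> p) = blk (\<xi> @ \<eta>) p"
    "\<not> blk (\<xi> @ \<eta>) p < m \<Longrightarrow> longest_elt r \<xi> p = p"
    "blk (\<xi> @ \<eta>) p < m \<Longrightarrow> p < q \<Longrightarrow> q \<le> r \<Longrightarrow> blk (\<xi> @ \<eta>) p = blk (\<xi> @ \<eta>) q \<Longrightarrow>
      longest_elt r \<xi> q < longest_elt r \<xi> p"
proof -
  have sums: "sum_list (\<xi> @ \<eta>) = r" "length \<xi> = m"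
    using assms(1) by (auto simp: bicompositions_def compositions_def)
  have pad: "sum_list (pad_right r \<xi>) = r" using sum_list_pads(1)[OF sums(1)] .
  have eq: "longest_elt r \<xi> = rev_perm (pad_right r \<xi>)"
    using longest_elt_eq[of \<xi> r] sums(1) by simp
  have rev: "longest_elt r \<xi> p \<in> {1..r}" "blk (pad_right r \<xi>) (longest_elt r \<xi> p) = blk (pad_right r \<xi>) p"
    using rev_perm_block[of p "pad_right r \<xi>"] p pad unfolding eq by simp_all
  show "longest_elt r \<xi> p \<in> {1..r}" by (rule rev(1))
  have formula: "blk (pad_right r \<xi>) v = (if blk (\<xi> @ \<eta>) v < m then blk (\<xi> @ \<eta>) v else m + (v - sum_list \<xi> - 1))"
    if "v \<in> {1..r}" for v
    using blk_pad_right[OF sums(1), of v] that sums(2) by simp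
  \<comment> \<open>Points of odd blocks lie beyond \<open>sum_list \<xi>\<close>, so the truncated
    subtraction in \<open>formula\<close> still determines them.\<close>
  have large: "sum_list \<xi> < v" if "v \<in> {1..r}" "\<not> blk (\<xi> @ \<eta>) v < m" for v
    using blk_append[of v \<xi> \<eta>] blk_less_length[of v \<xi>] that sums by (auto simp: not_le[symmetric])
  have fixed: "longest_elt r \<xi> p = p" if nb: "\<not> blk (\<xi> @ \<eta>) p < m"
  proof -
    have "\<not> blk (\<xi> @ \<eta>) (longest_elt r \<xi> p) < m"
      using formula[OF rev(1)] formula[OF p] rev(2) nb by (auto split: if_splits)
    then have "longest_elt r \<xi> p - sum_list \<xi> - 1 = p - sum_list \<xi> - 1"
      using formula[OF rev(1)] formula[OF p] rev(2) nb by simp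
    then show ?thesis
      using large[OF p nb] large[OF rev(1) \<open>\<not> blk (\<xi> @ \<eta>) (longest_elt r \<xi> p) < m\<close>] by simp
  qed
  then show "\<not> blk (\<xi> @ \<eta>) p < m \<Longrightarrow> longest_elt r \<xi> p = p" .
  show "blk (\<xi> @ \<eta>) (longest_elt r \<xi> p) = blk (\<xi> @ \<eta>) p"
  proof (cases "blk (\<xi> @ \<eta>) p < m")
    case True
    have "(if blk (\<xi> @ \<eta>) (longest_elt r \<xi> p) < m then blk (\<xi> @ \<eta>) (longest_elt r \<xi> p)
        else m + (longest_elt r \<xi> p - sum_list \<xi> - 1)) = blk (\<xi> @ \<eta>) p"
      unfolding formula[OF rev(1), symmetric] rev(2) formula[OF p] using True by (simp only: if_True)
    then show ?thesis using True by (cases "blk (\<xi> @ \<eta>) (longest_elt r \<xi> p) < m") simp_all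
  next
    case False
    then show ?thesis by (simp only: fixed not_False_eq_True)
  qed
  show "longest_elt r \<xi> q < longest_elt r \<xi> p"
    if "blk (\<xi> @ \<eta>) p < m" "p < q" "q \<le> r" "blk (\<xi> @ \<eta>) p = blk (\<xi> @ \<eta>) q"
    unfolding eq using that p pad formula[OF p] formula[of q] by (intro rev_perm_less) auto
qed

text \<open>Reversing the even blocks makes an increasing arrangement decrease there, without
  changing which values stand in a block.\<close>

lemma standardizes_comp_longest:
  assumes xe: "(\<xi>, \<eta>) \<in> bicompositions m n r" and u: "standardizes r 0 \<nu> (\<xi> @ \<eta>) T u"
  shows "standardizes r m \<nu> (\<xi> @ \<eta>) T (u \<circ> longest_elt r \<xi>)"
  unfolding standardizes_def
proof (intro conjI ballI)
  let ?l = "longest_elt r \<xi>"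
  have sums: "sum_list (\<xi> @ \<eta>) = r" "length \<xi> = m"
    using xe by (auto simp: bicompositions_def compositions_def)
  have u': "u permutes {1..r}" "super_mono 0 (\<xi> @ \<eta>) u"
      "\<forall>p\<in>{1..r}. value_at \<nu> T (u p) = Suc (blk (\<xi> @ \<eta>) p)"
    using u by (simp_all add: standardizes_def)
  have "?l permutes {1..r}"
    using rev_perm_permutes[of "pad_right r \<xi>"] longest_elt_eq[of \<xi> r] sum_list_pads(1)[OF sums(1)] sums(1)
    by simp
  then show "u \<circ> ?l permutes {1..r}" using u'(1) by (rule permutes_compose)
  show "super_mono m (\<xi> @ \<eta>) (u \<circ> ?l)"
    unfolding super_mono_def
  proof (intro allI impI)
    fix p q assume pq: "1 \<le> p \<and> p < q \<and> q \<le> sum_list (\<xi> @ \<eta>) \<and> blk (\<xi> @ \<eta>) p = blk (\<xi> @ \<eta>) q"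
    then have p: "p \<in> {1..r}" and q: "q \<in> {1..r}" using sums(1) by auto
    show "if blk (\<xi> @ \<eta>) p < m then (u \<circ> ?l) q < (u \<circ> ?l) p else (u \<circ> ?l) p < (u \<circ> ?l) q"
    proof (cases "blk (\<xi> @ \<eta>) p < m")
      case True
      have "?l q < ?l p" using longest_elt_blocks(4)[OF xe p True, of q] pq sums(1) by simp
      then have "u (?l q) < u (?l p)"
        using super_monoD[OF u'(2), of "?l q" "?l p"] longest_elt_blocks(1,2)[OF xe p]
          longest_elt_blocks(1,2)[OF xe q] pq sums(1) by simp
      then show ?thesis using True by simp
    next
      case False
      then have "?l p = p" "?l q = q"
        using longest_elt_blocks(3)[OF xe p] longest_elt_blocks(3)[OF xe q] pq by simp_all
      then show ?thesis using super_monoD[OF u'(2), of p q] pq False by simp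
    qed
  qed
  fix p assume p: "p \<in> {1..r}"
  show "value_at \<nu> T ((u \<circ> ?l) p) = Suc (blk (\<xi> @ \<eta>) p)"
    using u'(3) longest_elt_blocks(1,2)[OF xe p] by simp
qed

lemma supertableau_standardizes_iff:
  assumes \<nu>: "sum_list \<nu> = r" and xe: "(\<xi>, \<eta>) \<in> bicompositions m n r"
    and T: "T \<in> supertableaux \<nu> (\<xi>, \<eta>)"
  shows "y = tableau_perm r (longest_elt r \<nu>) (\<xi> @ \<eta>) T \<circ> longest_elt r \<xi> \<longleftrightarrow>
    standardizes r m \<nu> (\<xi> @ \<eta>) T y"
proof -
  have sums: "sum_list (\<xi> @ \<eta>) = r" "length \<xi> = m"
    using xe by (auto simp: bicompositions_def compositions_def)
  have T': "shape T = \<nu>" "set (concat T) \<subseteq> {1..length (\<xi> @ \<eta>)}"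
      "\<forall>k < length (\<xi> @ \<eta>). count_list (concat T) (Suc k) = (\<xi> @ \<eta>) ! k"
    using T unfolding supertableaux_iff[OF sums(2)] by blast+
  show ?thesis
    using standardizes_ex1[OF \<nu> sums(1) T', of m]
      standardizes_comp_longest[OF xe tableau_perm_standardizes[OF \<nu> sums(1) T']] by blast
qed

section \<open>Supertableaux and the positions of the cells\<close>

abbreviation positions :: "nat list \<Rightarrow> (nat \<Rightarrow> nat) \<Rightarrow> nat \<Rightarrow> nat \<Rightarrow> nat" where
  "positions \<nu> y \<equiv> \<lambda>b a. pinv y (cell_value \<nu> b a)"

lemma cell_value_row: "a < part \<nu> b \<Longrightarrow> a' < a \<Longrightarrow> cell_value \<nu> b a < cell_value \<nu> b a'"
  unfolding cell_value_def psum_part by simp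

lemma cell_value_col:
  assumes "a < part \<nu> b" "a' < part \<nu> b'" "b' < b"
  shows "cell_value \<nu> b' a' < cell_value \<nu> b a"
proof -
  have "psum \<nu> (Suc b') \<le> psum \<nu> b" using assms(3) by (intro psum_mono) simp
  then show ?thesis using assms(1) psum_part[of b \<nu>] unfolding cell_value_def by linarith
qed

text \<open>Equal entries are the delicate case. In a row they are at most \<open>m\<close>,
  \<open>cell_value\<close> falls along the row, and an even block lists larger values first. In a
  column they exceed \<open>m\<close>, \<open>cell_value\<close> rises, and an odd block lists
  smaller values first.\<close>

lemma std_array_of_supertableau:
  assumes \<nu>: "is_partition \<nu>" "sum_list \<nu> = r" and xe: "(\<xi>, \<eta>) \<in> bicompositions m n r"
    and T: "T \<in> supertableaux \<nu> (\<xi>, \<eta>)" and y: "standardizes r m \<nu> (\<xi> @ \<eta>) T y"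
  shows "std_array \<nu> (positions \<nu> y)"
proof -
  have sums: "sum_list (\<xi> @ \<eta>) = r" "length \<xi> = m"
    using xe by (auto simp: bicompositions_def compositions_def)
  let ?pos = "positions \<nu> y" and ?blk = "blk (\<xi> @ \<eta>)"
  have y': "y permutes {1..r}" "super_mono m (\<xi> @ \<eta>) y"
      "\<forall>p\<in>{1..r}. value_at \<nu> T (y p) = Suc (?blk p)"
    using y by (simp_all add: standardizes_def)
  have inv: "y (?pos b a) = cell_value \<nu> b a" for b a by (rule permutes_inverses(1)[OF y'(1)])
  have pos: "?pos b a \<in> {1..r}" "T ! b ! a = Suc (?blk (?pos b a))" if "a < part \<nu> b" for b a
  proof -
    show p: "?pos b a \<in> {1..r}"
      by (rule permutes_mem[OF permutes_inv[OF y'(1)]]) (use cell_value_props(1)[OF that] \<nu>(2) in simp)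
    show "T ! b ! a = Suc (?blk (?pos b a))"
      using y'(3) p inv value_at_cell[OF that, of T] by metis
  qed
  have less: "p < q" if "?blk p \<le> ?blk q" "p \<in> {1..r}" "q \<in> {1..r}"
      "?blk p = ?blk q \<Longrightarrow> (if ?blk p < m then y q < y p else y p < y q)" for p q
  proof (rule ccontr)
    assume "\<not> p < q"
    then have "q \<le> p" by simp
    then have "?blk q \<le> ?blk p" using blk_mono[of q p "\<xi> @ \<eta>"] that(2) sums(1) by simp
    then have eq: "?blk p = ?blk q" using that(1) by simp
    then have "p \<noteq> q" using that(4) by (auto split: if_splits)
    then show False
      using that(4)[OF eq] super_monoD[OF y'(2), of q p] \<open>q \<le> p\<close> eq that(2,3) sums(1)
      by (auto split: if_splits)
  qed
  show ?thesis
    unfolding std_array_def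
  proof (intro conjI allI impI)
    fix b a assume a: "Suc a < part \<nu> b"
    have rows: "T ! b ! a \<le> T ! b ! Suc a \<and> (m < T ! b ! a \<longrightarrow> T ! b ! a < T ! b ! Suc a)"
      using T a lessI[of a] unfolding supertableaux_iff[OF sums(2)] by blast
    show "?pos b a < ?pos b (Suc a)"
      using rows pos[of a b] pos[OF a] a cell_value_row[OF a, of a]
      by (intro less) (auto simp: inv not_less)
  next
    fix b a assume a: "a < part \<nu> (Suc b)"
    then have a': "a < part \<nu> b" using part_antimono[OF \<nu>(1), of b "Suc b"] by simp
    have cols: "T ! b ! a \<le> T ! Suc b ! a \<and> (T ! Suc b ! a \<le> m \<longrightarrow> T ! b ! a < T ! Suc b ! a)"
      using T a lessI[of b] unfolding supertableaux_iff[OF sums(2)] by blast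
    show "?pos b a < ?pos (Suc b) a"
      using cols pos[OF a] pos[OF a'] cell_value_col[OF a a']
      by (intro less) (auto simp: inv not_less)
  qed
qed

text \<open>Each cell receives the block of its position. Equal entries above \<open>m\<close> in a
  row would need increasing values at increasing positions, but \<open>cell_value\<close> decreases
  along rows; columns with entries up to \<open>m\<close> are excluded in the same way.\<close>

lemma supertableau_of_std_array:
  assumes \<nu>: "is_partition \<nu>" "sum_list \<nu> = r" and xe: "(\<xi>, \<eta>) \<in> bicompositions m n r"
    and y: "y permutes {1..r}" "super_mono m (\<xi> @ \<eta>) y" and std: "std_array \<nu> (positions \<nu> y)"
  obtains T where "T \<in> supertableaux \<nu> (\<xi>, \<eta>)" "standardizes r m \<nu> (\<xi> @ \<eta>) T y"
proof
  have sums: "sum_list (\<xi> @ \<eta>) = r" "length \<xi> = m"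
    using xe by (auto simp: bicompositions_def compositions_def)
  let ?pos = "positions \<nu> y" and ?blk = "blk (\<xi> @ \<eta>)"
  define T where "T = map (\<lambda>b. map (\<lambda>a. Suc (?blk (?pos b a))) [0..<\<nu> ! b]) [0..<length \<nu>]"
  have shape: "shape T = \<nu>" by (simp add: shape_def T_def map_nth comp_def)
  have T: "T ! b ! a = Suc (?blk (?pos b a))" if "a < part \<nu> b" for b a
    using that by (simp add: T_def part_def split: if_splits)
  have inv: "y (?pos b a) = cell_value \<nu> b a" for b a by (rule permutes_inverses(1)[OF y(1)])
  have pos: "?pos b a \<in> {1..r}" if "a < part \<nu> b" for b a
    by (rule permutes_mem[OF permutes_inv[OF y(1)]]) (use cell_value_props(1)[OF that] \<nu>(2) in simp)
  have val: "value_at \<nu> T v = Suc (?blk (pinv y v))" if "v \<in> {1..r}" for v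
  proof -
    have v: "v \<in> {1..sum_list \<nu>}" using that \<nu>(2) by simp
    show ?thesis
      using T[OF cell_value_exists(2)[OF v]] cell_value_exists(1)[OF v] by (simp add: value_at_def)
  qed
  show std_y: "standardizes r m \<nu> (\<xi> @ \<eta>) T y"
    unfolding standardizes_def
  proof (intro conjI ballI y)
    fix p assume "p \<in> {1..r}"
    then show "value_at \<nu> T (y p) = Suc (?blk p)"
      using val[OF permutes_mem[OF y(1)], of p] by (simp add: permutes_inverses(2)[OF y(1)])
  qed
  show "T \<in> supertableaux \<nu> (\<xi>, \<eta>)"
    unfolding supertableaux_iff[OF sums(2)]
  proof (intro conjI allI impI)
    show "shape T = \<nu>" by (rule shape)
    show "set (concat T) \<subseteq> {1..length (\<xi> @ \<eta>)}"
    proof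
      fix x assume "x \<in> set (concat T)"
      then obtain b a where ba: "b < length T" "a < length (T ! b)" "x = T ! b ! a"
        by (auto simp: in_set_conv_nth)
      then have "a < part \<nu> b" using shape_part(3)[OF shape] by blast
      then show "x \<in> {1..length (\<xi> @ \<eta>)}"
        using T ba(3) blk_less_length[of "?pos b a" "\<xi> @ \<eta>"] pos sums(1) by fastforce
    qed
    fix k assume k: "k < length (\<xi> @ \<eta>)"
    have "count_list (concat T) (Suc k) = card {v \<in> {1..r}. value_at \<nu> T v = Suc k}"
      using card_value_at[OF shape, of "Suc k"] \<nu>(2) by simp
    also have "{v \<in> {1..r}. value_at \<nu> T v = Suc k} = y ` {p \<in> {1..r}. ?blk p = k}"
    proof (intro equalityI subsetI)
      fix v assume v: "v \<in> {v \<in> {1..r}. value_at \<nu> T v = Suc k}"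
      then have "v \<in> {1..r}" "Suc (?blk (pinv y v)) = Suc k" using val[of v] by simp_all
      then have "pinv y v \<in> {p \<in> {1..r}. ?blk p = k}"
        using permutes_mem[OF permutes_inv[OF y(1)], of v] by blast
      then show "v \<in> y ` {p \<in> {1..r}. ?blk p = k}"
        by (rule image_eqI[rotated]) (simp add: permutes_inverses(1)[OF y(1)])
    next
      fix v assume "v \<in> y ` {p \<in> {1..r}. ?blk p = k}"
      then show "v \<in> {v \<in> {1..r}. value_at \<nu> T v = Suc k}"
        using std_y permutes_mem[OF y(1)] unfolding standardizes_def by blast
    qed
    also have "card \<dots> = card {p \<in> {1..r}. ?blk p = k}"
      by (rule card_image) (rule permutes_inj_on[OF y(1)])
    also have "\<dots> = (\<xi> @ \<eta>) ! k" using card_blk[OF k] sums(1) by simp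
    finally show "count_list (concat T) (Suc k) = (\<xi> @ \<eta>) ! k" .
  next
    fix b a a' assume a: "a < part \<nu> b \<and> a' < a"
    then have a': "a' < part \<nu> b" by simp
    have lt: "?pos b a' < ?pos b a" using std_array_row[OF std, of a' a b] a by simp
    then have le: "?blk (?pos b a') \<le> ?blk (?pos b a)"
      using pos[of a b] a sums(1) by (intro blk_mono) auto
    show "T ! b ! a' \<le> T ! b ! a" using le T[OF a'] T[of a b] a by simp
    assume "m < T ! b ! a'"
    then have m: "\<not> ?blk (?pos b a') < m" using T[OF a'] by simp
    have "?blk (?pos b a') \<noteq> ?blk (?pos b a)"
    proof
      assume "?blk (?pos b a') = ?blk (?pos b a)"
      then have "y (?pos b a') < y (?pos b a)"
        using super_monoD[OF y(2) _ lt] pos[of a b] pos[OF a'] a m sums(1) by simp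
      then show False using cell_value_row[of a \<nu> b a'] a unfolding inv by simp
    qed
    then show "T ! b ! a' < T ! b ! a" using le T[OF a'] T[of a b] a by simp
  next
    fix b b' a assume a: "a < part \<nu> b \<and> b' < b"
    then have a': "a < part \<nu> b'" using part_antimono[OF \<nu>(1), of b' b] by simp
    have lt: "?pos b' a < ?pos b a" using std_array_col[OF std \<nu>(1), of b' b a] a by simp
    then have le: "?blk (?pos b' a) \<le> ?blk (?pos b a)"
      using pos[of a b] a sums(1) by (intro blk_mono) auto
    show "T ! b' ! a \<le> T ! b ! a" using le T[OF a'] T[of a b] a by simp
    assume "T ! b ! a \<le> m"
    then have m: "?blk (?pos b a) < m" using T[of a b] a by simp
    have "?blk (?pos b' a) \<noteq> ?blk (?pos b a)"
    proof
      assume eq: "?blk (?pos b' a) = ?blk (?pos b a)"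
      then have "y (?pos b a) < y (?pos b' a)"
        using super_monoD[OF y(2) _ lt] pos[of a b] pos[OF a'] a m sums(1) by simp
      then show False using cell_value_col[of a \<nu> b a b'] a a' unfolding inv by simp
    qed
    then show "T ! b' ! a < T ! b ! a" using le T[OF a'] T[of a b] a by simp
  qed
qed

lemma standardizes_unique_tableau:
  assumes "shape T = \<nu>" "shape T' = \<nu>" "sum_list \<nu> = r"
    and "standardizes r m \<nu> \<rho> T y" "standardizes r m \<nu> \<rho> T' y"
  shows "T = T'"
proof -
  have y: "y permutes {1..r}" using assms(4) by (simp add: standardizes_def)
  have eq: "T ! b ! a = T' ! b ! a" if "a < part \<nu> b" for b a
  proof -
    have c: "cell_value \<nu> b a \<in> {1..r}" using cell_value_props(1)[OF that] assms(3) by simp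
    let ?p = "pinv y (cell_value \<nu> b a)"
    have "?p \<in> {1..r}" by (rule permutes_mem[OF permutes_inv[OF y] c])
    then have "value_at \<nu> T (y ?p) = value_at \<nu> T' (y ?p)"
      using assms(4,5) by (simp add: standardizes_def)
    then show ?thesis using value_at_cell[OF that] by (simp add: permutes_inverses(1)[OF y])
  qed
  show ?thesis
  proof (rule nth_equalityI)
    show len: "length T = length T'" using shape_part(1)[OF assms(1)] shape_part(1)[OF assms(2)] by simp
    fix b assume b: "b < length T"
    show "T ! b = T' ! b"
    proof (rule nth_equalityI)
      show "length (T ! b) = length (T' ! b)"
        using shape_part(2)[OF assms(1) b] shape_part(2)[OF assms(2)] b len by simp
      fix a assume "a < length (T ! b)"
      then show "T ! b ! a = T' ! b ! a" using eq shape_part(3)[OF assms(1)] b by blast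
    qed
  qed
qed

text \<open>Stands for the intersection of a cell with the double coset representatives, seen from
  the right: by \<open>RS_std_array\<close> the condition on \<open>positions\<close> makes the
  insertion tableau a column tableau.\<close>

definition cell_elements :: "nat \<Rightarrow> nat \<Rightarrow> nat list \<Rightarrow> nat list \<Rightarrow> (nat \<Rightarrow> nat) set" where
  "cell_elements r m \<nu> \<rho> =
     {y. y permutes {1..r} \<and> super_mono m \<rho> y \<and> std_array \<nu> (positions \<nu> y)}"

lemma tableau_of_standardizes:
  assumes \<nu>: "is_partition \<nu>" "sum_list \<nu> = r" and xe: "(\<xi>, \<eta>) \<in> bicompositions m n r"
    and y: "y \<in> cell_elements r m \<nu> (\<xi> @ \<eta>)"
  shows "tableau_of r \<nu> (\<xi>, \<eta>) y \<in> supertableaux \<nu> (\<xi>, \<eta>)"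
    "standardizes r m \<nu> (\<xi> @ \<eta>) (tableau_of r \<nu> (\<xi>, \<eta>) y) y"
proof -
  obtain T where T: "T \<in> supertableaux \<nu> (\<xi>, \<eta>)" "standardizes r m \<nu> (\<xi> @ \<eta>) T y"
    using supertableau_of_std_array[OF \<nu> xe, of y] y unfolding cell_elements_def by blast
  have "tableau_of r \<nu> (\<xi>, \<eta>) y = T"
    unfolding tableau_of_def prod.case
  proof (rule the_equality)
    show "T \<in> supertableaux \<nu> (\<xi>, \<eta>) \<and>
        y = tableau_perm r (longest_elt r \<nu>) (\<xi> @ \<eta>) T \<circ> longest_elt r \<xi>"
      using T supertableau_standardizes_iff[OF \<nu>(2) xe T(1)] by blast
    fix T' assume T': "T' \<in> supertableaux \<nu> (\<xi>, \<eta>) \<and>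
        y = tableau_perm r (longest_elt r \<nu>) (\<xi> @ \<eta>) T' \<circ> longest_elt r \<xi>"
    then have "standardizes r m \<nu> (\<xi> @ \<eta>) T' y"
      using supertableau_standardizes_iff[OF \<nu>(2) xe] by blast
    moreover have "shape T = \<nu>" "shape T' = \<nu>"
      using T(1) T' by (simp_all add: supertableaux_def)
    ultimately show "T' = T" using standardizes_unique_tableau[OF _ _ \<nu>(2)] T(2) by blast
  qed
  then show "tableau_of r \<nu> (\<xi>, \<eta>) y \<in> supertableaux \<nu> (\<xi>, \<eta>)"
    "standardizes r m \<nu> (\<xi> @ \<eta>) (tableau_of r \<nu> (\<xi>, \<eta>) y) y"
    using T by simp_all
qed

text \<open>A supertableau has exactly one standardizing permutation, and that permutation
  determines the entry of every cell.\<close>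

lemma bij_tableau_of:
  assumes \<nu>: "is_partition \<nu>" "sum_list \<nu> = r" and xe: "xe \<in> bicompositions m n r"
  shows "bij_betw (tableau_of r \<nu> xe) (cell_elements r m \<nu> (fst xe @ snd xe)) (supertableaux \<nu> xe)"
proof -
  obtain \<xi> \<eta> where [simp]: "xe = (\<xi>, \<eta>)" by (cases xe)
  note xe' = xe[simplified]
  have sums: "sum_list (\<xi> @ \<eta>) = r" "length \<xi> = m"
    using xe' by (auto simp: bicompositions_def compositions_def)
  have ex1: "\<exists>!y. standardizes r m \<nu> (\<xi> @ \<eta>) T y" if "T \<in> supertableaux \<nu> (\<xi>, \<eta>)" for T
    using that unfolding supertableaux_iff[OF sums(2)] by (intro standardizes_ex1[OF \<nu>(2) sums(1)]) blast+
  show ?thesis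
    unfolding \<open>xe = (\<xi>, \<eta>)\<close> fst_conv snd_conv
  proof (rule bij_betw_imageI)
    show "inj_on (tableau_of r \<nu> (\<xi>, \<eta>)) (cell_elements r m \<nu> (\<xi> @ \<eta>))"
    proof (rule inj_onI)
      fix y y'
      assume y: "y \<in> cell_elements r m \<nu> (\<xi> @ \<eta>)" and y': "y' \<in> cell_elements r m \<nu> (\<xi> @ \<eta>)"
        and eq: "tableau_of r \<nu> (\<xi>, \<eta>) y = tableau_of r \<nu> (\<xi>, \<eta>) y'"
      show "y = y'"
        using ex1[OF tableau_of_standardizes(1)[OF \<nu> xe' y]] tableau_of_standardizes(2)[OF \<nu> xe' y]
          tableau_of_standardizes(2)[OF \<nu> xe' y'] unfolding eq by blast
    qed
    show "tableau_of r \<nu> (\<xi>, \<eta>) ` cell_elements r m \<nu> (\<xi> @ \<eta>) = supertableaux \<nu> (\<xi>, \<eta>)"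
    proof (intro equalityI subsetI)
      fix T assume T: "T \<in> supertableaux \<nu> (\<xi>, \<eta>)"
      then obtain y where y: "standardizes r m \<nu> (\<xi> @ \<eta>) T y" using ex1 by blast
      then have mem: "y \<in> cell_elements r m \<nu> (\<xi> @ \<eta>)"
        using std_array_of_supertableau[OF \<nu> xe' T y] by (simp add: cell_elements_def standardizes_def)
      have "shape T = \<nu>" "shape (tableau_of r \<nu> (\<xi>, \<eta>) y) = \<nu>"
        using T tableau_of_standardizes(1)[OF \<nu> xe' mem] by (simp_all add: supertableaux_def)
      then have "T = tableau_of r \<nu> (\<xi>, \<eta>) y"
        using standardizes_unique_tableau[OF _ _ \<nu>(2) y tableau_of_standardizes(2)[OF \<nu> xe' mem]] by blast
      then show "T \<in> tableau_of r \<nu> (\<xi>, \<eta>) ` cell_elements r m \<nu> (\<xi> @ \<eta>)" using mem by blast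
    qed (use tableau_of_standardizes(1)[OF \<nu> xe'] in blast)
  qed
qed

section \<open>The two factors of a permutation\<close>

lemma col_array_cong:
  assumes "is_partition \<nu>" "\<And>b a. a < part \<nu> b \<Longrightarrow> f b a = g b a"
  shows "col_array (part \<nu>) f = col_array (part \<nu>) g"
  unfolding col_array_def using columns.less_col_length[OF columns_part[OF assms(1)]] assms(2)
  by (intro map_cong refl) simp

lemma shape_col_array: "is_partition \<nu> \<Longrightarrow> shape (col_array (part \<nu>) f) = dual_partition \<nu>"
  by (rule nth_equalityI) (simp_all add: shape_def col_array_def dual_col_length)

lemma cell_partition_props:
  assumes w: "w permutes {1..r}"
  shows "is_partition (cell_partition r w)" "sum_list (cell_partition r w) = r"
    "dual_partition (cell_partition r w) = shape (fst (RS r w))"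
    "cell_partition r (pinv w) = cell_partition r w"
proof -
  have \<kappa>: "is_partition (shape (fst (RS r w)))" "sum_list (shape (fst (RS r w))) = r"
    using shape_in_partitions[OF w] by (simp_all add: partitions_iff)
  then show "is_partition (cell_partition r w)" "sum_list (cell_partition r w) = r"
    "dual_partition (cell_partition r w) = shape (fst (RS r w))"
    by (simp_all add: cell_partition_def P_tableau_def is_partition_dual sum_list_dual dual_dual)
  have "shape (fst (RS r (pinv w))) = shape (fst (RS r w))"
    using Q_eq_P_inv[OF w] shape_RS[of r w] by simp
  then show "cell_partition r (pinv w) = cell_partition r w"
    by (simp add: cell_partition_def P_tableau_def)
qed

lemma tab_Q:
  assumes w: "w permutes {1..r}"
  shows "tab (snd (RS r w))" "distinct (concat (snd (RS r w)))" "set (concat (snd (RS r w))) = {1..r}"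
  using RS_P[OF permutes_inj_on[OF permutes_inv[OF w]]] Q_eq_P_inv[OF w] Q_entries[of r w] by auto

lemma right_part_eqI:
  assumes "y permutes {1..r}" "fst (RS r y) = column_tableau (shape (fst (RS r w)))"
    "snd (RS r y) = snd (RS r w)"
  shows "right_part r w = y"
  unfolding right_part_def P_tableau_def Q_tableau_def
proof (rule the_equality)
  fix y' assume "y' permutes {1..r} \<and> fst (RS r y') = column_tableau (shape (fst (RS r w))) \<and>
    snd (RS r y') = snd (RS r w)"
  then show "y' = y" using assms by (intro RS_inject_permutes) (auto simp: prod_eq_iff)
qed (use assms in simp)

text \<open>The element is built by placing the value of each cell at the position named by the
  transpose of Q(w). Rows and columns of Q increase, so the positions form a
  \<open>std_array\<close>, and \<open>RS_std_array\<close> returns Q as recording tableau.\<close>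

lemma right_part_props:
  assumes w: "w permutes {1..r}"
  defines "y \<equiv> right_part r w" and "\<nu> \<equiv> cell_partition r w"
  shows "y permutes {1..r}" "snd (RS r y) = snd (RS r w)" "std_array \<nu> (positions \<nu> y)"
proof -
  have \<nu>: "is_partition \<nu>" "sum_list \<nu> = r" "dual_partition \<nu> = shape (fst (RS r w))"
    using cell_partition_props[OF w] by (simp_all add: \<nu>_def)
  define Q where "Q = snd (RS r w)"
  have Q: "tab Q" "distinct (concat Q)" "set (concat Q) = {1..r}" using tab_Q[OF w] by (simp_all add: Q_def)
  have shape: "shape Q = dual_partition \<nu>" using shape_RS[of r w] \<nu>(3) by (simp add: Q_def)
  have cell: "a < length Q \<and> b < length (Q ! a) \<longleftrightarrow> a < part \<nu> b" for a b
    using shape_part(3)[OF shape, of a b] part_dual[OF \<nu>(1), of b a] by simp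
  \<comment> \<open>The position of the value \<open>v\<close> is the entry of Q in the reflected
    cell, so \<open>z\<close> is the inverse of the required permutation.\<close>
  define z where "z v = (if v \<in> {1..r} then Q ! (psum \<nu> (Suc (blk \<nu> v)) - v) ! blk \<nu> v else v)" for v
  have z_cell: "z (cell_value \<nu> b a) = Q ! a ! b" if "a < part \<nu> b" for a b
  proof -
    have "cell_value \<nu> b a \<in> {1..r}" "blk \<nu> (cell_value \<nu> b a) = b"
      using cell_value_props[OF that] \<nu>(2) by simp_all
    moreover have "psum \<nu> (Suc b) - cell_value \<nu> b a = a"
      using that unfolding cell_value_def psum_part by simp
    ultimately show ?thesis by (simp add: z_def)
  qed
  have entry: "Q ! a ! b \<in> {1..r}" if "a < part \<nu> b" for a b
  proof -
    have "Q ! a \<in> set Q" "Q ! a ! b \<in> set (Q ! a)" using that cell[of a b] by simp_all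
    then have "Q ! a ! b \<in> set (concat Q)" by auto
    then show ?thesis unfolding Q(3) .
  qed
  have "z ` {1..r} = {1..r}"
  proof (intro equalityI subsetI)
    fix x assume "x \<in> z ` {1..r}"
    then obtain v where v: "v \<in> {1..sum_list \<nu>}" "x = z v" using \<nu>(2) by auto
    show "x \<in> {1..r}"
      using z_cell[OF cell_value_exists(2)[OF v(1)]] entry[OF cell_value_exists(2)[OF v(1)]]
        cell_value_exists(1)[OF v(1)] v(2) by simp
  next
    fix x assume "x \<in> {1..r}"
    then have "x \<in> set (concat Q)" using Q(3) by simp
    then obtain a b where "a < length Q" "b < length (Q ! a)" "x = Q ! a ! b"
      by (auto simp: in_set_conv_nth)
    then have ab: "a < part \<nu> b" "x = Q ! a ! b" using cell by blast+
    then have "x = z (cell_value \<nu> b a)" using z_cell by simp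
    then show "x \<in> z ` {1..r}" using cell_value_props(1)[OF ab(1)] \<nu>(2) by blast
  qed
  then have "bij_betw z {1..r} {1..r}" by (simp add: bij_betw_def eq_card_imp_inj_on)
  then have z: "z permutes {1..r}"
    by (rule bij_imp_permutes) (simp only: z_def if_not_P if_False)
  define y0 where "y0 = pinv z"
  have y0: "y0 permutes {1..r}" and inv: "pinv y0 = z"
    using permutes_inv[OF z] permutes_inv_inv[OF z] by (simp_all add: y0_def)
  have std: "std_array \<nu> (positions \<nu> y0)"
    unfolding std_array_def inv
  proof (intro conjI allI impI)
    fix b a assume a: "Suc a < part \<nu> b"
    then have "Q ! a ! b < Q ! Suc a ! b"
      using tab_nth[OF Q(1), of a] cell[of "Suc a" b] cell[of a b] by simp
    then show "z (cell_value \<nu> b a) < z (cell_value \<nu> b (Suc a))" using a by (simp add: z_cell)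
  next
    fix b a assume a: "a < part \<nu> (Suc b)"
    then have a': "a < part \<nu> b" using part_antimono[OF \<nu>(1), of b "Suc b"] by simp
    have "sorted_wrt (<) (Q ! a)" "Suc b < length (Q ! a)"
      using tab_nth[OF Q(1), of a] cell[of a "Suc b"] a by simp_all
    then have "Q ! a ! b < Q ! a ! Suc b" by (rule sorted_wrt_nth_less[OF _ lessI])
    then show "z (cell_value \<nu> b a) < z (cell_value \<nu> (Suc b) a)" using a a' by (simp add: z_cell)
  qed
  have cong: "col_array (part \<nu>) (positions \<nu> y0) = col_array (part \<nu>) (\<lambda>b a. Q ! a ! b)"
    unfolding inv by (rule col_array_cong[OF \<nu>(1)]) (rule z_cell)
  have "\<nu> \<in> partitions r" using \<nu>(1,2) by (simp add: partitions_iff)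
  then have "RS r y0 = (col_array (part \<nu>) (\<lambda>b a. psum \<nu> b + 1 + a), col_array (part \<nu>) (positions \<nu> y0))"
    by (rule RS_std_array[OF _ y0 std])
  then have "RS r y0 = (column_tableau (shape (fst (RS r w))), Q)"
    unfolding cong col_array_of_tableau[OF \<nu>(1) shape] column_tableau_dual[OF \<nu>(1), symmetric] \<nu>(3) .
  then have RS: "RS r y0 = (column_tableau (shape (fst (RS r w))), snd (RS r w))"
    unfolding Q_def .
  have eq: "y = y0"
    unfolding y_def by (rule right_part_eqI[OF y0]) (simp_all only: RS fst_conv snd_conv)
  show "y permutes {1..r}" "std_array \<nu> (positions \<nu> y)"
    unfolding eq by (rule y0, rule std)
  show "snd (RS r y) = snd (RS r w)"
    unfolding eq by (simp only: RS snd_conv)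
qed

text \<open>Inversion exchanges P and Q, so the conditions on \<open>pinv x\<close> are those
  defining the right part of \<open>pinv w\<close>. From here on only right parts have to be
  studied.\<close>

lemma left_part_eq:
  assumes w: "w permutes {1..r}"
  shows "left_part r w = right_part r (pinv w)"
proof -
  have sym: "fst (RS r (pinv x)) = snd (RS r x)" "snd (RS r (pinv x)) = fst (RS r x)" if "x permutes {1..r}" for x
    using Q_eq_P_inv[OF that] Q_eq_P_inv[OF permutes_inv[OF that]]
    unfolding permutes_inv_inv[OF that] by (simp_all only:)
  have "x permutes {1..r} \<and> P_tableau r (pinv x) = P_tableau r w \<and>
        Q_tableau r (pinv x) = column_tableau (shape (P_tableau r w)) \<longleftrightarrow>
      x permutes {1..r} \<and> P_tableau r x = column_tableau (shape (P_tableau r (pinv w))) \<and>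
        Q_tableau r x = Q_tableau r (pinv w)" for x
  proof (cases "x permutes {1..r}")
    case True
    then show ?thesis
      unfolding P_tableau_def Q_tableau_def sym[OF True] sym[OF w] shape_RS[of r w] by blast
  qed blast
  then show ?thesis unfolding left_part_def right_part_def by (simp only:)
qed

text \<open>In the form of \<open>super_mono_adjacent\<close> the condition only asks which
  neighbours are descents.\<close>

lemma super_mono_same_Q:
  assumes "sum_list \<rho> = r" "w permutes {1..r}" "y permutes {1..r}" "snd (RS r w) = snd (RS r y)"
  shows "super_mono m \<rho> w \<longleftrightarrow> super_mono m \<rho> y"
proof -
  have asc: "w k < w (Suc k) \<longleftrightarrow> y k < y (Suc k)" if "1 \<le> k" "k < r" for k
    using same_Q_same_descents[OF assms(4) permutes_inj_on[OF assms(2)] permutes_inj_on[OF assms(3)] that] .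
  have desc: "u (Suc k) < u k \<longleftrightarrow> \<not> u k < u (Suc k)" if "u permutes {1..r}" for u k
  proof -
    have "u k \<noteq> u (Suc k)" using permutes_inj[OF that] by (metis injD n_not_Suc_n)
    then show ?thesis by linarith
  qed
  show ?thesis
    unfolding super_mono_adjacent[OF assms(1)] desc[OF assms(2)] desc[OF assms(3)] using asc by auto
qed

section \<open>Matrices and double cosets\<close>

definition meets :: "nat list \<Rightarrow> nat list \<Rightarrow> (nat \<Rightarrow> nat) \<Rightarrow> nat \<Rightarrow> nat \<Rightarrow> nat" where
  "meets \<rho> \<sigma> w i j = card (row_block \<rho> i \<inter> w ` row_block \<sigma> j)"

lemma meets_eq:
  assumes "sum_list \<rho> = r" "sum_list \<sigma> = r" "w permutes {1..r}" "i < length \<rho>" "j < length \<sigma>"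
  shows "meets \<rho> \<sigma> w i j = card {v \<in> {1..r}. blk \<rho> v = i \<and> blk \<sigma> (pinv w v) = j}"
proof -
  have "row_block \<rho> i \<inter> w ` row_block \<sigma> j = {v \<in> {1..r}. blk \<rho> v = i \<and> blk \<sigma> (pinv w v) = j}" (is "?L = ?R")
  proof (intro equalityI subsetI)
    fix v assume "v \<in> ?L"
    then show "v \<in> ?R"
      using assms(1,2) by (auto simp: row_block_blk assms(4,5) permutes_inverses(2)[OF assms(3)])
  next
    fix v assume v: "v \<in> ?R"
    then have "v = w (pinv w v)" "pinv w v \<in> {1..r}"
      using permutes_inverses(1)[OF assms(3), of v] permutes_mem[OF permutes_inv[OF assms(3)], of v] by simp_all
    then have "v \<in> w ` row_block \<sigma> j"
      using v assms(2) by (intro image_eqI[of _ _ "pinv w v"]) (simp_all add: row_block_blk assms(5))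
    then show "v \<in> ?L" using v assms(1) by (simp add: row_block_blk assms(4))
  qed
  then show ?thesis by (simp add: meets_def)
qed

lemma meets_inv:
  assumes "w permutes {1..r}"
  shows "meets \<sigma> \<rho> (pinv w) j i = meets \<rho> \<sigma> w i j"
proof -
  have "w ` (row_block \<sigma> j \<inter> pinv w ` row_block \<rho> i) = row_block \<rho> i \<inter> w ` row_block \<sigma> j"
    by (simp add: image_Int[OF permutes_inj[OF assms]] image_image permutes_inverses(1)[OF assms] Int_commute)
  then show ?thesis
    unfolding meets_def using card_image[OF permutes_inj_on[OF assms]] by metis
qed

lemma card_fibers:
  assumes "finite S" "finite I" "f ` S \<subseteq> I"
  shows "(\<Sum>i\<in>I. card {x \<in> S. f x = i}) = card S"
  using sum.group[OF assms, of "\<lambda>_. 1::nat"] by simp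

lemma sum_meets:
  assumes "sum_list \<rho> = r" "sum_list \<sigma> = r" "w permutes {1..r}" "length \<rho> = N" "length \<sigma> = N"
  shows "i < N \<Longrightarrow> (\<Sum>j<N. meets \<rho> \<sigma> w i j) = \<rho> ! i"
    "j < N \<Longrightarrow> (\<Sum>i<N. meets \<rho> \<sigma> w i j) = \<sigma> ! j"
proof -
  have rows: "(\<Sum>j<N. meets \<rho> \<sigma> w i j) = \<rho> ! i"
    if "sum_list \<rho> = r" "sum_list \<sigma> = r" "w permutes {1..r}" "length \<rho> = N" "length \<sigma> = N" "i < N" for \<rho> \<sigma> w i
  proof -
    have "(\<lambda>v. blk \<sigma> (pinv w v)) ` {v \<in> {1..r}. blk \<rho> v = i} \<subseteq> {..<N}"
    proof (rule image_subsetI)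
      fix v assume "v \<in> {v \<in> {1..r}. blk \<rho> v = i}"
      then have "v \<in> {1..r}" by blast
      then have "pinv w v \<in> {1..r}" by (rule permutes_mem[OF permutes_inv[OF that(3)]])
      then show "blk \<sigma> (pinv w v) \<in> {..<N}" using blk_less_length[of "pinv w v" \<sigma>] that by simp
    qed
    from card_fibers[OF _ _ this]
    have "(\<Sum>j<N. card {v \<in> {v \<in> {1..r}. blk \<rho> v = i}. blk \<sigma> (pinv w v) = j}) = card {v \<in> {1..r}. blk \<rho> v = i}"
      by simp
    also have "\<dots> = \<rho> ! i" using card_blk[of i \<rho>] that by simp
    finally show ?thesis using that by (simp add: meets_eq conj_assoc)
  qed
  show "i < N \<Longrightarrow> (\<Sum>j<N. meets \<rho> \<sigma> w i j) = \<rho> ! i" using rows assms by blast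
  show "j < N \<Longrightarrow> (\<Sum>i<N. meets \<rho> \<sigma> w i j) = \<sigma> ! j"
    using rows[OF assms(2,1) permutes_inv[OF assms(3)] assms(5,4)] unfolding meets_inv[OF assms(3)] .
qed

text \<open>Two values common to a row block and a column block of different parity would have to
  keep their order by one side of the conditions and reverse it by the other.\<close>

lemma meets_mixed:
  assumes "sum_list \<rho> = r" "sum_list \<sigma> = r" "w permutes {1..r}" "i < length \<rho>" "j < length \<sigma>"
    and mono: "super_mono m \<sigma> w" "super_mono m \<rho> (pinv w)" and "(i < m) \<noteq> (j < m)"
  shows "meets \<rho> \<sigma> w i j \<le> 1"
proof (rule ccontr)
  let ?S = "{v \<in> {1..r}. blk \<rho> v = i \<and> blk \<sigma> (pinv w v) = j}"
  assume "\<not> meets \<rho> \<sigma> w i j \<le> 1"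
  then have "\<not> card ?S \<le> Suc 0" unfolding meets_eq[OF assms(1-5)] by simp
  moreover have "finite ?S" by simp
  ultimately obtain u u' where "u \<in> ?S" "u' \<in> ?S" "u \<noteq> u'"
    using card_le_Suc0_iff_eq[of ?S] by blast
  then obtain v v' where vv: "v \<in> ?S" "v' \<in> ?S" "v < v'"
    by (cases "u < u'") (auto simp: not_less order_le_less)
  have inv: "w (pinv w u) = u" for u by (rule permutes_inverses(1)[OF assms(3)])
  have range: "pinv w v \<in> {1..r}" "pinv w v' \<in> {1..r}"
    using vv permutes_mem[OF permutes_inv[OF assms(3)]] by blast+
  have r: "if i < m then pinv w v' < pinv w v else pinv w v < pinv w v'"
    using super_monoD[OF mono(2), of v v'] vv assms(1) by simp
  show False
  proof (cases "i < m")
    case True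
    then have "pinv w v' < pinv w v" "\<not> j < m" using r assms(8) by simp_all
    then have "v' < v"
      using super_monoD[OF mono(1), of "pinv w v'" "pinv w v"] range vv assms(2) by (simp add: inv)
    then show False using vv(3) by simp
  next
    case False
    then have "pinv w v < pinv w v'" "j < m" using r assms(8) by simp_all
    then have "v' < v"
      using super_monoD[OF mono(1), of "pinv w v" "pinv w v'"] range vv assms(2) by (simp add: inv)
    then show False using vv(3) by simp
  qed
qed

text \<open>The columns \<open>j\<close> with \<open>v \<in> w R\<^sub>j\<close>, for \<open>v\<close> running through the block \<open>R\<^sub>i\<close>, are weakly increasing or
  weakly decreasing according to the parity of \<open>i\<close>, and thus determined by the \<open>i\<close>-th row of the matrix.\<close>

definition column_of :: "nat \<Rightarrow> nat list \<Rightarrow> (nat \<Rightarrow> nat list) \<Rightarrow> nat \<Rightarrow> nat" where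
  "column_of m \<rho> mrow v = (let i = blk \<rho> v in
     if i < m then blk (mrow i) (psum \<rho> (Suc i) + 1 - v) else blk (mrow i) (v - psum \<rho> i))"

section \<open>Permutations with prescribed block intersections\<close>

context
  fixes m N r :: nat and \<rho> \<sigma> :: "nat list" and a :: "nat \<Rightarrow> nat \<Rightarrow> nat"
  assumes sum_\<rho>: "sum_list \<rho> = r" and sum_\<sigma>: "sum_list \<sigma> = r"
    and len_\<rho>: "length \<rho> = N" and len_\<sigma>: "length \<sigma> = N"
    and rows: "\<And>i. i < N \<Longrightarrow> (\<Sum>j<N. a i j) = \<rho> ! i"
    and cols: "\<And>j. j < N \<Longrightarrow> (\<Sum>i<N. a i j) = \<sigma> ! j"
    and mixed: "\<And>i j. i < N \<Longrightarrow> j < N \<Longrightarrow> (i < m) \<noteq> (j < m) \<Longrightarrow> a i j \<le> 1"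
begin

abbreviation (input) mrow :: "nat \<Rightarrow> nat list" where
  "mrow i \<equiv> map (a i) [0..<N]"

lemma sum_row: "i < N \<Longrightarrow> sum_list (mrow i) = \<rho> ! i"
  using rows[of i] by (simp add: sum_list_sum_nth atLeast0LessThan)

text \<open>Counting within a block from its last or from its first point, the two directions in
  \<open>column_of\<close>.\<close>

lemma block_reindex:
  assumes i: "i < N"
  shows "card {v \<in> {1..r}. blk \<rho> v = i \<and> P (psum \<rho> (Suc i) + 1 - v)} = card {t \<in> {1..\<rho> ! i}. P t}"
    "card {v \<in> {1..r}. blk \<rho> v = i \<and> P (v - psum \<rho> i)} = card {t \<in> {1..\<rho> ! i}. P t}"
proof -
  have S: "psum \<rho> (Suc i) = psum \<rho> i + \<rho> ! i" using i len_\<rho> by (simp add: psum_Suc)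
  have mem: "v \<in> {1..r} \<and> blk \<rho> v = i \<longleftrightarrow> psum \<rho> i < v \<and> v \<le> psum \<rho> (Suc i)" for v
    using blk_eq_iff[of v \<rho> i] psum_le[of "Suc i" \<rho>] sum_\<rho> by auto
  have block: "{v \<in> {1..r}. blk \<rho> v = i \<and> R v} = {v. psum \<rho> i < v \<and> v \<le> psum \<rho> i + \<rho> ! i \<and> R v}" for R
    using mem unfolding S by blast
  have "bij_betw (\<lambda>v. psum \<rho> (Suc i) + 1 - v) {v \<in> {1..r}. blk \<rho> v = i \<and> P (psum \<rho> (Suc i) + 1 - v)}
      {t \<in> {1..\<rho> ! i}. P t}"
    unfolding block S by (rule bij_betw_byWitness[where f' = "\<lambda>t. psum \<rho> i + \<rho> ! i + 1 - t"]) auto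
  then show "card {v \<in> {1..r}. blk \<rho> v = i \<and> P (psum \<rho> (Suc i) + 1 - v)} = card {t \<in> {1..\<rho> ! i}. P t}"
    by (rule bij_betw_same_card)
  have "bij_betw (\<lambda>v. v - psum \<rho> i) {v \<in> {1..r}. blk \<rho> v = i \<and> P (v - psum \<rho> i)} {t \<in> {1..\<rho> ! i}. P t}"
    unfolding block by (rule bij_betw_byWitness[where f' = "\<lambda>t. psum \<rho> i + t"]) auto
  then show "card {v \<in> {1..r}. blk \<rho> v = i \<and> P (v - psum \<rho> i)} = card {t \<in> {1..\<rho> ! i}. P t}"
    by (rule bij_betw_same_card)
qed

lemma card_column_of:
  assumes i: "i < N" and j: "j < N"
  shows "card {v \<in> {1..r}. blk \<rho> v = i \<and> column_of m \<rho> mrow v = j} = a i j"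
proof -
  have "card {t \<in> {1..\<rho> ! i}. blk (mrow i) t = j} = a i j"
    using card_blk[of j "mrow i"] sum_row[OF i] j by simp
  moreover have "{v \<in> {1..r}. blk \<rho> v = i \<and> column_of m \<rho> mrow v = j} =
      (if i < m then {v \<in> {1..r}. blk \<rho> v = i \<and> blk (mrow i) (psum \<rho> (Suc i) + 1 - v) = j}
       else {v \<in> {1..r}. blk \<rho> v = i \<and> blk (mrow i) (v - psum \<rho> i) = j})"
    by (auto simp: column_of_def Let_def)
  ultimately show ?thesis
    using block_reindex[OF i, of "\<lambda>t. blk (mrow i) t = j"] by simp
qed

lemma in_block:
  assumes "v \<in> {1..r}"
  shows "blk \<rho> v < N" "psum \<rho> (blk \<rho> v) < v" "v \<le> psum \<rho> (Suc (blk \<rho> v))"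
    "psum \<rho> (Suc (blk \<rho> v)) = psum \<rho> (blk \<rho> v) + \<rho> ! blk \<rho> v"
proof -
  show b: "blk \<rho> v < N" using blk_less_length[of v \<rho>] assms sum_\<rho> len_\<rho> by simp
  show "psum \<rho> (blk \<rho> v) < v" "v \<le> psum \<rho> (Suc (blk \<rho> v))"
    using blk_eq_iff[of v \<rho> "blk \<rho> v"] assms sum_\<rho> by auto
  show "psum \<rho> (Suc (blk \<rho> v)) = psum \<rho> (blk \<rho> v) + \<rho> ! blk \<rho> v"
    using b len_\<rho> by (simp add: psum_Suc)
qed

lemma column_of_less:
  assumes v: "v \<in> {1..r}"
  shows "column_of m \<rho> mrow v < N"
proof -
  note b = in_block[OF v]
  have "blk (mrow (blk \<rho> v)) t < N" if "1 \<le> t" "t \<le> \<rho> ! blk \<rho> v" for t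
    using blk_less_length[of t "mrow (blk \<rho> v)"] that sum_row[OF b(1)] by simp
  then show ?thesis using b by (simp add: column_of_def Let_def)
qed

lemma column_of_mono:
  assumes "v \<in> {1..r}" "v' \<in> {1..r}" "blk \<rho> v = blk \<rho> v'" "v < v'"
  shows "if blk \<rho> v < m then column_of m \<rho> mrow v' \<le> column_of m \<rho> mrow v
    else column_of m \<rho> mrow v \<le> column_of m \<rho> mrow v'"
proof -
  note b = in_block[OF assms(1)] in_block[OF assms(2)]
  have le: "blk (mrow (blk \<rho> v)) t \<le> blk (mrow (blk \<rho> v)) t'" if "t \<le> t'" "t' \<le> \<rho> ! blk \<rho> v" for t t'
    using blk_mono[OF that(1), of "mrow (blk \<rho> v)"] that sum_row[OF b(1)] by simp
  show ?thesis
  proof (cases "blk \<rho> v < m")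
    case True
    have "blk (mrow (blk \<rho> v)) (psum \<rho> (Suc (blk \<rho> v)) + 1 - v') \<le> blk (mrow (blk \<rho> v)) (psum \<rho> (Suc (blk \<rho> v)) + 1 - v)"
      using b assms(3,4) by (intro le) auto
    then show ?thesis using True assms(3) by (simp add: column_of_def Let_def)
  next
    case False
    have "blk (mrow (blk \<rho> v)) (v - psum \<rho> (blk \<rho> v)) \<le> blk (mrow (blk \<rho> v)) (v' - psum \<rho> (blk \<rho> v))"
      using b assms(3,4) by (intro le) auto
    then show ?thesis using False assms(3) by (simp add: column_of_def Let_def)
  qed
qed

text \<open>Along a row block the column blocks of the positions are monotone, because
  \<open>pinv w\<close> is, and a row of the matrix prescribes their multiplicities. Enumerated in
  the increasing direction, they form the block function of that row by
  \<open>blk_unique\<close>.\<close>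

lemma column_of_unique:
  assumes w: "w permutes {1..r}" and mono: "super_mono m \<rho> (pinv w)"
    and meets: "\<And>i j. i < N \<Longrightarrow> j < N \<Longrightarrow> meets \<rho> \<sigma> w i j = a i j" and v: "v \<in> {1..r}"
  shows "blk \<sigma> (pinv w v) = column_of m \<rho> mrow v"
proof -
  define i where "i = blk \<rho> v"
  note b = in_block[OF v, folded i_def]
  let ?c = "\<lambda>v. blk \<sigma> (pinv w v)"
  have mem: "u \<in> {1..r} \<and> blk \<rho> u = i \<longleftrightarrow> psum \<rho> i < u \<and> u \<le> psum \<rho> (Suc i)" for u
    using blk_eq_iff[of u \<rho> i] psum_le[of "Suc i" \<rho>] sum_\<rho> by auto
  have c_less: "?c u < N" if "u \<in> {1..r}" for u
    using blk_less_length[of "pinv w u" \<sigma>] permutes_mem[OF permutes_inv[OF w] that] sum_\<sigma> len_\<sigma> by simp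
  have c_mono: "if i < m then ?c u' \<le> ?c u else ?c u \<le> ?c u'"
    if "u < u'" "psum \<rho> i < u" "u' \<le> psum \<rho> (Suc i)" for u u'
  proof -
    have u: "u \<in> {1..r}" "blk \<rho> u = i" "u' \<in> {1..r}" "blk \<rho> u' = i"
      using mem[of u] mem[of u'] that by auto
    have "if i < m then pinv w u' < pinv w u else pinv w u < pinv w u'"
      using super_monoD[OF mono, of u u'] u that(1) sum_\<rho> by simp
    moreover have "pinv w u \<le> r" "pinv w u' \<le> r"
      using permutes_mem[OF permutes_inv[OF w] u(1)] permutes_mem[OF permutes_inv[OF w] u(3)] by simp_all
    ultimately show ?thesis
      using blk_mono[of "pinv w u" "pinv w u'" \<sigma>] blk_mono[of "pinv w u'" "pinv w u" \<sigma>] sum_\<sigma>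
      by (simp split: if_splits)
  qed
  have count: "card {u \<in> {1..r}. blk \<rho> u = i \<and> ?c u = j} = mrow i ! j" if "j < length (mrow i)" for j
    using meets[of i j] meets_eq[OF sum_\<rho> sum_\<sigma> w, of i j] b(1) that len_\<rho> len_\<sigma> by simp
  show ?thesis
  proof (cases "i < m")
    case True
    \<comment> \<open>An even block is enumerated from its last point, because the column indices
      decrease along it.\<close>
    let ?f = "\<lambda>t. ?c (psum \<rho> (Suc i) + 1 - t)"
    have "?f (psum \<rho> (Suc i) + 1 - v) = blk (mrow i) (psum \<rho> (Suc i) + 1 - v)"
    proof (rule blk_unique[OF sum_row[OF b(1)], where f = ?f])
      fix p q :: nat assume pq: "1 \<le> p" "p \<le> q" "q \<le> \<rho> ! i"
      show "?f p \<le> ?f q"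
      proof (cases "p = q")
        case False
        then have "psum \<rho> (Suc i) + 1 - q < psum \<rho> (Suc i) + 1 - p" "psum \<rho> i < psum \<rho> (Suc i) + 1 - q"
            "psum \<rho> (Suc i) + 1 - p \<le> psum \<rho> (Suc i)"
          using pq b(4) by linarith+
        from c_mono[OF this] True show ?thesis by simp
      qed simp
    next
      fix j assume j: "j < length (mrow i)"
      have "{u \<in> {1..r}. blk \<rho> u = i \<and> ?c u = j} =
          {u \<in> {1..r}. blk \<rho> u = i \<and> ?f (psum \<rho> (Suc i) + 1 - u) = j}"
      proof (intro Collect_cong conj_cong refl)
        fix u assume "u \<in> {1..r}" "blk \<rho> u = i"
        then have "psum \<rho> (Suc i) + 1 - (psum \<rho> (Suc i) + 1 - u) = u" using mem[of u] by linarith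
        then show "(?c u = j) = (?f (psum \<rho> (Suc i) + 1 - u) = j)" by (simp only:)
      qed
      then show "card {t \<in> {1..\<rho> ! i}. ?f t = j} = mrow i ! j"
        using count[OF j] block_reindex(1)[OF b(1), of "\<lambda>t. ?f t = j"] by simp
    next
      fix t assume "1 \<le> t" "t \<le> \<rho> ! i"
      then have "psum \<rho> (Suc i) + 1 - t \<in> {1..r}" using mem[of "psum \<rho> (Suc i) + 1 - t"] b by auto
      then show "?f t < length (mrow i)" using c_less by simp
    qed (use b in auto)
    then show ?thesis using True b by (simp add: column_of_def Let_def i_def[symmetric])
  next
    case False
    let ?f = "\<lambda>t. ?c (psum \<rho> i + t)"
    have "?f (v - psum \<rho> i) = blk (mrow i) (v - psum \<rho> i)"
    proof (rule blk_unique[OF sum_row[OF b(1)], where f = ?f])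
      fix p q :: nat assume pq: "1 \<le> p" "p \<le> q" "q \<le> \<rho> ! i"
      show "?f p \<le> ?f q"
      proof (cases "p = q")
        case ne: False
        then have "psum \<rho> i + p < psum \<rho> i + q" "psum \<rho> i < psum \<rho> i + p" "psum \<rho> i + q \<le> psum \<rho> (Suc i)"
          using pq b(4) by linarith+
        from c_mono[OF this] False show ?thesis by simp
      qed simp
    next
      fix j assume j: "j < length (mrow i)"
      have "{u \<in> {1..r}. blk \<rho> u = i \<and> ?c u = j} =
          {u \<in> {1..r}. blk \<rho> u = i \<and> ?f (u - psum \<rho> i) = j}"
      proof (intro Collect_cong conj_cong refl)
        fix u assume "u \<in> {1..r}" "blk \<rho> u = i"
        then have "psum \<rho> i + (u - psum \<rho> i) = u" using mem[of u] by linarith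
        then show "(?c u = j) = (?f (u - psum \<rho> i) = j)" by (simp only:)
      qed
      then show "card {t \<in> {1..\<rho> ! i}. ?f t = j} = mrow i ! j"
        using count[OF j] block_reindex(2)[OF b(1), of "\<lambda>t. ?f t = j"] by simp
    next
      fix t assume "1 \<le> t" "t \<le> \<rho> ! i"
      then have "psum \<rho> i + t \<in> {1..r}" using mem[of "psum \<rho> i + t"] b by auto
      then show "?f t < length (mrow i)" using c_less by simp
    qed (use b in auto)
    then show ?thesis using False b by (simp add: column_of_def Let_def i_def[symmetric])
  qed
qed

lemma sorting_column_of:
  "\<exists>!w. w permutes {1..r} \<and> super_mono m \<sigma> w \<and> (\<forall>p\<in>{1..r}. column_of m \<rho> mrow (w p) = blk \<sigma> p)"
proof (rule sorting_permutation[OF sum_\<sigma>])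
  fix j assume "j < length \<sigma>"
  then have j: "j < N" using len_\<sigma> by simp
  have "(\<Sum>i<N. card {v \<in> {v \<in> {1..r}. column_of m \<rho> mrow v = j}. blk \<rho> v = i}) =
      card {v \<in> {1..r}. column_of m \<rho> mrow v = j}"
    by (rule card_fibers) (use in_block(1) in auto)
  moreover have "{v \<in> {v \<in> {1..r}. column_of m \<rho> mrow v = j}. blk \<rho> v = i} =
      {v \<in> {1..r}. blk \<rho> v = i \<and> column_of m \<rho> mrow v = j}" for i by blast
  ultimately show "card {v \<in> {1..r}. column_of m \<rho> mrow v = j} = \<sigma> ! j"
    using card_column_of[OF _ j] cols[OF j] by simp
next
  show "v \<in> {1..r} \<Longrightarrow> column_of m \<rho> mrow v < length \<sigma>" for v
    using column_of_less len_\<sigma> by simp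
qed

text \<open>Sorting by \<open>column_of\<close> secures the condition on \<open>w\<close>, and
  monotonicity gives the one on \<open>pinv w\<close> between different columns. Inside a single
  matrix entry the two conditions agree if the parities agree; otherwise the entry is at most 1 and
  leaves no pair to compare.\<close>

lemma permutation_of_matrix:
  "\<exists>!w. (w permutes {1..r} \<and> super_mono m \<rho> (pinv w) \<and> super_mono m \<sigma> w) \<and>
     (\<forall>i<N. \<forall>j<N. a i j = meets \<rho> \<sigma> w i j)"
proof (rule ex_ex1I)
  obtain w where w: "w permutes {1..r}" "super_mono m \<sigma> w" "\<forall>p\<in>{1..r}. column_of m \<rho> mrow (w p) = blk \<sigma> p"
    using sorting_column_of by blast
  have inv: "w (pinv w u) = u" for u by (rule permutes_inverses(1)[OF w(1)])
  have range: "pinv w v \<in> {1..r}" if "v \<in> {1..r}" for v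
    by (rule permutes_mem[OF permutes_inv[OF w(1)] that])
  have col: "column_of m \<rho> mrow v = blk \<sigma> (pinv w v)" if "v \<in> {1..r}" for v
    using w(3) range[OF that] inv[of v] by metis
  have meets: "a i j = meets \<rho> \<sigma> w i j" if "i < N" "j < N" for i j
  proof -
    have "{v \<in> {1..r}. blk \<rho> v = i \<and> blk \<sigma> (pinv w v) = j} =
        {v \<in> {1..r}. blk \<rho> v = i \<and> column_of m \<rho> mrow v = j}"
      using col by auto
    then show ?thesis
      using meets_eq[OF sum_\<rho> sum_\<sigma> w(1), of i j] card_column_of[OF that] that len_\<rho> len_\<sigma> by simp
  qed
  have "super_mono m \<rho> (pinv w)"
    unfolding super_mono_def
  proof (intro allI impI)
    fix v v' assume vv: "1 \<le> v \<and> v < v' \<and> v' \<le> sum_list \<rho> \<and> blk \<rho> v = blk \<rho> v'"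
    then have v: "v \<in> {1..r}" "v' \<in> {1..r}" using sum_\<rho> by auto
    define i where "i = blk \<rho> v"
    let ?j = "blk \<sigma> (pinv w v)" and ?j' = "blk \<sigma> (pinv w v')"
    have ord: "if i < m then ?j' \<le> ?j else ?j \<le> ?j'"
      using column_of_mono[OF v] vv unfolding col[OF v(1)] col[OF v(2)] i_def by blast
    have strict: "p < q" if "blk \<sigma> p < blk \<sigma> q" "p \<in> {1..r}" "q \<in> {1..r}" for p q
      using blk_mono[of q p \<sigma>] that sum_\<sigma> by (cases "p < q") auto
    have ne: "pinv w v \<noteq> pinv w v'" using inv vv by (metis less_irrefl)
    show "if blk \<rho> v < m then pinv w v' < pinv w v else pinv w v < pinv w v'"
    proof (cases "?j = ?j'")
      case False
      then show ?thesis
        using ord strict[of "pinv w v" "pinv w v'"] strict[of "pinv w v'" "pinv w v"] range[OF v(1)] range[OF v(2)]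
        by (auto simp: i_def[symmetric] split: if_splits)
    next
      case True
      have i: "i < N" and j: "?j < N"
        using in_block(1)[OF v(1)] column_of_less[OF v(1)] col[OF v(1)] by (simp_all add: i_def)
      \<comment> \<open>Both values are counted by the entry \<open>a i ?j\<close>, which is then at
        least 2, so the parities must agree.\<close>
      have "{v, v'} \<subseteq> {u \<in> {1..r}. blk \<rho> u = i \<and> column_of m \<rho> mrow u = ?j}"
        using v vv True col by (simp add: i_def)
      then have "card {v, v'} \<le> a i ?j"
        unfolding card_column_of[OF i j, symmetric] by (intro card_mono) auto
      then have "(i < m) = (?j < m)" using mixed[OF i j] vv by fastforce
      moreover have "v' < v" if "pinv w v < pinv w v'" "?j < m"
        using super_monoD[OF w(2), of "pinv w v" "pinv w v'"] that True range[OF v(1)] range[OF v(2)] sum_\<sigma>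
        by (simp add: inv)
      moreover have "v' < v" if "pinv w v' < pinv w v" "\<not> ?j < m"
        using super_monoD[OF w(2), of "pinv w v'" "pinv w v"] that True range[OF v(1)] range[OF v(2)] sum_\<sigma>
        by (simp add: inv)
      ultimately show ?thesis using vv ne unfolding i_def by (metis less_asym' linorder_neqE_nat)
    qed
  qed
  then show "\<exists>w. (w permutes {1..r} \<and> super_mono m \<rho> (pinv w) \<and> super_mono m \<sigma> w) \<and>
      (\<forall>i<N. \<forall>j<N. a i j = meets \<rho> \<sigma> w i j)"
    using w meets by blast
next
  have char: "w permutes {1..r} \<and> super_mono m \<sigma> w \<and> (\<forall>p\<in>{1..r}. column_of m \<rho> mrow (w p) = blk \<sigma> p)"
    if "(w permutes {1..r} \<and> super_mono m \<rho> (pinv w) \<and> super_mono m \<sigma> w) \<and>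
      (\<forall>i<N. \<forall>j<N. a i j = meets \<rho> \<sigma> w i j)" for w
  proof -
    have w: "w permutes {1..r}" "super_mono m \<rho> (pinv w)" "super_mono m \<sigma> w"
        "\<And>i j. i < N \<Longrightarrow> j < N \<Longrightarrow> meets \<rho> \<sigma> w i j = a i j"
      using that by auto
    have "column_of m \<rho> mrow (w p) = blk \<sigma> p" if "p \<in> {1..r}" for p
      using column_of_unique[OF w(1,2,4) permutes_mem[OF w(1) that]] by (simp add: permutes_inverses(2)[OF w(1)])
    then show ?thesis using w by blast
  qed
  fix w w'
  assume "(w permutes {1..r} \<and> super_mono m \<rho> (pinv w) \<and> super_mono m \<sigma> w) \<and>
      (\<forall>i<N. \<forall>j<N. a i j = meets \<rho> \<sigma> w i j)"
    and "(w' permutes {1..r} \<and> super_mono m \<rho> (pinv w') \<and> super_mono m \<sigma> w') \<and>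
      (\<forall>i<N. \<forall>j<N. a i j = meets \<rho> \<sigma> w' i j)"
  then show "w = w'" using char[of w] char[of w'] sorting_column_of by blast
qed

end

section \<open>The correspondence\<close>

lemma bicompositions_append:
  assumes "lm \<in> bicompositions m n r"
  shows "length (fst lm @ snd lm) = m + n" "sum_list (fst lm @ snd lm) = r" "length (fst lm) = m"
  using assms by (auto simp: bicompositions_def compositions_def)

lemma double_coset_reps_mem:
  assumes "lm \<in> bicompositions m n r" "xe \<in> bicompositions m n r"
  shows "w \<in> double_coset_reps r lm xe \<longleftrightarrow> w permutes {1..r} \<and>
    super_mono m (fst lm @ snd lm) (pinv w) \<and> super_mono m (fst xe @ snd xe) w"
  using double_coset_reps_iff[of "fst lm" "snd lm" m n r "fst xe" "snd xe" w] assms by simp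

text \<open>A shape outside the hook contains the cell in row \<open>m\<close> and column
  \<open>n\<close>, counted from 0. Down the first column the entry of row \<open>m\<close> must
  exceed \<open>m\<close>; from there it grows strictly along the row, so that cell would need an
  entry above \<open>m + n\<close>.\<close>

lemma hook_partition_of_supertableau:
  assumes \<nu>: "\<nu> \<in> partitions r" and xe: "xe \<in> bicompositions m n r" and T: "T \<in> supertableaux \<nu> xe"
  shows "\<nu> \<in> hook_partitions m n r"
proof (rule ccontr)
  assume no: "\<nu> \<notin> hook_partitions m n r"
  have p: "is_partition \<nu>" using \<nu> by (simp add: partitions_iff)
  obtain \<xi> \<eta> where xe': "xe = (\<xi>, \<eta>)" by (cases xe)
  have len: "length \<xi> = m" "length (\<xi> @ \<eta>) = m + n" using bicompositions_append[OF xe] xe' by simp_all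
  have n: "n < part \<nu> m" using no \<nu> by (auto simp: hook_partitions_def part_def split: if_splits)
  have T': "shape T = \<nu>" "set (concat T) \<subseteq> {1..m + n}"
      "\<And>b a a'. a < part \<nu> b \<Longrightarrow> a' < a \<Longrightarrow> m < T ! b ! a' \<longrightarrow> T ! b ! a' < T ! b ! a"
      "\<And>b b' a. a < part \<nu> b \<Longrightarrow> b' < b \<Longrightarrow> T ! b ! a \<le> m \<longrightarrow> T ! b' ! a < T ! b ! a"
    using T unfolding xe' supertableaux_iff[OF len(1)] len(2) by blast+
  have entry: "1 \<le> T ! b ! a" "T ! b ! a \<le> m + n" if "a < part \<nu> b" for b a
  proof -
    have "b < length T" "a < length (T ! b)" using shape_part(3)[OF T'(1)] that by blast+
    then have "T ! b \<in> set T" "T ! b ! a \<in> set (T ! b)" by simp_all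
    then have "T ! b ! a \<in> set (concat T)" by auto
    then have "T ! b ! a \<in> {1..m + n}" using T'(2) by blast
    then show "1 \<le> T ! b ! a" "T ! b ! a \<le> m + n" by simp_all
  qed
  have col: "Suc b \<le> T ! b ! 0" if "b \<le> m" for b
    using that
  proof (induction b)
    case 0
    then show ?case using entry(1)[of 0 0] n part_antimono[OF p, of 0 m] by simp
  next
    case (Suc b)
    have "0 < part \<nu> (Suc b)" using n part_antimono[OF p Suc.prems] by simp
    then have "T ! Suc b ! 0 \<le> m \<longrightarrow> T ! b ! 0 < T ! Suc b ! 0" using T'(4)[of 0 "Suc b" b] by simp
    moreover have "Suc b \<le> T ! b ! 0" using Suc by simp
    ultimately show ?case using Suc.prems by linarith
  qed
  have row: "m + Suc a \<le> T ! m ! a" if "a \<le> n" for a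
    using that
  proof (induction a)
    case 0
    then show ?case using col[of m] by simp
  next
    case (Suc a)
    have "m < T ! m ! a \<longrightarrow> T ! m ! a < T ! m ! Suc a" using T'(3)[of "Suc a" m a] Suc.prems n by simp
    moreover have "m + Suc a \<le> T ! m ! a" using Suc by simp
    ultimately show ?case by linarith
  qed
  show False using row[of n] entry(2)[OF n] by simp
qed

lemma super_RS_eq:
  assumes "w permutes {1..r}"
  shows "super_RS r lm xe w = (tableau_of r (cell_partition r w) lm (right_part r (pinv w)),
    tableau_of r (cell_partition r w) xe (right_part r w))"
  by (simp add: super_RS_def left_part_eq[OF assms])

lemma right_part_in_cell_elements:
  assumes w: "w permutes {1..r}" and "sum_list \<rho> = r" "super_mono m \<rho> w"
  shows "right_part r w \<in> cell_elements r m (cell_partition r w) \<rho>"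
  using right_part_props[OF w] super_mono_same_Q[OF assms(2) w, of "right_part r w" m] assms(3)
  unfolding cell_elements_def mem_Collect_eq by metis

lemma cell_elements_RS:
  assumes \<nu>: "\<nu> \<in> partitions r" and y: "y \<in> cell_elements r m \<nu> \<rho>"
  shows "y permutes {1..r}" "fst (RS r y) = column_tableau (dual_partition \<nu>)"
    "shape (snd (RS r y)) = dual_partition \<nu>"
proof -
  have p: "is_partition \<nu>" using \<nu> by (simp add: partitions_iff)
  have y': "y permutes {1..r}" "std_array \<nu> (positions \<nu> y)"
    using y unfolding cell_elements_def by blast+
  then show "y permutes {1..r}" by blast
  have fst: "fst (RS r y) = col_array (part \<nu>) (\<lambda>b a. psum \<nu> b + 1 + a)"
    unfolding RS_std_array[OF \<nu> y'] by (rule fst_conv)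
  then show "fst (RS r y) = column_tableau (dual_partition \<nu>)"
    unfolding column_tableau_dual[OF p] .
  show "shape (snd (RS r y)) = dual_partition \<nu>"
    unfolding shape_RS fst by (rule shape_col_array[OF p])
qed

lemma same_right_part:
  assumes "w permutes {1..r}" "w' permutes {1..r}" "right_part r w = right_part r w'"
  shows "snd (RS r w) = snd (RS r w')"
  using right_part_props(2)[OF assms(1)] right_part_props(2)[OF assms(2)] assms(3) by simp

text \<open>A pair of supertableaux corresponds to cell elements x and y, these to Q(x) and Q(y),
  and these to the permutation w with P(w) = Q(x) and Q(w) = Q(y). The monotonicity conditions pass
  along, since each depends on a single recording tableau, that of w or of its inverse.\<close>

lemma bij_super_RS:
  assumes lm: "lm \<in> bicompositions m n r" and xe: "xe \<in> bicompositions m n r"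
  shows "bij_betw (super_RS r lm xe) (double_coset_reps r lm xe)
    (\<Union>\<nu> \<in> hook_partitions m n r. supertableaux \<nu> lm \<times> supertableaux \<nu> xe)"
proof (rule bij_betw_imageI)
  let ?L = "fst lm @ snd lm" and ?X = "fst xe @ snd xe"
  note D = double_coset_reps_mem[OF lm xe]
  have parts: "right_part r (pinv w) \<in> cell_elements r m (cell_partition r w) ?L"
      "right_part r w \<in> cell_elements r m (cell_partition r w) ?X"
    if "w \<in> double_coset_reps r lm xe" for w
  proof -
    have w: "w permutes {1..r}" "super_mono m ?L (pinv w)" "super_mono m ?X w" using that D by blast+
    show "right_part r (pinv w) \<in> cell_elements r m (cell_partition r w) ?L"
      using right_part_in_cell_elements[OF permutes_inv[OF w(1)] bicompositions_append(2)[OF lm] w(2)]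
      unfolding cell_partition_props(4)[OF w(1)] .
    show "right_part r w \<in> cell_elements r m (cell_partition r w) ?X"
      using right_part_in_cell_elements[OF w(1) bicompositions_append(2)[OF xe] w(3)] .
  qed
  have bij: "bij_betw (tableau_of r (cell_partition r w) le) (cell_elements r m (cell_partition r w) (fst le @ snd le))
      (supertableaux (cell_partition r w) le)"
    if "w permutes {1..r}" "le \<in> bicompositions m n r" for w le
    using bij_tableau_of[OF cell_partition_props(1,2)[OF that(1)] that(2)] .
  show "inj_on (super_RS r lm xe) (double_coset_reps r lm xe)"
  proof (rule inj_onI)
    fix w w' assume w: "w \<in> double_coset_reps r lm xe" and w': "w' \<in> double_coset_reps r lm xe"
      and eq: "super_RS r lm xe w = super_RS r lm xe w'"
    have perm: "w permutes {1..r}" "w' permutes {1..r}" using w w' D by blast+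
    let ?\<nu> = "cell_partition r w"
    have tabs: "tableau_of r ?\<nu> lm (right_part r (pinv w)) = tableau_of r (cell_partition r w') lm (right_part r (pinv w'))"
        "tableau_of r ?\<nu> xe (right_part r w) = tableau_of r (cell_partition r w') xe (right_part r w')"
      using eq unfolding super_RS_eq[OF perm(1)] super_RS_eq[OF perm(2)] by blast+
    \<comment> \<open>The shape of the second tableau reveals the cell, so two equal images can be
      compared inside a single one.\<close>
    have "shape (tableau_of r (cell_partition r u) xe (right_part r u)) = cell_partition r u"
      if "u \<in> double_coset_reps r lm xe" for u
    proof -
      have "u permutes {1..r}" using that D by blast
      then have "tableau_of r (cell_partition r u) xe (right_part r u) \<in> supertableaux (cell_partition r u) xe"
        using bij_betwE[OF bij[OF _ xe]] parts(2)[OF that] by blast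
      then show ?thesis by (auto simp: supertableaux_def split: prod.splits)
    qed
    from this[OF w] this[OF w'] have \<nu>: "cell_partition r w' = ?\<nu>" using tabs(2) by metis
    have "right_part r w = right_part r w'"
      by (rule inj_onD[OF bij_betw_imp_inj_on[OF bij[OF perm(1) xe]]])
        (use tabs(2) parts(2)[OF w] parts(2)[OF w'] in \<open>simp_all only: \<nu>\<close>)
    then have Q: "snd (RS r w) = snd (RS r w')" by (rule same_right_part[OF perm])
    have "right_part r (pinv w) = right_part r (pinv w')"
      by (rule inj_onD[OF bij_betw_imp_inj_on[OF bij[OF perm(1) lm]]])
        (use tabs(1) parts(1)[OF w] parts(1)[OF w'] in \<open>simp_all only: \<nu>\<close>)
    then have "snd (RS r (pinv w)) = snd (RS r (pinv w'))"
      by (rule same_right_part[OF permutes_inv[OF perm(1)] permutes_inv[OF perm(2)]])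
    then have "fst (RS r w) = fst (RS r w')"
      using Q_eq_P_inv[OF permutes_inv[OF perm(1)]] Q_eq_P_inv[OF permutes_inv[OF perm(2)]]
      unfolding permutes_inv_inv[OF perm(1)] permutes_inv_inv[OF perm(2)] by metis
    then show "w = w'" using Q by (intro RS_inject_permutes[OF perm] prod_eqI)
  qed
  show "super_RS r lm xe ` double_coset_reps r lm xe =
      (\<Union>\<nu> \<in> hook_partitions m n r. supertableaux \<nu> lm \<times> supertableaux \<nu> xe)"
  proof (intro equalityI subsetI)
    fix ST assume "ST \<in> super_RS r lm xe ` double_coset_reps r lm xe"
    then obtain w where w: "w \<in> double_coset_reps r lm xe" "ST = super_RS r lm xe w" by blast
    then have perm: "w permutes {1..r}" using D by blast
    let ?\<nu> = "cell_partition r w"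
    have mem: "tableau_of r ?\<nu> lm (right_part r (pinv w)) \<in> supertableaux ?\<nu> lm"
        "tableau_of r ?\<nu> xe (right_part r w) \<in> supertableaux ?\<nu> xe"
      using bij_betwE[OF bij[OF perm lm]] bij_betwE[OF bij[OF perm xe]] parts[OF w(1)] by blast+
    have "?\<nu> \<in> partitions r" using cell_partition_props[OF perm] by (simp add: partitions_iff)
    then have "?\<nu> \<in> hook_partitions m n r" using hook_partition_of_supertableau xe mem(2) by blast
    then show "ST \<in> (\<Union>\<nu> \<in> hook_partitions m n r. supertableaux \<nu> lm \<times> supertableaux \<nu> xe)"
      unfolding w(2) super_RS_eq[OF perm] using mem by blast
  next
    fix ST assume "ST \<in> (\<Union>\<nu> \<in> hook_partitions m n r. supertableaux \<nu> lm \<times> supertableaux \<nu> xe)"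
    then obtain \<nu> S T where ST: "ST = (S, T)" "\<nu> \<in> hook_partitions m n r" "S \<in> supertableaux \<nu> lm" "T \<in> supertableaux \<nu> xe"
      by blast
    have \<nu>: "\<nu> \<in> partitions r" using ST(2) by (simp add: hook_partitions_def)
    then have p: "is_partition \<nu>" "sum_list \<nu> = r" by (simp_all add: partitions_iff)
    obtain x where x: "x \<in> cell_elements r m \<nu> ?L" "S = tableau_of r \<nu> lm x"
      using bij_betw_imp_surj_on[OF bij_tableau_of[OF p lm]] ST(3) by blast
    obtain y where y: "y \<in> cell_elements r m \<nu> ?X" "T = tableau_of r \<nu> xe y"
      using bij_betw_imp_surj_on[OF bij_tableau_of[OF p xe]] ST(4) by blast
    note x' = cell_elements_RS[OF \<nu> x(1)] and y' = cell_elements_RS[OF \<nu> y(1)]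
    have shapes: "shape (snd (RS r x)) = shape (snd (RS r y))" unfolding x'(3) y'(3) ..
    obtain w where w: "w permutes {1..r}" "RS r w = (snd (RS r x), snd (RS r y))"
      using RS_surj_permutes[OF tab_Q(1)[OF x'(1)] tab_Q(1)[OF y'(1)] shapes tab_Q(2)[OF x'(1)]
          tab_Q(2)[OF y'(1)] tab_Q(3)[OF x'(1)] tab_Q(3)[OF y'(1)]] by blast
    have inv: "pinv w permutes {1..r}" using w(1) by (rule permutes_inv)
    have Qw: "snd (RS r w) = snd (RS r y)" and Pw: "fst (RS r w) = snd (RS r x)"
      unfolding w(2) by simp_all
    have Qinv: "snd (RS r (pinv w)) = snd (RS r x)"
      using Q_eq_P_inv[OF inv] unfolding permutes_inv_inv[OF w(1)] Pw .
    have Pinv: "fst (RS r (pinv w)) = snd (RS r y)"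
      using Q_eq_P_inv[OF w(1)] unfolding Qw by (rule sym)
    have cell: "cell_partition r w = \<nu>"
      unfolding cell_partition_def P_tableau_def Pw x'(3) by (rule dual_dual[OF p(1)])
    have right: "right_part r w = y"
      by (rule right_part_eqI[OF y'(1)]) (simp_all only: Pw Qw x'(3) y'(2))
    have left: "right_part r (pinv w) = x"
      by (rule right_part_eqI[OF x'(1)]) (simp_all only: Pinv Qinv y'(3) x'(2))
    have "super_mono m ?X w"
      using super_mono_same_Q[OF bicompositions_append(2)[OF xe] w(1) y'(1) Qw] y(1)
      unfolding cell_elements_def by blast
    moreover have "super_mono m ?L (pinv w)"
      using super_mono_same_Q[OF bicompositions_append(2)[OF lm] inv x'(1) Qinv] x(1)
      unfolding cell_elements_def by blast
    ultimately have "w \<in> double_coset_reps r lm xe" using D w(1) by blast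
    moreover have "super_RS r lm xe w = ST"
      unfolding super_RS_eq[OF w(1)] cell right left ST(1) x(2) y(2) ..
    ultimately show "ST \<in> super_RS r lm xe ` double_coset_reps r lm xe" by blast
  qed
qed

section \<open>From matrices to permutations and back\<close>

lemma row_col_sums:
  assumes A: "A \<in> super_matrices m n r"
  shows "row_sums m A \<in> bicompositions m n r" "col_sums m A \<in> bicompositions m n r"
    "i < m + n \<Longrightarrow> (fst (row_sums m A) @ snd (row_sums m A)) ! i = (\<Sum>j<m + n. A $$ (i, j))"
    "j < m + n \<Longrightarrow> (fst (col_sums m A) @ snd (col_sums m A)) ! j = (\<Sum>i<m + n. A $$ (i, j))"
proof -
  have dim: "dim_row A = m + n" "dim_col A = m + n" and total: "(\<Sum>i<m + n. \<Sum>j<m + n. A $$ (i, j)) = r"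
    using A by (auto simp: super_matrices_def)
  have "(\<Sum>j<m + n. \<Sum>i<m + n. A $$ (i, j)) = r" using total by (subst sum.swap)
  then show "row_sums m A \<in> bicompositions m n r" "col_sums m A \<in> bicompositions m n r"
    using total dim
    by (simp_all add: row_sums_def col_sums_def Let_def bicompositions_def compositions_def
        sum_list_sum_nth atLeast0LessThan)
  show "i < m + n \<Longrightarrow> (fst (row_sums m A) @ snd (row_sums m A)) ! i = (\<Sum>j<m + n. A $$ (i, j))"
    "j < m + n \<Longrightarrow> (fst (col_sums m A) @ snd (col_sums m A)) ! j = (\<Sum>i<m + n. A $$ (i, j))"
    using dim by (simp_all add: row_sums_def col_sums_def Let_def)
qed

lemma matrix_perm_ex1:
  assumes A: "A \<in> super_matrices m n r"
  defines "R \<equiv> fst (row_sums m A) @ snd (row_sums m A)" and "C \<equiv> fst (col_sums m A) @ snd (col_sums m A)"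
  shows "\<exists>!w. w \<in> double_coset_reps r (row_sums m A) (col_sums m A) \<and>
    (\<forall>i<m + n. \<forall>j<m + n. A $$ (i, j) = meets R C w i j)"
    and "w \<in> double_coset_reps r (row_sums m A) (col_sums m A) \<Longrightarrow>
      (\<And>i j. i < m + n \<Longrightarrow> j < m + n \<Longrightarrow> A $$ (i, j) = meets R C w i j) \<Longrightarrow> matrix_perm m r A = w"
    and "matrix_perm m r A \<in> double_coset_reps r (row_sums m A) (col_sums m A)"
    and "i < m + n \<Longrightarrow> j < m + n \<Longrightarrow> A $$ (i, j) = meets R C (matrix_perm m r A) i j"
proof -
  have dim: "dim_row A = m + n" "dim_col A = m + n"
    and "\<forall>i<m + n. \<forall>j<m + n. (i < m) \<noteq> (j < m) \<longrightarrow> A $$ (i, j) \<in> {0, 1}"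
    using A by (auto simp: super_matrices_def)
  then have mixed: "A $$ (i, j) \<le> 1" if "i < m + n" "j < m + n" "(i < m) \<noteq> (j < m)" for i j
    using that by fastforce
  note sums = row_col_sums[OF A]
  note R = bicompositions_append[OF sums(1), folded R_def] and C = bicompositions_append[OF sums(2), folded C_def]
  show ex1: "\<exists>!w. w \<in> double_coset_reps r (row_sums m A) (col_sums m A) \<and>
      (\<forall>i<m + n. \<forall>j<m + n. A $$ (i, j) = meets R C w i j)"
    unfolding double_coset_reps_mem[OF sums(1,2)] R_def[symmetric] C_def[symmetric]
    by (rule permutation_of_matrix[OF R(2) C(2) R(1) C(1)])
      (use sums(3,4) mixed in \<open>simp_all add: R_def C_def\<close>)
  have eq: "matrix_perm m r A = (THE w. w \<in> double_coset_reps r (row_sums m A) (col_sums m A) \<and>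
      (\<forall>i<m + n. \<forall>j<m + n. A $$ (i, j) = meets R C w i j))"
    unfolding matrix_perm_def dim meets_def R_def C_def by (simp add: case_prod_beta Let_def)
  show "matrix_perm m r A \<in> double_coset_reps r (row_sums m A) (col_sums m A)"
    "i < m + n \<Longrightarrow> j < m + n \<Longrightarrow> A $$ (i, j) = meets R C (matrix_perm m r A) i j"
    using theI'[OF ex1] unfolding eq[symmetric] by blast+
  then show "matrix_perm m r A = w" if "w \<in> double_coset_reps r (row_sums m A) (col_sums m A)"
      "\<And>i j. i < m + n \<Longrightarrow> j < m + n \<Longrightarrow> A $$ (i, j) = meets R C w i j"
    using the1_equality[OF ex1, of w] that unfolding eq by blast
qed

text \<open>The matrix of intersection numbers has the right sums by \<open>sum_meets\<close>, and
  its mixed entries are at most 1 by \<open>meets_mixed\<close>.\<close>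

lemma matrix_of_permutation:
  assumes lm: "lm \<in> bicompositions m n r" and xe: "xe \<in> bicompositions m n r"
    and w: "w \<in> double_coset_reps r lm xe"
  obtains A where "A \<in> super_matrices m n r" "row_sums m A = lm" "col_sums m A = xe" "matrix_perm m r A = w"
proof
  let ?R = "fst lm @ snd lm" and ?C = "fst xe @ snd xe"
  define A where "A = mat (m + n) (m + n) (\<lambda>(i, j). meets ?R ?C w i j)"
  note R = bicompositions_append[OF lm] and C = bicompositions_append[OF xe]
  have w': "w permutes {1..r}" "super_mono m ?R (pinv w)" "super_mono m ?C w"
    using w double_coset_reps_mem[OF lm xe] by blast+
  have entry: "A $$ (i, j) = meets ?R ?C w i j" if "i < m + n" "j < m + n" for i j
    using that by (simp add: A_def)
  have rows: "(\<Sum>j<m + n. A $$ (i, j)) = ?R ! i" if "i < m + n" for i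
    using sum_meets(1)[OF R(2) C(2) w'(1) R(1) C(1) that] entry[OF that] by simp
  have cols: "(\<Sum>i<m + n. A $$ (i, j)) = ?C ! j" if "j < m + n" for j
    using sum_meets(2)[OF R(2) C(2) w'(1) R(1) C(1) that] entry[OF _ that] by simp
  have "(\<Sum>i<m + n. \<Sum>j<m + n. A $$ (i, j)) = (\<Sum>i<m + n. ?R ! i)"
    using rows by (intro sum.cong) auto
  also have "\<dots> = r" using R(1,2) by (metis atLeast0LessThan sum_list_sum_nth)
  finally have total: "(\<Sum>i<m + n. \<Sum>j<m + n. A $$ (i, j)) = r" .
  have "A $$ (i, j) \<in> {0, 1}" if "i < m + n" "j < m + n" "(i < m) \<noteq> (j < m)" for i j
    using meets_mixed[OF R(2) C(2) w'(1) _ _ w'(3,2) that(3)] entry[OF that(1,2)] that R(1) C(1) by auto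
  then show A: "A \<in> super_matrices m n r"
    using total by (auto simp: super_matrices_def A_def)
  have split: "lm' = lm''" if "fst lm' @ snd lm' = fst lm'' @ snd lm''" "length (fst lm') = m" "length (fst lm'') = m"
    for lm' lm'' :: "nat list \<times> nat list"
    using that by (simp add: prod_eq_iff)
  note sums = row_col_sums[OF A]
  note R' = bicompositions_append[OF sums(1)] and C' = bicompositions_append[OF sums(2)]
  show row_eq: "row_sums m A = lm"
  proof (rule split[OF _ R'(3) R(3)], rule nth_equalityI)
    fix i assume "i < length (fst (row_sums m A) @ snd (row_sums m A))"
    then show "(fst (row_sums m A) @ snd (row_sums m A)) ! i = ?R ! i"
      using sums(3)[of i] rows[of i] R'(1) by simp
  qed (simp only: R(1) R'(1))
  show col_eq: "col_sums m A = xe"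
  proof (rule split[OF _ C'(3) C(3)], rule nth_equalityI)
    fix j assume "j < length (fst (col_sums m A) @ snd (col_sums m A))"
    then show "(fst (col_sums m A) @ snd (col_sums m A)) ! j = ?C ! j"
      using sums(4)[of j] cols[of j] C'(1) by simp
  qed (simp only: C(1) C'(1))
  show "matrix_perm m r A = w"
    by (rule matrix_perm_ex1(2)[OF A]) (use w entry in \<open>simp_all only: row_eq col_eq\<close>)
qed

text \<open>Makes the union over the contents disjoint: a tableau counts its own entries, and the
  common \<open>m\<close> says where to split the counts.\<close>

lemma content_unique:
  assumes "lm \<in> bicompositions m n r" "lm' \<in> bicompositions m n r"
    and "T \<in> supertableaux \<nu> lm" "T \<in> supertableaux \<nu>' lm'"
  shows "lm = lm'"
proof -
  note a = bicompositions_append[OF assms(1)] and b = bicompositions_append[OF assms(2)]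
  have count: "count_list (concat T) (Suc k) = (fst le @ snd le) ! k"
    if "T \<in> supertableaux \<kappa> le" "k < length (fst le @ snd le)" for \<kappa> le k
    using that by (auto simp: supertableaux_def split: prod.splits)
  have "fst lm @ snd lm = fst lm' @ snd lm'"
  proof (rule nth_equalityI)
    show "length (fst lm @ snd lm) = length (fst lm' @ snd lm')" unfolding a(1) b(1) ..
    fix k assume "k < length (fst lm @ snd lm)"
    then show "(fst lm @ snd lm) ! k = (fst lm' @ snd lm') ! k"
      using count[OF assms(3), of k] count[OF assms(4), of k] a(1) b(1) by simp
  qed
  moreover have "length (fst lm) = length (fst lm')" unfolding a(3) b(3) ..
  ultimately have "fst lm = fst lm' \<and> snd lm = snd lm'" by (metis append_eq_append_conv)
  then show ?thesis by (simp add: prod_eq_iff)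
qed

lemma super_RSK_mem:
  assumes A: "A \<in> super_matrices m n r"
  obtains \<nu> where "\<nu> \<in> hook_partitions m n r"
    "super_RSK m r A \<in> supertableaux \<nu> (row_sums m A) \<times> supertableaux \<nu> (col_sums m A)"
proof -
  have "super_RSK m r A \<in> (\<Union>\<nu> \<in> hook_partitions m n r.
      supertableaux \<nu> (row_sums m A) \<times> supertableaux \<nu> (col_sums m A))"
    unfolding super_RSK_def
    by (rule bij_betw_apply[OF bij_super_RS[OF row_col_sums(1,2)[OF A]] matrix_perm_ex1(3)[OF A]])
  then show ?thesis by (rule UN_E) (rule that)
qed

text \<open>The contents of the two tableaux are the row and column sums, so everything reduces to
  \<open>bij_super_RS\<close> for one pair of contents. The permutation then returns the matrix
  entries as intersection numbers.\<close>

lemma bij_super_RSK: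
  "bij_betw (super_RSK m r) (super_matrices m n r)
    (\<Union>lm \<in> bicompositions m n r. \<Union>xe \<in> bicompositions m n r.
      \<Union>\<nu> \<in> hook_partitions m n r. supertableaux \<nu> lm \<times> supertableaux \<nu> xe)"
proof (rule bij_betw_imageI)
  show "inj_on (super_RSK m r) (super_matrices m n r)"
  proof (rule inj_onI)
    fix A B assume A: "A \<in> super_matrices m n r" and B: "B \<in> super_matrices m n r"
      and eq: "super_RSK m r A = super_RSK m r B"
    obtain \<nu> where \<nu>: "super_RSK m r A \<in> supertableaux \<nu> (row_sums m A) \<times> supertableaux \<nu> (col_sums m A)"
      by (rule super_RSK_mem[OF A])
    obtain \<nu>' where \<nu>': "super_RSK m r A \<in> supertableaux \<nu>' (row_sums m B) \<times> supertableaux \<nu>' (col_sums m B)"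
      unfolding eq by (rule super_RSK_mem[OF B])
    have sums: "row_sums m A = row_sums m B" "col_sums m A = col_sums m B"
      by (rule content_unique[OF row_col_sums(1)[OF A] row_col_sums(1)[OF B]
              mem_Times_iff[THEN iffD1, THEN conjunct1, OF \<nu>] mem_Times_iff[THEN iffD1, THEN conjunct1, OF \<nu>']],
          rule content_unique[OF row_col_sums(2)[OF A] row_col_sums(2)[OF B]
              mem_Times_iff[THEN iffD1, THEN conjunct2, OF \<nu>] mem_Times_iff[THEN iffD1, THEN conjunct2, OF \<nu>']])
    have "matrix_perm m r A = matrix_perm m r B"
      by (rule inj_onD[OF bij_betw_imp_inj_on[OF bij_super_RS[OF row_col_sums(1,2)[OF A]]]])
        (use eq matrix_perm_ex1(3)[OF A] matrix_perm_ex1(3)[OF B] in \<open>simp_all only: super_RSK_def sums\<close>)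
    then have "A $$ (i, j) = B $$ (i, j)" if "i < m + n" "j < m + n" for i j
      using matrix_perm_ex1(4)[OF A that] matrix_perm_ex1(4)[OF B that] sums by simp
    then show "A = B" using A B by (intro eq_matI) (auto simp: super_matrices_def)
  qed
  show "super_RSK m r ` super_matrices m n r = (\<Union>lm \<in> bicompositions m n r. \<Union>xe \<in> bicompositions m n r.
      \<Union>\<nu> \<in> hook_partitions m n r. supertableaux \<nu> lm \<times> supertableaux \<nu> xe)" (is "_ = ?U")
  proof (intro equalityI subsetI)
    fix ST assume "ST \<in> super_RSK m r ` super_matrices m n r"
    then obtain A where A: "A \<in> super_matrices m n r" "ST = super_RSK m r A" by blast
    obtain \<nu> where "\<nu> \<in> hook_partitions m n r"
        "ST \<in> supertableaux \<nu> (row_sums m A) \<times> supertableaux \<nu> (col_sums m A)"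
      unfolding A(2) by (rule super_RSK_mem[OF A(1)])
    then show "ST \<in> ?U" by (rule UN_I[OF row_col_sums(1)[OF A(1)] UN_I[OF row_col_sums(2)[OF A(1)] UN_I]])
  next
    fix ST assume "ST \<in> ?U"
    then obtain lm xe where le: "lm \<in> bicompositions m n r" "xe \<in> bicompositions m n r"
        "ST \<in> (\<Union>\<nu> \<in> hook_partitions m n r. supertableaux \<nu> lm \<times> supertableaux \<nu> xe)" by blast
    then obtain w where w: "w \<in> double_coset_reps r lm xe" "ST = super_RS r lm xe w"
      using bij_betw_imp_surj_on[OF bij_super_RS[OF le(1,2)]] by blast
    obtain A where "A \<in> super_matrices m n r" "row_sums m A = lm" "col_sums m A = xe" "matrix_perm m r A = w"
      using matrix_of_permutation[OF le(1,2) w(1)] by blast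
    then show "ST \<in> super_RSK m r ` super_matrices m n r"
      using w(2) by (intro image_eqI[of _ _ A]) (simp_all add: super_RSK_def)
  qed
qed

lemma transpose_super_matrices:
  assumes A: "A \<in> super_matrices m n r"
  shows "transpose_mat A \<in> super_matrices m n r" "row_sums m (transpose_mat A) = col_sums m A"
    "col_sums m (transpose_mat A) = row_sums m A"
proof -
  have dim: "A \<in> carrier_mat (m + n) (m + n)" "dim_row A = m + n" "dim_col A = m + n"
    and total: "(\<Sum>i<m + n. \<Sum>j<m + n. A $$ (i, j)) = r"
    and mixed: "\<And>i j. i < m + n \<Longrightarrow> j < m + n \<Longrightarrow> (i < m) \<noteq> (j < m) \<Longrightarrow> A $$ (i, j) \<in> {0, 1}"
    using A by (auto simp: super_matrices_def)
  have entry: "transpose_mat A $$ (i, j) = A $$ (j, i)" if "i < m + n" "j < m + n" for i j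
    using that dim by simp
  have "(\<Sum>i<m + n. \<Sum>j<m + n. transpose_mat A $$ (i, j)) = (\<Sum>i<m + n. \<Sum>j<m + n. A $$ (j, i))"
    by (intro sum.cong refl) (simp add: entry)
  also have "\<dots> = r" using total by (subst sum.swap)
  finally show "transpose_mat A \<in> super_matrices m n r"
    using dim(1) mixed by (auto simp: super_matrices_def entry)
  show "row_sums m (transpose_mat A) = col_sums m A" "col_sums m (transpose_mat A) = row_sums m A"
  proof -
    have "map (\<lambda>i. \<Sum>j<m + n. transpose_mat A $$ (i, j)) [0..<m + n] = map (\<lambda>j. \<Sum>i<m + n. A $$ (i, j)) [0..<m + n]"
        "map (\<lambda>j. \<Sum>i<m + n. transpose_mat A $$ (i, j)) [0..<m + n] = map (\<lambda>i. \<Sum>j<m + n. A $$ (i, j)) [0..<m + n]"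
      by (intro map_cong sum.cong refl; simp add: entry)+
    then show "row_sums m (transpose_mat A) = col_sums m A" "col_sums m (transpose_mat A) = row_sums m A"
      using dim(2,3) by (simp_all only: row_sums_def col_sums_def index_transpose_mat(2,3))
  qed
qed

text \<open>Inverting a permutation transposes its intersection numbers and exchanges the two
  monotonicity conditions.\<close>

lemma matrix_perm_transpose:
  assumes A: "A \<in> super_matrices m n r"
  shows "matrix_perm m r (transpose_mat A) = pinv (matrix_perm m r A)"
proof -
  let ?w = "matrix_perm m r A"
  note t = transpose_super_matrices[OF A] and sums = row_col_sums(1,2)[OF A]
  have dim: "dim_row A = m + n" "dim_col A = m + n"
    using A by (auto simp: super_matrices_def)
  have w: "?w permutes {1..r}"
    using matrix_perm_ex1(3)[OF A] double_coset_reps_mem[OF sums] by blast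
  show ?thesis
  proof (rule matrix_perm_ex1(2)[OF t(1)])
    show "pinv ?w \<in> double_coset_reps r (row_sums m (transpose_mat A)) (col_sums m (transpose_mat A))"
      using matrix_perm_ex1(3)[OF A] permutes_inv[OF w]
      unfolding t(2,3) double_coset_reps_mem[OF sums] double_coset_reps_mem[OF sums(2,1)] permutes_inv_inv[OF w]
      by blast
    fix i j assume ij: "i < m + n" "j < m + n"
    then show "transpose_mat A $$ (i, j) = meets (fst (row_sums m (transpose_mat A)) @ snd (row_sums m (transpose_mat A)))
        (fst (col_sums m (transpose_mat A)) @ snd (col_sums m (transpose_mat A))) (pinv ?w) i j"
      unfolding t(2,3) meets_inv[OF w] using matrix_perm_ex1(4)[OF A ij(2,1)] dim by simp
  qed
qed

text \<open>By \<open>super_RS_eq\<close> the two components come from the right parts of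
  \<open>pinv w\<close> and of \<open>w\<close>, in one common shape; inversion swaps them.\<close>

lemma super_RSK_transpose:
  assumes A: "A \<in> super_matrices m n r" and ST: "super_RSK m r A = (S, T)"
  shows "super_RSK m r (transpose_mat A) = (T, S)"
proof -
  let ?w = "matrix_perm m r A"
  note t = transpose_super_matrices[OF A]
  have w: "?w permutes {1..r}"
    using matrix_perm_ex1(3)[OF A] double_coset_reps_mem[OF row_col_sums(1,2)[OF A]] by blast
  show ?thesis
    using ST unfolding super_RSK_def t(2,3) matrix_perm_transpose[OF A] super_RS_eq[OF w]
      super_RS_eq[OF permutes_inv[OF w]] cell_partition_props(4)[OF w] permutes_inv_inv[OF w]
    by blast
qed

theorem theorem4p7:
  fixes m n r :: nat
  assumes "m \<noteq> 0 \<or> n \<noteq> 0" and "r \<ge> 1"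
  shows "(\<forall>lm \<in> bicompositions m n r. \<forall>xe \<in> bicompositions m n r.
      bij_betw (super_RS r lm xe) (double_coset_reps r lm xe)
        (\<Union>\<nu> \<in> hook_partitions m n r. supertableaux \<nu> lm \<times> supertableaux \<nu> xe)) \<and>
    bij_betw (super_RSK m r) (super_matrices m n r)
      (\<Union>lm \<in> bicompositions m n r. \<Union>xe \<in> bicompositions m n r.
        \<Union>\<nu> \<in> hook_partitions m n r. supertableaux \<nu> lm \<times> supertableaux \<nu> xe) \<and>
    (\<forall>A \<in> super_matrices m n r. \<forall>S T. super_RSK m r A = (S, T) \<longrightarrow>
      transpose_mat A \<in> super_matrices m n r \<and> super_RSK m r (transpose_mat A) = (T, S))"
proof (intro conjI ballI allI impI)
  show "bij_betw (super_RS r lm xe) (double_coset_reps r lm xe)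
      (\<Union>\<nu> \<in> hook_partitions m n r. supertableaux \<nu> lm \<times> supertableaux \<nu> xe)"
    if "lm \<in> bicompositions m n r" "xe \<in> bicompositions m n r" for lm xe
    using that by (rule bij_super_RS)
  show "bij_betw (super_RSK m r) (super_matrices m n r)
      (\<Union>lm \<in> bicompositions m n r. \<Union>xe \<in> bicompositions m n r.
        \<Union>\<nu> \<in> hook_partitions m n r. supertableaux \<nu> lm \<times> supertableaux \<nu> xe)"
    by (rule bij_super_RSK)
  fix A S T assume A: "A \<in> super_matrices m n r" and ST: "super_RSK m r A = (S, T)"
  show "transpose_mat A \<in> super_matrices m n r" by (rule transpose_super_matrices(1)[OF A])
  show "super_RSK m r (transpose_mat A) = (T, S)" by (rule super_RSK_transpose[OF A ST])
qed

end
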